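(* For any finite poset $P$ and finite multiset $\beta$ of elements of $P$, $F_{W_\beta}(\mathbf{x})=\omega X^\beta_{\mathrm{inc}(P)}(\mathbf{x})$. If moreover $P$ is a natural unit interval order, then $F_{W_\beta(t)}(\mathbf{x})=\omega X^\beta_{\mathrm{inc}(P)}(\mathbf{x},t)$.
   Context: Write $a<_Pb$ for strict order, $a\sim_Pb$ for incomparable or equal. For a word $w$, $\mathrm{Des}_P(w)=\{i:w_{i+1}<_Pw_i\}$; $Q_D(\mathbf{x})=\sum x_{i_1}\cdots x_{i_n}$ over $i_1\le\cdots\le i_n$ with $i_j<i_{j+1}$ for $j\in D$; for $\gamma=\sum_w\gamma_ww$ (coefficients in $\mathbb{Z}$ or $\mathbb{Q}(t)$), $F_\gamma=\sum_w\gamma_wQ_{\mathrm{Des}_P(w)}$. $W_\beta=\sum w$ over words of content (multiset of letters) $\beta$; $\omega$ is the involution of symmetric functions with $\omega h_\lambda=e_\lambda$. A natural unit interval order is a poset $P$ with a total order $<$ such that $a<_Pb\Rightarrow a<b$ and ($a\sim_Pb$, $b\sim_Pc$, $a<_Pc$) $\Rightarrow a<b<c$. $\mathrm{inv}_P(w)=\#\{i<j: w_i>w_j, w_i\sim_Pw_j\}$ and $W_\beta(t)=\sum t^{\mathrm{inv}_P(w)}w$ over words of content $\beta$. If $a$ has multiplicity $n_a$ in $\beta$, $P[\beta]$ is the poset with elements $a^{(1)},\dots,a^{(n_a)}$ ($a\in P$) and $a^{(i)}<b^{(j)}$ iff $a<_Pb$; for a natural unit interval order it carries the total order $a^{(1)}<\cdots<a^{(n_a)}$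 and $a^{(i)}<b^{(j)}$ whenever $a<b$. $X^\beta_{\mathrm{inc}(P)}(\mathbf{x})=\sum_\kappa\prod_{b\in P[\beta]}x_{\kappa(b)}$, over maps $\kappa:P[\beta]\to\mathbb{Z}_{\ge1}$ with $\kappa(b)\ne\kappa(b')$ whenever $b\ne b'$ are incomparable in $P[\beta]$, and $\kappa(a^{(1)})>\cdots>\kappa(a^{(n_a)})$ for each $a$. $X^\beta_{\mathrm{inc}(P)}(\mathbf{x},t)$ is the same sum weighted by $t^{\mathrm{asc}(\kappa)}$, where $\mathrm{asc}(\kappa)=\#\{(b,b'): b<b',\ b,b'\text{ incomparable in }P[\beta],\ \kappa(b)<\kappa(b')\}$. *)

theory Defs
  imports Main "HOL-Library.Multiset" "HOL-Library.FuncSet"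
    "HOL-Computational_Algebra.Polynomial"
begin

text \<open>A formal power series in x_1, x_2, ... with coefficients in 'c is represented by its
coefficient function on exponent vectors alpha :: nat => nat (alpha v = exponent of x_v).
Variables are indexed by positive integers; the index 0 is unused.\<close>

type_synonym 'c series = "(nat \<Rightarrow> nat) \<Rightarrow> 'c"

definition series_one :: "'c::comm_ring_1 series" where
  "series_one \<alpha> = (if \<alpha> = (\<lambda>_. 0) then 1 else 0)"

definition series_mult :: "'c::comm_ring_1 series \<Rightarrow> 'c series \<Rightarrow> 'c series" where
  "series_mult f g \<alpha> = (\<Sum>\<gamma>\<in>{\<gamma>. \<forall>v. \<gamma> v \<le> \<alpha> v}. f \<gamma> * g (\<lambda>v. \<alpha> v - \<gamma> v))"

definition is_monomial_deg :: "nat \<Rightarrow> (nat \<Rightarrow> nat) \<Rightarrow> bool" where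
  "is_monomial_deg k \<alpha> \<longleftrightarrow> finite {v. \<alpha> v \<noteq> 0} \<and> \<alpha> 0 = 0 \<and> (\<Sum>v\<in>{v. \<alpha> v \<noteq> 0}. \<alpha> v) = k"

definition h_sym :: "nat \<Rightarrow> 'c::comm_ring_1 series" where
  "h_sym k \<alpha> = (if is_monomial_deg k \<alpha> then 1 else 0)"

definition e_sym :: "nat \<Rightarrow> 'c::comm_ring_1 series" where
  "e_sym k \<alpha> = (if is_monomial_deg k \<alpha> \<and> (\<forall>v. \<alpha> v \<le> 1) then 1 else 0)"

definition is_partition :: "nat list \<Rightarrow> bool" where
  "is_partition lam \<longleftrightarrow> sorted (rev lam) \<and> 0 \<notin> set lam"

definition h_part :: "nat list \<Rightarrow> 'c::comm_ring_1 series" where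
  "h_part lam = foldr (\<lambda>k f. series_mult (h_sym k) f) lam series_one"

definition e_part :: "nat list \<Rightarrow> 'c::comm_ring_1 series" where
  "e_part lam = foldr (\<lambda>k f. series_mult (e_sym k) f) lam series_one"

text \<open>The involution omega on symmetric functions: the linear map with omega h_lambda = e_lambda
(well defined since the h_lambda form a basis of the ring of symmetric functions).\<close>
definition omega :: "'c::comm_ring_1 series \<Rightarrow> 'c series" where
  "omega f = (THE g. \<exists>c :: nat list \<Rightarrow> 'c.
      finite {lam. c lam \<noteq> 0} \<and> (\<forall>lam. c lam \<noteq> 0 \<longrightarrow> is_partition lam) \<and>
      f = (\<lambda>\<alpha>. \<Sum>lam\<in>{lam. c lam \<noteq> 0}. c lam * h_part lam \<alpha>) \<and>
      g = (\<lambda>\<alpha>. \<Sum>lam\<in>{lam. c lam \<noteq> 0}. c lam * e_part lam \<alpha>))"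

text \<open>Positions are 0-based: D is a set of positions j, meaning i_j < i_(j+1).\<close>
definition Q_fund :: "nat \<Rightarrow> nat set \<Rightarrow> 'c::comm_ring_1 series" where
  "Q_fund n D \<alpha> = of_nat (card {is :: nat list. length is = n \<and> sorted is \<and> (\<forall>k\<in>set is. 1 \<le> k) \<and>
       (\<forall>j\<in>D. Suc j < n \<longrightarrow> is ! j < is ! Suc j) \<and> (\<forall>v. count (mset is) v = \<alpha> v)})"

definition Des :: "('a \<Rightarrow> 'a \<Rightarrow> bool) \<Rightarrow> 'a list \<Rightarrow> nat set" where
  "Des lt w = {i. Suc i < length w \<and> lt (w ! Suc i) (w ! i)}"

text \<open>F_gamma for gamma = sum of gamma w * w over a finite set of words W.\<close>
definition F_of :: "('a \<Rightarrow> 'a \<Rightarrow> bool) \<Rightarrow> 'a list set \<Rightarrow> ('a list \<Rightarrow> 'c::comm_ring_1) \<Rightarrow> 'c series" where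
  "F_of lt W \<gamma> \<alpha> = (\<Sum>w\<in>W. \<gamma> w * Q_fund (length w) (Des lt w) \<alpha>)"

definition words :: "'a multiset \<Rightarrow> 'a list set" where
  "words \<beta> = {w. mset w = \<beta>}"

definition sim :: "('a \<Rightarrow> 'a \<Rightarrow> bool) \<Rightarrow> 'a \<Rightarrow> 'a \<Rightarrow> bool" where
  "sim lt a b \<longleftrightarrow> \<not> lt a b \<and> \<not> lt b a"

definition inv_P :: "('a \<Rightarrow> 'a \<Rightarrow> bool) \<Rightarrow> ('a \<Rightarrow> 'a \<Rightarrow> bool) \<Rightarrow> 'a list \<Rightarrow> nat" where
  "inv_P lt tot w = card {(i, j). i < j \<and> j < length w \<and> tot (w ! j) (w ! i) \<and> sim lt (w ! i) (w ! j)}"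

definition F_W :: "('a \<Rightarrow> 'a \<Rightarrow> bool) \<Rightarrow> 'a multiset \<Rightarrow> int series" where
  "F_W lt \<beta> = F_of lt (words \<beta>) (\<lambda>_. 1)"

definition F_Wt :: "('a \<Rightarrow> 'a \<Rightarrow> bool) \<Rightarrow> ('a \<Rightarrow> 'a \<Rightarrow> bool) \<Rightarrow> 'a multiset \<Rightarrow> int poly series" where
  "F_Wt lt tot \<beta> = F_of lt (words \<beta>) (\<lambda>w. monom 1 (inv_P lt tot w))"

definition Pbeta :: "'a multiset \<Rightarrow> ('a \<times> nat) set" where
  "Pbeta \<beta> = {(a, i). a \<in># \<beta> \<and> 1 \<le> i \<and> i \<le> count \<beta> a}"

definition lt_beta :: "('a \<Rightarrow> 'a \<Rightarrow> bool) \<Rightarrow> 'a \<times> nat \<Rightarrow> 'a \<times> nat \<Rightarrow> bool" where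
  "lt_beta lt b b' \<longleftrightarrow> lt (fst b) (fst b')"

definition incomp_beta :: "('a \<Rightarrow> 'a \<Rightarrow> bool) \<Rightarrow> 'a \<times> nat \<Rightarrow> 'a \<times> nat \<Rightarrow> bool" where
  "incomp_beta lt b b' \<longleftrightarrow> b \<noteq> b' \<and> \<not> lt_beta lt b b' \<and> \<not> lt_beta lt b' b"

definition tot_beta :: "('a \<Rightarrow> 'a \<Rightarrow> bool) \<Rightarrow> 'a \<times> nat \<Rightarrow> 'a \<times> nat \<Rightarrow> bool" where
  "tot_beta tot b b' \<longleftrightarrow> tot (fst b) (fst b') \<or> (fst b = fst b' \<and> snd b < snd b')"

definition colorings :: "('a \<Rightarrow> 'a \<Rightarrow> bool) \<Rightarrow> 'a multiset \<Rightarrow> (nat \<Rightarrow> nat) \<Rightarrow> ('a \<times> nat \<Rightarrow> nat) set" where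
  "colorings lt \<beta> \<alpha> = {\<kappa> \<in> extensional (Pbeta \<beta>).
      (\<forall>b\<in>Pbeta \<beta>. 1 \<le> \<kappa> b) \<and>
      (\<forall>b\<in>Pbeta \<beta>. \<forall>b'\<in>Pbeta \<beta>. incomp_beta lt b b' \<longrightarrow> \<kappa> b \<noteq> \<kappa> b') \<and>
      (\<forall>a i j. (a, i) \<in> Pbeta \<beta> \<longrightarrow> (a, j) \<in> Pbeta \<beta> \<longrightarrow> i < j \<longrightarrow> \<kappa> (a, i) > \<kappa> (a, j)) \<and>
      (\<forall>v. card {b \<in> Pbeta \<beta>. \<kappa> b = v} = \<alpha> v)}"

definition asc :: "('a \<Rightarrow> 'a \<Rightarrow> bool) \<Rightarrow> ('a \<Rightarrow> 'a \<Rightarrow> bool) \<Rightarrow> 'a multiset \<Rightarrow> ('a \<times> nat \<Rightarrow> nat) \<Rightarrow> nat" where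
  "asc lt tot \<beta> \<kappa> = card {(b, b'). b \<in> Pbeta \<beta> \<and> b' \<in> Pbeta \<beta> \<and> tot_beta tot b b' \<and>
      incomp_beta lt b b' \<and> \<kappa> b < \<kappa> b'}"

definition X_inc :: "('a \<Rightarrow> 'a \<Rightarrow> bool) \<Rightarrow> 'a multiset \<Rightarrow> int series" where
  "X_inc lt \<beta> \<alpha> = int (card (colorings lt \<beta> \<alpha>))"

definition X_inc_t :: "('a \<Rightarrow> 'a \<Rightarrow> bool) \<Rightarrow> ('a \<Rightarrow> 'a \<Rightarrow> bool) \<Rightarrow> 'a multiset \<Rightarrow> int poly series" where
  "X_inc_t lt tot \<beta> \<alpha> = (\<Sum>\<kappa>\<in>colorings lt \<beta> \<alpha>. monom 1 (asc lt tot \<beta> \<kappa>))"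

definition strict_poset :: "'a set \<Rightarrow> ('a \<Rightarrow> 'a \<Rightarrow> bool) \<Rightarrow> bool" where
  "strict_poset P lt \<longleftrightarrow> (\<forall>a b. lt a b \<longrightarrow> a \<in> P \<and> b \<in> P) \<and> (\<forall>a\<in>P. \<not> lt a a) \<and>
     (\<forall>a\<in>P. \<forall>b\<in>P. \<forall>c\<in>P. lt a b \<longrightarrow> lt b c \<longrightarrow> lt a c)"

definition nuio :: "'a set \<Rightarrow> ('a \<Rightarrow> 'a \<Rightarrow> bool) \<Rightarrow> ('a \<Rightarrow> 'a \<Rightarrow> bool) \<Rightarrow> bool" where
  "nuio P lt tot \<longleftrightarrow>
     (\<forall>a b. tot a b \<longrightarrow> a \<in> P \<and> b \<in> P) \<and> (\<forall>a\<in>P. \<not> tot a a) \<and>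
     (\<forall>a\<in>P. \<forall>b\<in>P. \<forall>c\<in>P. tot a b \<longrightarrow> tot b c \<longrightarrow> tot a c) \<and>
     (\<forall>a\<in>P. \<forall>b\<in>P. a \<noteq> b \<longrightarrow> tot a b \<or> tot b a) \<and>
     (\<forall>a\<in>P. \<forall>b\<in>P. lt a b \<longrightarrow> tot a b) \<and>
     (\<forall>a\<in>P. \<forall>b\<in>P. \<forall>c\<in>P. sim lt a b \<longrightarrow> sim lt b c \<longrightarrow> lt a c \<longrightarrow> tot a b \<and> tot b c)"

end

theory Submission
  imports Defs "HOL-Library.Function_Algebras" "HOL-Combinatorics.List_Permutation"
begin

text \<open>In a ring with elements u_a indexed by the letters, let e_k be the sum of u_w over the strictly
decreasing words w of length k, and h_k the sum over the words of length k without descents; then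
the alternating sums of e_i h_(n-i) vanish for n > 0. Take u_a to be the operator that removes the
letter a from a multiset and multiplies by t for every smaller incomparable letter left behind.
Cutting words into blocks of equal index, the coefficient of x^alpha in F is the vacuum coefficient
of the product of the h_(alpha_i); peeling off the largest color, that of X is the vacuum
coefficient of the product of the e_(alpha_i). When the e_k commute (trivially for t = 1, and for
natural unit interval orders by an induction over initial segments), both series are symmetric and
are exchanged by the involution on coefficient functions that replaces every block by the signed sum
over its compositions. This involution exchanges h_lambda and e_lambda, and F lies in the span of the
e_lambda because it is symmetric, hence omega X = F.\<close>

section \<open>The ring of endomorphisms of an abelian group\<close>

text \<open>\<open>omega\<close> is a definite description over all expansions in the
  \<open>h_part\<close>, so an expansion must be exhibited and all expansions must be shown to have
  the same image. The second point is why the involution is computed from the coefficients alone.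
  The first is settled on the elementary side: F is eliminated against elementary products whose
  leading coefficient is 1, so the expansion stays over \<open>int\<close> or
  \<open>int poly\<close>, and the involution carries it to an expansion of X. The difficulty in the
  graded case is commutation. Splitting letters off an initial segment creates commutators between
  chain sums of two nested segments. These are in general nonzero; what survives is that they are
  symmetric in the two degrees, and this symmetry is carried through the induction as a companion
  statement. Commutation is used more than once: it makes F symmetric, it lets the relation between
  the two families be read in both directions, and it undoes the reversed order in which peeling
  colors from the top produces the factors of X.\<close>

typedef (overloaded) 'v endo = "{f :: 'v::ab_group_add \<Rightarrow> 'v. \<forall>x y. f (x + y) = f x + f y}"
  morphisms app Endo
  by (rule exI[of _ id]) simp

setup_lifting type_definition_endo

text \<open>The letter operators do not commute, so they need a type of class \<open>ring_1\<close>
  before sums and products over words can be formed; composition is the product. Scalars enter later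
  as further operators.\<close>

instantiation endo :: (ab_group_add) ring
begin

lift_definition zero_endo :: "'a endo" is "\<lambda>_. 0" by simp
lift_definition plus_endo :: "'a endo \<Rightarrow> 'a endo \<Rightarrow> 'a endo" is "\<lambda>f g x. f x + g x"
  by (simp add: algebra_simps)
lift_definition uminus_endo :: "'a endo \<Rightarrow> 'a endo" is "\<lambda>f x. - f x"
  by (simp add: algebra_simps)
lift_definition minus_endo :: "'a endo \<Rightarrow> 'a endo \<Rightarrow> 'a endo" is "\<lambda>f g x. f x - g x"
  by (simp add: algebra_simps)
lift_definition times_endo :: "'a endo \<Rightarrow> 'a endo \<Rightarrow> 'a endo" is "\<lambda>f g x. f (g x)"
  by simp

instance
  by standard (transfer; simp add: algebra_simps)+

end

instantiation endo :: ("{ab_group_add, zero_neq_one}") ring_1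
begin

lift_definition one_endo :: "'a endo" is "\<lambda>x. x" by simp

instance
proof
  fix a :: "'a endo"
  show "1 * a = a" "a * 1 = a" by (transfer; simp)+
  show "(0 :: 'a endo) \<noteq> 1" by transfer (metis zero_neq_one)
qed

end

section \<open>Decreasing words and descent-free words\<close>

text \<open>The predicate is a parameter because a product of such sums is again one, with a
  predicate on the pieces of the concatenated word.\<close>

definition word_sum :: "('a \<Rightarrow> 'r::ring_1) \<Rightarrow> ('a list \<Rightarrow> bool) \<Rightarrow> 'a set \<Rightarrow> nat \<Rightarrow> 'r" where
  "word_sum u Q A k = (\<Sum>w\<in>{w. set w \<subseteq> A \<and> length w = k \<and> Q w}. prod_list (map u w))"

definition decreasing :: "('a \<Rightarrow> 'a \<Rightarrow> bool) \<Rightarrow> 'a list \<Rightarrow> bool" where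
  "decreasing lt = sorted_wrt (\<lambda>a b. lt b a)"

definition descent_free :: "('a \<Rightarrow> 'a \<Rightarrow> bool) \<Rightarrow> 'a list \<Rightarrow> bool" where
  "descent_free lt = successively (\<lambda>a b. \<not> lt b a)"

lemma finite_words: "finite A \<Longrightarrow> finite {w. set w \<subseteq> A \<and> length w = k \<and> Q w}"
  by (rule finite_subset[OF _ finite_lists_length_eq[of A k]]) auto

lemma word_sum_0: "Q [] \<Longrightarrow> word_sum u Q A 0 = 1"
proof -
  assume "Q []"
  then have "{w. set w \<subseteq> A \<and> length w = 0 \<and> Q w} = {[]}" by auto
  then show ?thesis by (simp add: word_sum_def)
qed

lemma word_sum_mult:
  assumes "finite A"
  shows "word_sum u Q A i * word_sum u Q' A j =
    word_sum u (\<lambda>w. Q (take i w) \<and> Q' (drop i w)) A (i + j)"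
proof -
  let ?V = "{w. set w \<subseteq> A \<and> length w = i \<and> Q w}" and ?W = "{w. set w \<subseteq> A \<and> length w = j \<and> Q' w}"
  have "word_sum u Q A i * word_sum u Q' A j =
      (\<Sum>(v, w)\<in>?V \<times> ?W. prod_list (map u (v @ w)))"
    by (simp add: word_sum_def sum_product sum.cartesian_product)
  also have "\<dots> = word_sum u (\<lambda>w. Q (take i w) \<and> Q' (drop i w)) A (i + j)"
    unfolding word_sum_def
    by (rule sum.reindex_bij_witness[where i = "\<lambda>w. (take i w, drop i w)" and j = "\<lambda>(v, w). v @ w"])
       (auto dest: in_set_takeD in_set_dropD)
  finally show ?thesis .
qed

text \<open>Whether \<open>R\<close> holds between the first two letters decides which cuts survive.
  If it fails, only the cuts before and after the first letter can contribute, and they cancel. If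
  it holds, the cut at 0 contributes nothing, and the others give the negative of the sum for the
  tail.\<close>

lemma alternating_split_sum:
  fixes R :: "'a \<Rightarrow> 'a \<Rightarrow> bool"
  assumes "x \<noteq> []"
  shows "(\<Sum>k\<le>length x. (-1) ^ k *
    (if successively R (take k x) \<and> successively (\<lambda>a b. \<not> R a b) (drop k x) then 1 else 0 :: int)) = 0"
  using assms
proof (induction x rule: induct_list012)
  case (3 a b y)
  let ?f = "\<lambda>x k. (-1) ^ k *
    (if successively R (take k x) \<and> successively (\<lambda>a b. \<not> R a b) (drop k x) then 1 else 0 :: int)"
  let ?z = "if successively (\<lambda>a b. \<not> R a b) (b # y) then 1 else 0 :: int"
  let ?r = "if R a b then 1 else 0 :: int"
  have "(\<Sum>k\<le>length (b # y). ?f (b # y) k) = 0"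
    using "3.IH"(2) by blast
  then have tail: "(\<Sum>k\<le>length y. ?f (b # y) (Suc k)) = - ?z"
    by (subst (asm) length_Cons, subst (asm) sum.atMost_Suc_shift) simp
  have "(\<Sum>k\<le>length (a # b # y). ?f (a # b # y) k) =
      ?f (a # b # y) 0 + (?f (a # b # y) (Suc 0) + (\<Sum>k\<le>length y. ?f (a # b # y) (Suc (Suc k))))"
    by (simp only: length_Cons sum.atMost_Suc_shift)
  also have "(\<Sum>k\<le>length y. ?f (a # b # y) (Suc (Suc k))) = (\<Sum>k\<le>length y. - ?r * ?f (b # y) (Suc k))"
    by (rule sum.cong) auto
  also have "\<dots> = ?r * ?z"
    by (simp only: sum_distrib_left[symmetric] tail minus_mult_minus)
  finally show ?case by auto
qed simp_all

text \<open>Words that are strictly decreasing up to some point and descent free after it come in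
pairs of opposite sign, since the splitting point can be moved past one letter.\<close>

lemma decreasing_descent_free_convolution:
  fixes u :: "'a \<Rightarrow> 'r::ring_1"
  assumes "finite A" and trans: "\<And>a b c. lt a b \<Longrightarrow> lt b c \<Longrightarrow> lt a c" and "n > 0"
  shows "(\<Sum>k\<le>n. (-1) ^ k * (word_sum u (decreasing lt) A k * word_sum u (descent_free lt) A (n - k))) = 0"
proof -
  let ?W = "{w. set w \<subseteq> A \<and> length w = n}"
  let ?c = "\<lambda>k x. (-1) ^ k * (if successively (\<lambda>a b. lt b a) (take k x) \<and>
      successively (\<lambda>a b. \<not> lt b a) (drop k x) then 1 else 0 :: int)"
  have fin: "finite ?W" using finite_words[OF assms(1), of n "\<lambda>_. True"] by simp
  \<comment> \<open>Transitivity turns the pairwise condition into one on neighbours, so the two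
    pieces of a cut word are governed by complementary relations.\<close>
  have dec: "decreasing lt = successively (\<lambda>a b. lt b a)"
    unfolding decreasing_def
    by (rule ext, subst successively_conv_sorted_wrt) (auto simp: transp_def intro: trans)
  have "(\<Sum>k\<le>n. (-1) ^ k * (word_sum u (decreasing lt) A k * word_sum u (descent_free lt) A (n - k)))
      = (\<Sum>k\<le>n. \<Sum>x\<in>?W. of_int (?c k x) * prod_list (map u x))"
  proof (rule sum.cong[OF refl])
    fix k assume "k \<in> {..n}"
    then have n: "k + (n - k) = n" by simp
    have "word_sum u (decreasing lt) A k * word_sum u (descent_free lt) A (n - k) =
        (\<Sum>x\<in>?W. if decreasing lt (take k x) \<and> descent_free lt (drop k x) then prod_list (map u x) else 0)"
      unfolding word_sum_mult[OF assms(1)] n unfolding word_sum_def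
      by (subst sum.inter_filter[OF fin, symmetric]) (rule sum.cong; auto)
    then show "(-1) ^ k * (word_sum u (decreasing lt) A k * word_sum u (descent_free lt) A (n - k)) =
        (\<Sum>x\<in>?W. of_int (?c k x) * prod_list (map u x))"
      by (auto simp: sum_distrib_left dec descent_free_def intro!: sum.cong)
  qed
  also have "\<dots> = (\<Sum>x\<in>?W. of_int (\<Sum>k\<le>n. ?c k x) * prod_list (map u x))"
    by (subst sum.swap) (simp only: sum_distrib_right of_int_sum)
  also have "\<dots> = 0"
  proof (rule sum.neutral, rule ballI)
    fix x assume x: "x \<in> ?W"
    then have "x \<noteq> []" using \<open>n > 0\<close> by auto
    from alternating_split_sum[OF this, of "\<lambda>a b. lt b a"] x
    have "(\<Sum>k\<le>n. ?c k x) = 0" by simp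
    then show "of_int (\<Sum>k\<le>n. ?c k x) * prod_list (map u x) = 0"
      by (simp only: of_int_0 mult_zero_left)
  qed
  finally show ?thesis .
qed

section \<open>Commuting chain sums for natural unit interval orders\<close>

abbreviation chain_sum :: "('a \<Rightarrow> 'r::ring_1) \<Rightarrow> ('a \<Rightarrow> 'a \<Rightarrow> bool) \<Rightarrow> 'a set \<Rightarrow> nat \<Rightarrow> 'r" where
  "chain_sum u lt \<equiv> word_sum u (decreasing lt)"

text \<open>The first letter of a decreasing word dominates the others. If it lies in the
  down-closed set \<open>A\<close>, the whole word does; if it is some \<open>j\<close> outside
  \<open>A\<close>, what follows is an arbitrary decreasing word over the elements below
  \<open>j\<close>.\<close>

lemma chain_sum_split:
  assumes "finite B" "A \<subseteq> B"
    and down: "\<And>a b. a \<in> A \<Longrightarrow> b \<in> B \<Longrightarrow> lt b a \<Longrightarrow> b \<in> A"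
    and sub: "\<And>j b. j \<in> B - A \<Longrightarrow> lt b j \<Longrightarrow> b \<in> B"
    and trans: "\<And>a b c. lt a b \<Longrightarrow> lt b c \<Longrightarrow> lt a c"
  shows "chain_sum u lt B (Suc k) =
    chain_sum u lt A (Suc k) + (\<Sum>j\<in>B - A. u j * chain_sum u lt {b. lt b j} k)"
proof -
  let ?W = "\<lambda>A k. {w. set w \<subseteq> A \<and> length w = k \<and> decreasing lt w}"
  have fin: "finite (?W {b. lt b j} k)" if "j \<in> B - A" for j
    using finite_words[of "{b. lt b j}" k "decreasing lt"] that sub finite_subset[OF _ assms(1), of "{b. lt b j}"]
    by blast
  have split: "?W B (Suc k) = ?W A (Suc k) \<union> (\<lambda>(j, w). j # w) ` (SIGMA j:B - A. ?W {b. lt b j} k)"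
    (is "_ = _ \<union> ?R")
  proof (rule set_eqI, rule iffI)
    fix w assume w: "w \<in> ?W B (Suc k)"
    then obtain j v where [simp]: "w = j # v" by (cases w) auto
    have v: "set v \<subseteq> B" "length v = k" "decreasing lt v" "j \<in> B" "\<forall>b\<in>set v. lt b j"
      using w by (auto simp: decreasing_def)
    show "w \<in> ?W A (Suc k) \<union> ?R"
    proof (cases "j \<in> A")
      case True
      then have "set v \<subseteq> A" using v(1,5) down by blast
      then show ?thesis using True w by auto
    next
      case False
      then have "(j, v) \<in> (SIGMA j:B - A. ?W {b. lt b j} k)" using v by auto
      then show ?thesis by (auto simp: image_iff)
    qed
  next
    fix w assume "w \<in> ?W A (Suc k) \<union> ?R"
    then show "w \<in> ?W B (Suc k)"
      using assms(2) sub by (auto simp: decreasing_def)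
  qed
  have "chain_sum u lt B (Suc k) = chain_sum u lt A (Suc k) + (\<Sum>w\<in>?R. prod_list (map u w))"
    unfolding word_sum_def split
  proof (rule sum.union_disjoint)
    show "finite (?W A (Suc k))"
      using finite_words[of A] assms(1,2) finite_subset by blast
    show "finite ?R" using fin assms(1) by blast
  qed auto
  also have "(\<Sum>w\<in>?R. prod_list (map u w)) =
      (\<Sum>(j, w)\<in>(SIGMA j:B - A. ?W {b. lt b j} k). u j * prod_list (map u w))"
    by (subst sum.reindex) (auto simp: inj_on_def intro!: sum.cong)
  also have "\<dots> = (\<Sum>j\<in>B - A. u j * chain_sum u lt {b. lt b j} k)"
    using fin assms(1) by (simp add: sum.Sigma[symmetric] sum_distrib_left word_sum_def)
  finally show ?thesis .
qed

lemma prod_list_commute: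
  fixes x :: "'r::monoid_mult"
  assumes "\<And>y. y \<in> set ys \<Longrightarrow> x * y = y * x"
  shows "x * prod_list ys = prod_list ys * x"
  using assms
proof (induction ys)
  case (Cons y ys)
  have "x * prod_list (y # ys) = (x * y) * prod_list ys" by (simp add: mult.assoc)
  also have "\<dots> = y * (x * prod_list ys)" using Cons.prems by (simp add: mult.assoc)
  also have "\<dots> = prod_list (y # ys) * x" using Cons by (simp add: mult.assoc)
  finally show ?case .
qed simp

lemma word_sum_commute:
  assumes "\<And>a. a \<in> A \<Longrightarrow> x * u a = u a * x"
  shows "x * word_sum u Q A k = word_sum u Q A k * x"
  unfolding word_sum_def sum_distrib_left sum_distrib_right
  by (rule sum.cong[OF refl], rule prod_list_commute) (use assms in auto)

text \<open>These relations are all that the commutation argument uses of the letter operators.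
  \<open>T\<close> stands for multiplication by t; in an abstract ring it is an element that
  commutes with the letters.\<close>

locale unit_interval_relations =
  fixes P :: "'a set" and lt tot :: "'a \<Rightarrow> 'a \<Rightarrow> bool" and u :: "'a \<Rightarrow> 'r::ring_1" and T :: 'r
  assumes finite_P: "finite P" and poset: "strict_poset P lt" and nuio: "nuio P lt tot"
    and T_commute: "\<And>a. a \<in> P \<Longrightarrow> T * u a = u a * T"
    and u_commute: "\<And>a b. lt a b \<Longrightarrow> u b * u a = u a * u b"
    and u_quantum: "\<And>a b. tot a b \<Longrightarrow> sim lt a b \<Longrightarrow> u b * u a = T * u a * u b"
begin

abbreviation "E \<equiv> chain_sum u lt"

abbreviation below :: "'a \<Rightarrow> 'a set" where
  "below j \<equiv> {b. lt b j}"

definition initial :: "'a set \<Rightarrow> bool" where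
  "initial A \<longleftrightarrow> A \<subseteq> P \<and> (\<forall>a\<in>A. \<forall>b. tot b a \<longrightarrow> b \<in> A)"

section \<open>Order facts and sets of predecessors in a unit interval order\<close>

lemma lt_trans: "lt a b \<Longrightarrow> lt b c \<Longrightarrow> lt a c"
  using poset unfolding strict_poset_def by blast

lemma lt_irrefl [simp]: "\<not> lt a a"
  using poset unfolding strict_poset_def by blast

lemma lt_P: "lt a b \<Longrightarrow> a \<in> P" "lt a b \<Longrightarrow> b \<in> P"
  using poset unfolding strict_poset_def by blast+

lemma tot_P: "tot a b \<Longrightarrow> a \<in> P" "tot a b \<Longrightarrow> b \<in> P"
  using nuio unfolding nuio_def by blast+

lemma tot_trans: "tot a b \<Longrightarrow> tot b c \<Longrightarrow> tot a c"
  using nuio unfolding nuio_def by metis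

lemma tot_irrefl [simp]: "\<not> tot a a"
  using nuio unfolding nuio_def by blast

lemma tot_asym: "tot a b \<Longrightarrow> \<not> tot b a"
  using tot_trans[of a b a] by auto

lemma tot_total: "a \<in> P \<Longrightarrow> b \<in> P \<Longrightarrow> a \<noteq> b \<Longrightarrow> tot a b \<or> tot b a"
  using nuio unfolding nuio_def by blast

lemma lt_tot: "lt a b \<Longrightarrow> tot a b"
  using nuio lt_P unfolding nuio_def by metis

lemma sim_sim_lt: "sim lt a b \<Longrightarrow> sim lt b c \<Longrightarrow> lt a c \<Longrightarrow> b \<in> P \<Longrightarrow> tot a b \<and> tot b c"
  using nuio lt_P unfolding nuio_def by metis

text \<open>Otherwise \<open>x\<close>, \<open>i\<close> and \<open>i\<close>, \<open>j\<close> are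
  incomparable pairs, and the axiom on incomparable triples, applied to \<open>x\<close>,
  \<open>i\<close>, \<open>j\<close>, places \<open>i\<close> before \<open>j\<close>.\<close>

lemma below_mono: "lt x i" if "lt x j" "tot j i"
proof (rule ccontr)
  assume "\<not> lt x i"
  moreover have "\<not> lt i x" using that lt_tot tot_trans tot_asym by blast
  ultimately have "sim lt x i" by (simp add: sim_def)
  moreover have "sim lt i j" using that lt_trans lt_tot tot_asym \<open>\<not> lt x i\<close> unfolding sim_def by blast
  ultimately show False using sim_sim_lt[of x i j] that tot_asym tot_P by blast
qed

text \<open>Here the axiom is applied to \<open>x\<close>, \<open>y\<close>, \<open>i\<close>. With
  the preceding fact, the sets \<open>below i\<close> are initial segments that grow with
  \<open>i\<close>; the later argument uses the axiom only in this form.\<close>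

lemma below_down: "lt y i" if "lt x i" "tot y x"
proof (rule ccontr)
  assume "\<not> lt y i"
  moreover have "\<not> lt i y" using that lt_tot tot_trans tot_asym by blast
  ultimately have "sim lt y i" by (simp add: sim_def)
  moreover have "sim lt x y" using that lt_trans lt_tot tot_asym \<open>\<not> lt y i\<close> unfolding sim_def by blast
  ultimately show False using sim_sim_lt[of x y i] that tot_asym tot_P by blast
qed

lemma initial_below: "initial (below i)"
  unfolding initial_def using below_down lt_P by blast

lemma below_subset: "below j \<subseteq> below i" if "tot j i"
  using below_mono that by blast

lemma initial_finite: "initial A \<Longrightarrow> finite A"
  unfolding initial_def using finite_P finite_subset by blast

lemma initial_tot: "initial A \<Longrightarrow> a \<in> A \<Longrightarrow> i \<in> P \<Longrightarrow> i \<notin> A \<Longrightarrow> tot a i"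
  unfolding initial_def using tot_total by blast

lemma initial_lt: "initial A \<Longrightarrow> a \<in> A \<Longrightarrow> lt b a \<Longrightarrow> b \<in> A"
  unfolding initial_def using lt_tot by blast

section \<open>Chain sums of initial segments\<close>

lemma E_0 [simp]: "E A 0 = 1"
  by (simp add: word_sum_0 decreasing_def)

lemma E_split:
  assumes "initial B" "initial A" "A \<subseteq> B"
  shows "E B (Suc k) = E A (Suc k) + (\<Sum>j\<in>B - A. u j * E (below j) k)"
  by (rule chain_sum_split) (use assms initial_finite initial_lt lt_trans in blast)+

lemma T_E: "A \<subseteq> P \<Longrightarrow> T * E A k = E A k * T"
  using T_commute by (intro word_sum_commute) auto

lemma u_E_below: "u i * E A k = E A k * u i" if "A \<subseteq> below i"
  by (rule word_sum_commute) (use that u_commute in auto)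

text \<open>A chain in an initial segment whose elements all precede i contains at most one element
incomparable to i.\<close>

lemma u_E:
  assumes "initial A" "i \<in> P" "i \<notin> A" "below i \<subseteq> A"
  shows "u i * E A k = (E (below i) k + T * (E A k - E (below i) k)) * u i"
proof (cases k)
  case (Suc k')
  have D: "E A k - E (below i) k = (\<Sum>j\<in>A - below i. u j * E (below j) k')"
    using E_split[OF assms(1) initial_below assms(4)] by (simp add: Suc)
  have "u i * (E A k - E (below i) k) = T * (E A k - E (below i) k) * u i"
    unfolding D sum_distrib_left sum_distrib_right
  proof (rule sum.cong[OF refl])
    fix j assume j: "j \<in> A - below i"
    then have ji: "tot j i" using assms initial_tot by blast
    then have "sim lt j i" using j lt_tot tot_asym by (auto simp: sim_def)
    then have "u i * u j = T * u j * u i" using u_quantum ji by blast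
    then have "u i * (u j * E (below j) k') = T * u j * (u i * E (below j) k')"
      by (metis mult.assoc)
    also have "\<dots> = T * (u j * E (below j) k') * u i"
      using u_E_below[OF below_subset[OF ji]] by (simp add: mult.assoc)
    finally show "u i * (u j * E (below j) k') = T * (u j * E (below j) k') * u i" .
  qed
  moreover have "u i * E (below i) k = E (below i) k * u i" by (simp add: u_E_below)
  ultimately show ?thesis by (simp add: algebra_simps)
qed simp

section \<open>Commutation by induction on initial segments\<close>

definition commuting :: "'a set \<Rightarrow> bool" where
  "commuting A \<longleftrightarrow> (\<forall>p q. E A p * E A q = E A q * E A p)"

text \<open>Chain sums of nested segments need not commute: two incomparable letters a, b with A =
  {a} and B = {a, b} already leave a multiple of 1 - T in degrees 1 and 1. The property kept is that
  the commutator does not change when the degrees are exchanged.\<close>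

definition interlacing :: "'a set \<Rightarrow> 'a set \<Rightarrow> bool" where
  "interlacing A B \<longleftrightarrow> (\<forall>p q. E A p * E B q - E B q * E A p = E A q * E B p - E B p * E A q)"

text \<open>The last condition says that a chain in \<open>B\<close> can leave \<open>A\<close> only
  with its first letter.\<close>

definition cover :: "'a set \<Rightarrow> 'a set \<Rightarrow> bool" where
  "cover A B \<longleftrightarrow> initial A \<and> initial B \<and> A \<subseteq> B \<and> (\<forall>j\<in>B. below j \<subseteq> A)"

lemma cover_below: "cover (below i) A" if "initial A" "i \<in> P" "i \<notin> A" "below i \<subseteq> A"
  unfolding cover_def using that initial_below below_subset initial_tot by blast

text \<open>Each letter \<open>u i\<close> with \<open>i\<close> in \<open>B - A\<close> is moved to
  the right end. The twist by \<open>T\<close> is chosen so that the coefficient left in front of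
  \<open>u i\<close> is \<open>G i p q\<close>: its outer terms are symmetric in \<open>p\<close>
  and \<open>q\<close> by commutation in \<open>below i\<close>, its middle commutator by
  interlacing of \<open>below i\<close> with \<open>A\<close>. Both induction steps rest on this
  identity.\<close>

lemma twisted_difference_symmetric:
  assumes AB: "cover A B"
    and comm: "\<And>i. i \<in> B - A \<Longrightarrow> commuting (below i)"
    and inter: "\<And>i. i \<in> B - A \<Longrightarrow> interlacing (below i) A"
  defines "D \<equiv> \<lambda>k. E B k - E A k"
  shows "D (Suc p) * E A q - T * E A q * D (Suc p) = D (Suc q) * E A p - T * E A p * D (Suc q)"
proof -
  define G where "G i p q = E (below i) p * E (below i) q
    + T * (E (below i) p * E A q - E A q * E (below i) p) - T * E (below i) p * E (below i) q" for i p q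
  have D: "D (Suc p) = (\<Sum>i\<in>B - A. E (below i) p * u i)" for p
    unfolding D_def using E_split[of B A p] AB u_E_below[OF order_refl] by (simp add: cover_def)
  have eq: "D (Suc p) * E A q - T * E A q * D (Suc p) = (\<Sum>i\<in>B - A. G i p q * u i)" for p q
    unfolding D sum_distrib_left sum_distrib_right sum_subtractf[symmetric]
  proof (rule sum.cong[OF refl])
    fix i assume i: "i \<in> B - A"
    have iP: "i \<in> P" "i \<notin> A" "below i \<subseteq> A" "initial A"
      using i AB unfolding cover_def initial_def by auto
    have TE: "T * E (below i) p = E (below i) p * T"
      by (rule T_E) (use lt_P in auto)
    have "E (below i) p * u i * E A q = E (below i) p * (E (below i) q + T * (E A q - E (below i) q)) * u i"
      using u_E[OF iP(4,1,2,3), of q] by (simp add: mult.assoc)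
    also have "\<dots> = (E (below i) p * E (below i) q + (E (below i) p * T) * (E A q - E (below i) q)) * u i"
      by (simp add: algebra_simps)
    finally show "E (below i) p * u i * E A q - T * E A q * (E (below i) p * u i) = G i p q * u i"
      unfolding TE[symmetric] G_def by (simp add: algebra_simps)
  qed
  have "G i p q = G i q p" if "i \<in> B - A" for i
    using comm[OF that] inter[OF that] unfolding G_def commuting_def interlacing_def
    by (metis (no_types, lifting) mult.assoc)
  then show ?thesis unfolding eq by simp
qed

text \<open>Since \<open>A\<close> commutes with itself, only the letters \<open>j\<close> in
  \<open>B - A\<close> contribute to the commutator. The contribution of \<open>j\<close> is the
  twisted difference for \<open>below j\<close> inside \<open>A\<close>, times \<open>u j\<close>,
  and that difference is symmetric in the degrees.\<close>

lemma chain_sums_interlacing_aux: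
  assumes AB: "cover A B" and "commuting A"
    and comm: "\<And>j. j \<in> B \<Longrightarrow> commuting (below j)"
    and inter: "\<And>j C. j \<in> B \<Longrightarrow> cover C (below j) \<Longrightarrow> interlacing C (below j)"
  shows "interlacing A B"
proof -
  have S: "(E A (Suc p) - E (below j) (Suc p)) * E (below j) q
      - T * E (below j) q * (E A (Suc p) - E (below j) (Suc p))
    = (E A (Suc q) - E (below j) (Suc q)) * E (below j) p
      - T * E (below j) p * (E A (Suc q) - E (below j) (Suc q))" if j: "j \<in> B - A" for p q j
  proof (rule twisted_difference_symmetric)
    have jP: "j \<in> P" "j \<notin> A" "below j \<subseteq> A" "initial A"
      using j AB unfolding cover_def initial_def by auto
    show "cover (below j) A" by (rule cover_below) (use jP in auto)
    fix i assume i: "i \<in> A - below j"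
    then have iB: "i \<in> B" using AB unfolding cover_def by auto
    show "commuting (below i)" using comm iB .
    have "tot i j" using initial_tot jP i by blast
    then have "cover (below i) (below j)"
      using cover_below[OF initial_below, of i j] i jP below_subset[of i j] unfolding initial_def by blast
    then show "interlacing (below i) (below j)" using inter j by blast
  qed
  have eq: "E A p * E B (Suc q) - E B (Suc q) * E A p =
      (\<Sum>j\<in>B - A. ((E A p - E (below j) p) * E (below j) q - T * E (below j) q * (E A p - E (below j) p)) * u j)"
    for p q
  proof -
    have "E A p * E B (Suc q) - E B (Suc q) * E A p =
        (\<Sum>j\<in>B - A. E A p * (u j * E (below j) q) - (u j * E (below j) q) * E A p)"
      using AB assms(2) E_split[of B A q]
      by (simp add: cover_def commuting_def sum_subtractf distrib_left distrib_right sum_distrib_left sum_distrib_right)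
    also have "\<dots> = (\<Sum>j\<in>B - A. ((E A p - E (below j) p) * E (below j) q
        - T * E (below j) q * (E A p - E (below j) p)) * u j)"
    proof (rule sum.cong[OF refl])
      fix j assume j: "j \<in> B - A"
      have jP: "j \<in> P" "j \<notin> A" "below j \<subseteq> A" "initial A"
        using j AB unfolding cover_def initial_def by auto
      have c: "u j * E (below j) q = E (below j) q * u j" by (rule u_E_below) simp
      have T: "E (below j) q * T = T * E (below j) q"
        by (rule T_E[symmetric]) (use lt_P in auto)
      have cc: "E (below j) q * E (below j) p = E (below j) p * E (below j) q"
        using comm j unfolding commuting_def by blast
      have "(u j * E (below j) q) * E A p = E (below j) q * (u j * E A p)"
        by (simp only: c mult.assoc)
      also have "\<dots> = (E (below j) q * E (below j) p + (E (below j) q * T) * (E A p - E (below j) p)) * u j"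
        unfolding u_E[OF jP(4,1,2,3)] by (simp add: algebra_simps)
      finally show "E A p * (u j * E (below j) q) - (u j * E (below j) q) * E A p =
        ((E A p - E (below j) p) * E (below j) q - T * E (below j) q * (E A p - E (below j) p)) * u j"
        unfolding c T cc by (simp add: algebra_simps)
    qed
    finally show ?thesis .
  qed
  show ?thesis
    unfolding interlacing_def
  proof (intro allI)
    fix p q
    show "E A p * E B q - E B q * E A p = E A q * E B p - E B p * E A q"
    proof (cases p; cases q)
      fix p' q' assume [simp]: "p = Suc p'" "q = Suc q'"
      show ?thesis
        unfolding \<open>q = Suc q'\<close> \<open>p = Suc p'\<close> eq
        by (rule sum.cong[OF refl]) (simp only: S)
    next
      fix p' assume [simp]: "p = Suc p'" "q = 0"
      show ?thesis using eq[of 0 p'] by simp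
    next
      fix q' assume [simp]: "p = 0" "q = Suc q'"
      show ?thesis using eq[of 0 q'] by simp
    qed simp
  qed
qed

text \<open>With \<open>u n\<close> moved to the right, a product of two chain sums of
  \<open>insert n A\<close> has degree at most two in \<open>u n\<close>. The constant part is
  symmetric by commutation in \<open>A\<close> and the quadratic part by commutation in
  \<open>below n\<close>. The linear part splits into a part in \<open>e\<close> alone and a part
  containing \<open>D\<close>; symmetry of the latter is the twisted difference identity with its
  \<open>T\<close> terms moved across.\<close>

lemma chain_sums_commuting_aux:
  assumes "initial A" "n \<in> P" "n \<notin> A" "initial (insert n A)" "commuting A" "below n \<subseteq> A"
    and comm: "\<And>j. j \<in> insert n A \<Longrightarrow> commuting (below j)"
    and inter: "\<And>C. cover C (below n) \<Longrightarrow> interlacing C (below n)"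
  shows "commuting (insert n A)"
proof -
  let ?B = "insert n A"
  define e where "e = E (below n)"
  define D where "D k = E A k - e k" for k
  have S: "D (Suc p) * e q - T * e q * D (Suc p) = D (Suc q) * e p - T * e p * D (Suc q)" for p q
    unfolding D_def e_def
  proof (rule twisted_difference_symmetric)
    show "cover (below n) A" by (rule cover_below) (use assms in auto)
    fix i assume i: "i \<in> A - below n"
    show "commuting (below i)" using comm i by blast
    have "tot i n" using initial_tot i assms by blast
    then have "cover (below i) (below n)"
      using cover_below[OF initial_below, of i n] i assms below_subset[of i n] unfolding initial_def by blast
    then show "interlacing (below i) (below n)" using inter by blast
  qed
  have e_comm: "e p * e q = e q * e p" for p q
    using comm[of n] unfolding commuting_def e_def by blast
  have ue: "u n * e p = e p * u n" for p unfolding e_def by (rule u_E_below) simp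
  have eT: "e p * T = T * e p" for p
    unfolding e_def by (rule T_E[symmetric]) (use lt_P in auto)
  have uE: "u n * E A k = (e k + T * D k) * u n" for k
    unfolding e_def D_def by (rule u_E) (use assms in auto)
  have B: "E ?B (Suc k) = E A (Suc k) + e k * u n" for k
  proof -
    have "?B - A = {n}" using assms by auto
    then show ?thesis using E_split[OF assms(4,1), of k] ue by (auto simp: e_def)
  qed
  have A: "E A k = e k + D k" for k by (simp add: D_def)
  have prod: "E ?B (Suc p) * E ?B (Suc q) = E A (Suc p) * E A (Suc q)
      + (e (Suc p) * e q + e p * e (Suc q)) * u n + (D (Suc p) * e q + T * e p * D (Suc q)) * u n
      + e p * e q * u n * u n" for p q
  proof -
    have "e p * u n * E A (Suc q) = (e p * e (Suc q) + (e p * T) * D (Suc q)) * u n"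
      using uE[of "Suc q"] by (simp add: algebra_simps)
    then have 1: "e p * u n * E A (Suc q) = (e p * e (Suc q) + T * e p * D (Suc q)) * u n"
      unfolding eT .
    have 2: "e p * u n * (e q * u n) = e p * e q * u n * u n"
      by (metis ue mult.assoc)
    have 3: "E A (Suc p) * (e q * u n) = (e (Suc p) * e q + D (Suc p) * e q) * u n"
      by (simp add: A algebra_simps)
    show ?thesis
      unfolding B using 1 2 3 by (simp add: distrib_left distrib_right)
  qed
  have X: "D (Suc p) * e q + T * e p * D (Suc q) = D (Suc q) * e p + T * e q * D (Suc p)" for p q
    using S[of p q] by (simp add: algebra_simps)
  have Y: "e (Suc p) * e q + e p * e (Suc q) = e (Suc q) * e p + e q * e (Suc p)" for p q
    using e_comm[of "Suc p" q] e_comm[of p "Suc q"] by (simp add: add.commute)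
  have "E ?B (Suc p) * E ?B (Suc q) = E ?B (Suc q) * E ?B (Suc p)" for p q
    unfolding prod X[of p q] Y[of p q] e_comm[of p q]
    using assms(5) unfolding commuting_def by metis
  then show ?thesis
    unfolding commuting_def by (metis E_0 mult_1 mult_1_right not0_implies_Suc)
qed

text \<open>The two properties feed each other: commutation in \<open>B\<close> uses interlacing
  into \<open>below n\<close> for its last letter \<open>n\<close>, and interlacing into
  \<open>B\<close> uses commutation in \<open>A\<close>. The segments involved are proper subsets of
  \<open>B\<close>, except for a cover with \<open>A = B\<close>, where interlacing follows from the
  commutation in \<open>B\<close> just obtained.\<close>

lemma chain_sums_commuting_interlacing:
  "initial B \<Longrightarrow> commuting B \<and> (\<forall>A. cover A B \<longrightarrow> interlacing A B)"
proof (induction "card B" arbitrary: B rule: less_induct)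
  case less
  have smaller: "card C < card B" if "C \<subset> B" for C
    using that less.prems initial_finite psubset_card_mono by blast
  have IH: "commuting C \<and> (\<forall>A. cover A C \<longrightarrow> interlacing A C)" if "initial C" "C \<subset> B" for C
    using less.hyps that smaller by blast
  have belowB: "below j \<subset> B" if "j \<in> B" for j
  proof -
    have "below j \<subseteq> B" using initial_lt less.prems that by blast
    moreover have "j \<notin> below j" by simp
    ultimately show ?thesis using that by blast
  qed
  have comm: "commuting B"
  proof (cases "B = {}")
    case True
    have "E {} (Suc k) = 0" for k
    proof -
      have "{w::'a list. set w \<subseteq> {} \<and> length w = Suc k \<and> decreasing lt w} = {}" by auto
      then show ?thesis unfolding word_sum_def by (simp only: sum.empty)
    qed
    then show ?thesis unfolding commuting_def True
      by (metis E_0 mult_1 mult_1_right mult_zero_left mult_zero_right not0_implies_Suc)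
  next
    case False
    have "\<exists>n\<in>B. \<forall>b\<in>B. \<not> tot n b"
    proof -
      have "finite B" using initial_finite less.prems .
      moreover have "transp_on B tot" "asymp_on B tot"
        using tot_trans by (auto intro!: transp_onI asymp_onI dest: tot_asym)
      ultimately show ?thesis
        using Finite_Set.bex_max_element[of B tot] False tot_irrefl by metis
    qed
    then obtain n where n: "n \<in> B" "\<And>b. b \<in> B \<Longrightarrow> \<not> tot n b" by blast
    define A where "A = B - {n}"
    have B: "B = insert n A" using n A_def by auto
    have A: "initial A" unfolding initial_def
    proof (intro conjI ballI allI impI)
      show "A \<subseteq> P" using less.prems unfolding initial_def A_def by blast
      fix a b assume "a \<in> A" "tot b a"
      then show "b \<in> A" using n less.prems unfolding A_def initial_def by blast
    qed
    show ?thesis unfolding B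
    proof (rule chain_sums_commuting_aux)
      show "initial A" by fact
      show "n \<in> P" using less.prems n unfolding initial_def by blast
      show "n \<notin> A" by (simp add: A_def)
      show "initial (insert n A)" using less.prems B by simp
      show "commuting A" using IH[OF A] n by (auto simp: A_def)
      show "below n \<subseteq> A" using belowB[OF n(1)] by (auto simp: A_def)
      fix j assume "j \<in> insert n A"
      then show "commuting (below j)" using IH[OF initial_below belowB] B by blast
    next
      fix C assume "cover C (below n)"
      then show "interlacing C (below n)" using IH[OF initial_below belowB] n by blast
    qed
  qed
  moreover have "interlacing A B" if AB: "cover A B" for A
  proof (cases "A = B")
    case True
    then show ?thesis using comm unfolding commuting_def interlacing_def by simp
  next
    case False
    then have "A \<subset> B" "initial A" using AB unfolding cover_def by auto
    then have "commuting A" using IH by blast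
    then show ?thesis
      using chain_sums_interlacing_aux[OF AB] IH[OF initial_below belowB] by blast
  qed
  ultimately show ?case by blast
qed

theorem chain_sums_commute: "E P p * E P q = E P q * E P p"
proof -
  have "initial P" unfolding initial_def using tot_P by blast
  then show ?thesis using chain_sums_commuting_interlacing unfolding commuting_def by blast
qed

end

section \<open>Letter operators\<close>

lift_definition scalar :: "'c::comm_ring_1 \<Rightarrow> ('m \<Rightarrow> 'c) endo" is "\<lambda>c \<phi> \<beta>. c * \<phi> \<beta>"
  by (simp add: fun_eq_iff distrib_left)

text \<open>Vectors are functions on multisets, and the operator acts by evaluating at the smaller
  multiset. Hence in a product the leftmost letter is removed first and meets all later ones, so
  \<open>q a b\<close> is collected for \<open>a\<close> in front of \<open>b\<close>.\<close>

lift_definition letter_op :: "('a \<Rightarrow> 'a \<Rightarrow> 'c::comm_ring_1) \<Rightarrow> 'a \<Rightarrow> ('a multiset \<Rightarrow> 'c) endo" is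
  "\<lambda>q a \<phi> \<beta>. if a \<in># \<beta> then (\<Prod>b\<in>#\<beta> - {#a#}. q a b) * \<phi> (\<beta> - {#a#}) else 0"
  by (simp add: fun_eq_iff distrib_left)

definition vacuum :: "'a multiset \<Rightarrow> 'c::comm_ring_1" where
  "vacuum \<beta> = (if \<beta> = {#} then 1 else 0)"

fun pair_weight :: "('a \<Rightarrow> 'a \<Rightarrow> 'c::comm_ring_1) \<Rightarrow> 'a list \<Rightarrow> 'c" where
  "pair_weight q [] = 1"
| "pair_weight q (a # w) = (\<Prod>b\<leftarrow>w. q a b) * pair_weight q w"

lemma app_mult: "app (f * g) \<phi> = app f (app g \<phi>)"
  by transfer simp

lemma app_one [simp]: "app 1 \<phi> = \<phi>"
  by transfer simp

lemma app_plus: "app (f + g) \<phi> = app f \<phi> + app g \<phi>"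
  by transfer simp

lemma app_zero_op [simp]: "app 0 \<phi> = 0"
  by transfer simp

lemma app_sum: "app (\<Sum>i\<in>I. f i) \<phi> = (\<Sum>i\<in>I. app (f i) \<phi>)"
  by (induction I rule: infinite_finite_induct) (simp_all add: app_plus)

lemma sum_fun_apply: "(\<Sum>i\<in>I. f i) x = (\<Sum>i\<in>I. f i x)" for f :: "'i \<Rightarrow> 'b \<Rightarrow> 'c::comm_monoid_add"
  by (induction I rule: infinite_finite_induct) simp_all

lemma app_letter_op:
  "app (letter_op q a) \<phi> \<beta> = (if a \<in># \<beta> then (\<Prod>b\<in>#\<beta> - {#a#}. q a b) * \<phi> (\<beta> - {#a#}) else 0)"
  by (simp add: letter_op.rep_eq)

lemma app_scalar: "app (scalar c) \<phi> \<beta> = c * \<phi> \<beta>"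
  by (simp add: scalar.rep_eq)

lemma endo_eqI: "(\<And>\<phi> \<beta>. app f \<phi> \<beta> = app g \<phi> \<beta>) \<Longrightarrow> f = g" for f g :: "('m \<Rightarrow> 'c::comm_ring_1) endo"
  by (simp add: app_inject[symmetric] fun_eq_iff)

lemma scalar_1: "scalar 1 = 1"
  by (rule endo_eqI) (simp add: app_scalar)

lemma scalar_letter_op: "scalar c * letter_op q a = letter_op q a * scalar c"
  by (rule endo_eqI) (simp add: app_mult app_scalar app_letter_op algebra_simps)

text \<open>Removing \<open>a\<close> and \<open>b\<close> in either order leaves the same multiset
  and the same factors against it; only the factor of the pair itself depends on the order.\<close>

lemma letter_op_exchange:
  fixes q :: "'a \<Rightarrow> 'a \<Rightarrow> 'c::comm_ring_1"
  assumes "q b a = c * q a b"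
  shows "letter_op q b * letter_op q a = scalar c * letter_op q a * letter_op q b"
proof (rule endo_eqI)
  fix \<phi> :: "'a multiset \<Rightarrow> 'c" and \<beta>
  show "app (letter_op q b * letter_op q a) \<phi> \<beta> = app (scalar c * letter_op q a * letter_op q b) \<phi> \<beta>"
  proof (cases "{#a, b#} \<subseteq># \<beta>")
    case True
    then obtain \<gamma> where "\<beta> = {#a, b#} + \<gamma>" using subset_mset.le_iff_add by blast
    then show ?thesis
      using assms by (simp add: app_mult app_scalar app_letter_op add_mset_commute[of a b] algebra_simps)
  next
    case False
    have swap: "b \<in># \<beta> \<and> a \<in># \<beta> - {#b#} \<longleftrightarrow> {#a, b#} \<subseteq># \<beta>" for a b
      by (auto simp: insert_subset_eq_iff add_mset_commute[of a b])
    show ?thesis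
      using False swap[of b a] swap[of a b]
      by (auto simp: app_mult app_scalar app_letter_op add_mset_commute)
  qed
qed

text \<open>Besides the pairs inside the word, every removed letter meets every letter that remains,
  which accounts for the double product; it is empty when the word exhausts
  \<open>\<beta>\<close>.\<close>

lemma app_word:
  "app (prod_list (map (letter_op q) w)) \<phi> \<beta> = (if mset w \<subseteq># \<beta> then
    pair_weight q w * (\<Prod>a\<in>#mset w. \<Prod>b\<in>#\<beta> - mset w. q a b) * \<phi> (\<beta> - mset w) else 0)"
proof (induction w arbitrary: \<beta>)
  case (Cons a w)
  show ?case
  proof (cases "mset (a # w) \<subseteq># \<beta>")
    case True
    then obtain \<gamma> where "\<beta> = mset (a # w) + \<gamma>" using subset_mset.le_iff_add by blast
    moreover have "prod_mset (image_mset (q a) (mset w)) = (\<Prod>b\<leftarrow>w. q a b)"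
      by (metis mset_map prod_mset_prod_list)
    ultimately show ?thesis
      by (simp add: app_mult app_letter_op Cons.IH algebra_simps)
  next
    case False
    then show ?thesis by (auto simp: app_mult app_letter_op Cons.IH insert_subset_eq_iff)
  qed
qed simp

lemma app_word_vacuum:
  "app (prod_list (map (letter_op q) w)) vacuum \<beta> = (if mset w = \<beta> then pair_weight q w else 0)"
proof -
  have "mset w \<subseteq># \<beta> \<Longrightarrow> \<beta> - mset w = {#} \<longleftrightarrow> mset w = \<beta>"
    by (metis Diff_eq_empty_iff_mset subset_mset.antisym subset_mset.order_refl)
  then show ?thesis by (auto simp: app_word vacuum_def)
qed

text \<open>The base case ignores leftover letters; in the statements about word sums and
  coefficients the length of the word is fixed to \<open>sum_list a\<close>, so none are
  left.\<close>

fun blocks :: "('a list \<Rightarrow> bool) \<Rightarrow> nat list \<Rightarrow> 'a list \<Rightarrow> bool" where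
  "blocks Q [] w \<longleftrightarrow> True"
| "blocks Q (x # a) w \<longleftrightarrow> Q (take x w) \<and> blocks Q a (drop x w)"

lemma prod_list_word_sum:
  assumes "finite A"
  shows "prod_list (map (word_sum u Q A) a) = word_sum u (blocks Q a) A (sum_list a)"
  by (induction a) (simp_all add: word_sum_0 word_sum_mult[OF assms])

lemma finite_word_set: "finite {w. mset w = \<beta>}"
proof (rule finite_subset)
  show "{w. mset w = \<beta>} \<subseteq> {w. set w \<subseteq> set_mset \<beta> \<and> length w = size \<beta>}" by auto
qed (rule finite_lists_length_eq, simp)

lemma app_word_sums_vacuum:
  assumes "finite A" "set_mset \<beta> \<subseteq> A"
  shows "app (prod_list (map (word_sum (letter_op q) Q A) a)) vacuum \<beta> =
    (\<Sum>w\<in>words \<beta>. if length w = sum_list a \<and> blocks Q a w then pair_weight q w else 0)"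
proof -
  let ?W = "{w. set w \<subseteq> A \<and> length w = sum_list a \<and> blocks Q a w}"
  have "app (prod_list (map (word_sum (letter_op q) Q A) a)) vacuum \<beta> =
      (\<Sum>w\<in>?W. if mset w = \<beta> then pair_weight q w else 0)"
    unfolding prod_list_word_sum[OF assms(1)] word_sum_def app_sum sum_fun_apply app_word_vacuum ..
  also have "\<dots> = (\<Sum>w\<in>{w \<in> ?W. mset w = \<beta>}. pair_weight q w)"
    by (rule sum.inter_filter[symmetric]) (rule finite_words[OF assms(1)])
  also have "{w \<in> ?W. mset w = \<beta>} = {w \<in> words \<beta>. length w = sum_list a \<and> blocks Q a w}"
    using assms(2) by (auto simp: words_def)
  finally show ?thesis
    by (subst sum.inter_filter[symmetric]) (simp_all add: words_def finite_word_set)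
qed

text \<open>Pairs inside a chain are comparable and have weight 1. What remains is the factor
  between the removed chain and the rest, which is exactly what a top color class contributes to the
  weight of a coloring.\<close>

lemma app_chain_sum_mult:
  assumes "finite A" and comparable: "\<And>a b. lt a b \<Longrightarrow> q b a = 1"
  shows "app (word_sum (letter_op q) (decreasing lt) A k * r) \<phi> \<beta> =
    (\<Sum>w\<in>{w. set w \<subseteq> A \<and> length w = k \<and> decreasing lt w \<and> mset w \<subseteq># \<beta>}.
      (\<Prod>a\<in>#mset w. \<Prod>b\<in>#\<beta> - mset w. q a b) * app r \<phi> (\<beta> - mset w))"
proof -
  let ?W = "{w. set w \<subseteq> A \<and> length w = k \<and> decreasing lt w}"
  have one: "pair_weight q w = 1" if "decreasing lt w" for w
    using that
  proof (induction w)
    case (Cons a w)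
    then have "map (q a) w = map (\<lambda>_. 1) w" using comparable by (auto simp: decreasing_def)
    then have "(\<Prod>b\<leftarrow>w. q a b) = 1" by (simp only:) (simp add: map_replicate_const)
    then show ?case using Cons by (simp add: decreasing_def)
  qed simp
  have "app (word_sum (letter_op q) (decreasing lt) A k * r) \<phi> \<beta> =
      (\<Sum>w\<in>?W. if mset w \<subseteq># \<beta> then
        (\<Prod>a\<in>#mset w. \<Prod>b\<in>#\<beta> - mset w. q a b) * app r \<phi> (\<beta> - mset w) else 0)"
    unfolding word_sum_def app_mult app_sum sum_fun_apply app_word
    by (rule sum.cong) (auto simp: one)
  also have "\<dots> = (\<Sum>w\<in>{w \<in> ?W. mset w \<subseteq># \<beta>}.
      (\<Prod>a\<in>#mset w. \<Prod>b\<in>#\<beta> - mset w. q a b) * app r \<phi> (\<beta> - mset w))"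
    by (rule sum.inter_filter[symmetric]) (rule finite_words[OF assms(1)])
  finally show ?thesis by (simp add: conj_assoc cong: conj_cong)
qed

section \<open>The fundamental quasisymmetric expansion\<close>

text \<open>Series are evaluated on exponent lists, so that recursion over the variables is
  possible; position 0 of the list belongs to the variable of index 1. Every exponent vector of
  finite support that vanishes at 0 arises, and the series in question are zero on all
  others.\<close>

definition exps :: "nat list \<Rightarrow> nat \<Rightarrow> nat" where
  "exps a v = (if 1 \<le> v \<and> v \<le> length a then a ! (v - 1) else 0)"

lemma exps_exists:
  assumes "finite {v. \<alpha> v \<noteq> 0}" "\<alpha> 0 = 0"
  shows "\<exists>a. \<alpha> = exps a"
proof -
  obtain N where N: "\<And>v. \<alpha> v \<noteq> 0 \<Longrightarrow> v < N"
    using finite_nat_set_iff_bounded assms(1) by auto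
  have "\<alpha> v = exps (map (\<lambda>i. \<alpha> (Suc i)) [0..<N]) v" for v
    using assms(2) N[of v] by (cases v) (force simp: exps_def)+
  then show ?thesis by blast
qed

lemma exps_0 [simp]: "exps a 0 = 0"
  by (simp add: exps_def)

lemma finite_exps: "finite {v. exps a v \<noteq> 0}"
  by (rule finite_subset[of _ "{..length a}"]) (auto simp: exps_def)

text \<open>For \<open>s = 1\<close> this is the only weakly increasing index sequence with exponent
  list \<open>a\<close>; the start \<open>s\<close> is free for the induction.\<close>

fun color_list :: "nat \<Rightarrow> nat list \<Rightarrow> nat list" where
  "color_list s [] = []"
| "color_list s (x # a) = replicate x s @ color_list (Suc s) a"

lemma length_color_list [simp]: "length (color_list s a) = sum_list a"
  by (induction a arbitrary: s) auto

lemma color_list_ge: "k \<in> set (color_list s a) \<Longrightarrow> s \<le> k"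
  by (induction a arbitrary: s) (auto split: if_splits dest: Suc_leD)

lemma sorted_color_list: "sorted (color_list s a)"
  by (induction a arbitrary: s) (auto simp: sorted_append dest!: color_list_ge)

lemma count_color_list:
  "count (mset (color_list s a)) v = (if s \<le> v \<and> v < s + length a then a ! (v - s) else 0)"
proof (induction a arbitrary: s)
  case (Cons x a)
  show ?case
    using Suc_diff_Suc[of s v] by (auto simp: Cons.IH nth_Cons')
qed simp

text \<open>A sorted sequence is determined by its multiset, so at most one index sequence is
  counted and the coefficient is 0 or 1.\<close>

lemma Q_fund_exps:
  "Q_fund n D (exps a) = (if n = sum_list a \<and>
    (\<forall>j\<in>D. Suc j < n \<longrightarrow> color_list 1 a ! j < color_list 1 a ! Suc j) then 1 else 0)"
proof -
  have cnt: "(\<forall>v. count (mset is) v = exps a v) \<longleftrightarrow> mset is = mset (color_list 1 a)" for "is"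
    by (auto simp: multiset_eq_iff count_color_list exps_def less_Suc_eq_le)
  have eq: "sorted is \<and> mset is = mset (color_list 1 a) \<longleftrightarrow> is = color_list 1 a" for "is"
    using properties_for_sort[of "is" "color_list 1 a"] sorted_color_list[of 1 a]
    by (metis properties_for_sort)
  have "{is :: nat list. length is = n \<and> sorted is \<and> (\<forall>k\<in>set is. 1 \<le> k) \<and>
       (\<forall>j\<in>D. Suc j < n \<longrightarrow> is ! j < is ! Suc j) \<and> (\<forall>v. count (mset is) v = exps a v)}
     = (if n = sum_list a \<and> (\<forall>j\<in>D. Suc j < n \<longrightarrow> color_list 1 a ! j < color_list 1 a ! Suc j)
       then {color_list 1 a} else {})" (is "?S = _")
  proof -
    have "is \<in> ?S \<longleftrightarrow> is = color_list 1 a \<and> n = sum_list a \<and>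
        (\<forall>j\<in>D. Suc j < n \<longrightarrow> color_list 1 a ! j < color_list 1 a ! Suc j)" for "is"
      unfolding mem_Collect_eq cnt using eq[of "is"] color_list_ge[of _ 1 a] by auto
    then show ?thesis by auto
  qed
  then show ?thesis unfolding Q_fund_def by auto
qed

lemma Q_fund_eq_0:
  assumes "\<nexists>a. \<alpha> = exps a"
  shows "Q_fund n D \<alpha> = 0"
proof -
  have "\<not> ((\<forall>k\<in>set is. 1 \<le> k) \<and> (\<forall>v. count (mset is) v = \<alpha> v))" for "is" :: "nat list"
  proof
    assume *: "(\<forall>k\<in>set is. 1 \<le> k) \<and> (\<forall>v. count (mset is) v = \<alpha> v)"
    then have "\<alpha> = count (mset is)" by auto
    moreover have "finite {v. count (mset is) v \<noteq> 0}" by simp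
    moreover have "count (mset is) 0 = 0" using * by (metis count_eq_zero_iff not_one_le_zero set_mset_mset)
    ultimately show False using assms exps_exists by metis
  qed
  then have "{is :: nat list. length is = n \<and> sorted is \<and> (\<forall>k\<in>set is. 1 \<le> k) \<and>
       (\<forall>j\<in>D. Suc j < n \<longrightarrow> is ! j < is ! Suc j) \<and> (\<forall>v. count (mset is) v = \<alpha> v)} = {}"
    by blast
  then show ?thesis unfolding Q_fund_def by (simp only: card.empty of_nat_0)
qed

text \<open>Inside a block the colors agree, so the condition on neighbours forbids descents; across
  a boundary the colors increase and the condition holds by itself.\<close>

lemma blocks_iff_successively:
  assumes "length w = sum_list a"
  shows "blocks (descent_free lt) a w \<longleftrightarrow>
    successively (\<lambda>p p'. lt (snd p') (snd p) \<longrightarrow> fst p < fst p') (zip (color_list s a) w)"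
  using assms
proof (induction a arbitrary: s w)
  case (Cons x a)
  let ?R = "\<lambda>p p'. lt (snd p') (snd p) \<longrightarrow> fst p < (fst p' :: nat)"
  have len: "length (take x w) = x" "length (drop x w) = sum_list a" using Cons.prems by auto
  have zip: "zip (color_list s (x # a)) w =
      zip (replicate x s) (take x w) @ zip (color_list (Suc s) a) (drop x w)"
    using len by (simp add: zip_append1)
  have "zip (replicate x s) (take x w) = map (Pair s) (take x w)"
    using len by (metis zip_replicate1 min.idem take_all order_refl)
  then have 1: "successively ?R (zip (replicate x s) (take x w)) \<longleftrightarrow> descent_free lt (take x w)"
    by (simp add: descent_free_def successively_map)
  have 2: "?R (last (zip (replicate x s) (take x w))) (hd (zip (color_list (Suc s) a) (drop x w)))"
    if "zip (replicate x s) (take x w) \<noteq> []" "zip (color_list (Suc s) a) (drop x w) \<noteq> []"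
  proof -
    have "fst (last (zip (replicate x s) (take x w))) = s"
      using last_in_set[OF that(1)]
      by (metis in_set_replicate prod.collapse set_zip_leftD)
    moreover have "Suc s \<le> fst (hd (zip (color_list (Suc s) a) (drop x w)))"
      using hd_in_set[OF that(2)] color_list_ge by (metis prod.collapse set_zip_leftD)
    ultimately show ?thesis by auto
  qed
  show ?case
    unfolding zip successively_append_iff 1 blocks.simps Cons.IH[OF len(2), of "Suc s"]
    using 2 by fast
qed simp

lemma Q_fund_Des_exps:
  "Q_fund (length w) (Des lt w) (exps a) =
    (if length w = sum_list a \<and> blocks (descent_free lt) a w then 1 else 0)"
proof -
  have "(\<forall>j\<in>Des lt w. Suc j < length w \<longrightarrow> color_list 1 a ! j < color_list 1 a ! Suc j) \<longleftrightarrow>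
      blocks (descent_free lt) a w" if "length w = sum_list a"
    unfolding blocks_iff_successively[OF that, of lt 1] successively_conv_nth
    using that by (auto simp: Des_def)
  then show ?thesis unfolding Q_fund_exps by auto
qed

lemma F_of_words_exps:
  fixes q :: "'a \<Rightarrow> 'a \<Rightarrow> 'c::comm_ring_1"
  assumes "finite A" "set_mset \<beta> \<subseteq> A"
  shows "F_of lt (words \<beta>) (pair_weight q) (exps a) =
    app (prod_list (map (word_sum (letter_op q) (descent_free lt) A) a)) vacuum \<beta>"
  unfolding app_word_sums_vacuum[OF assms] F_of_def Q_fund_Des_exps
  by (rule sum.cong) auto

lemma F_of_eq_0: "\<nexists>a. \<alpha> = exps a \<Longrightarrow> F_of lt W \<gamma> \<alpha> = 0"
  by (simp add: F_of_def Q_fund_eq_0)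

section \<open>Colorings\<close>

text \<open>The element of larger color takes the role of the earlier letter, because the largest
  color is removed first. Equal colors give no factor, like pairs inside a chain.\<close>

definition color_weight :: "('a \<Rightarrow> 'a \<Rightarrow> 'c::comm_ring_1) \<Rightarrow> 'a multiset \<Rightarrow> ('a \<times> nat \<Rightarrow> nat) \<Rightarrow> 'c" where
  "color_weight q \<beta> \<kappa> = (\<Prod>b\<in>Pbeta \<beta>. \<Prod>b'\<in>Pbeta \<beta>. if \<kappa> b' < \<kappa> b then q (fst b) (fst b') else 1)"

definition X_weighted :: "('a \<Rightarrow> 'a \<Rightarrow> 'c::comm_ring_1) \<Rightarrow> ('a \<Rightarrow> 'a \<Rightarrow> bool) \<Rightarrow> 'a multiset \<Rightarrow> 'c series" where
  "X_weighted q lt \<beta> \<alpha> = (\<Sum>\<kappa>\<in>colorings lt \<beta> \<alpha>. color_weight q \<beta> \<kappa>)"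

lemma Pbeta_Sigma: "Pbeta \<beta> = (SIGMA a:set_mset \<beta>. {1..count \<beta> a})"
  by (auto simp: Pbeta_def)

lemma finite_Pbeta [simp]: "finite (Pbeta \<beta>)"
  by (simp add: Pbeta_Sigma)

lemma prod_Pbeta: "(\<Prod>b\<in>Pbeta \<gamma>. f (fst b)) = (\<Prod>a\<in>#\<gamma>. f a :: 'c::comm_monoid_mult)"
proof -
  have "(\<Prod>b\<in>Pbeta \<gamma>. f (fst b)) = (\<Prod>a\<in>set_mset \<gamma>. \<Prod>i\<in>{1..count \<gamma> a}. f a)"
    unfolding Pbeta_Sigma by (subst prod.Sigma) (simp_all add: case_prod_beta)
  then show ?thesis by (simp add: image_prod_mset_multiplicity)
qed

lemma colorings_supp:
  assumes "\<kappa> \<in> colorings lt \<beta> \<alpha>" "b \<in> Pbeta \<beta>"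
  shows "\<alpha> (\<kappa> b) \<noteq> 0"
proof -
  have "card {b' \<in> Pbeta \<beta>. \<kappa> b' = \<kappa> b} = \<alpha> (\<kappa> b)"
    using assms(1) unfolding colorings_def by blast
  moreover have "b \<in> {b' \<in> Pbeta \<beta>. \<kappa> b' = \<kappa> b}" using assms(2) by simp
  moreover have "finite {b' \<in> Pbeta \<beta>. \<kappa> b' = \<kappa> b}" by simp
  ultimately show ?thesis by (metis card_eq_0_iff empty_iff)
qed

lemma finite_colorings:
  assumes "\<And>v. v > N \<Longrightarrow> \<alpha> v = 0"
  shows "finite (colorings lt \<beta> \<alpha>)"
proof (rule finite_subset)
  show "colorings lt \<beta> \<alpha> \<subseteq> (\<Pi>\<^sub>E b\<in>Pbeta \<beta>. {..N})"
  proof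
    fix \<kappa> assume k: "\<kappa> \<in> colorings lt \<beta> \<alpha>"
    then have "\<kappa> b \<le> N" if "b \<in> Pbeta \<beta>" for b
      using colorings_supp[OF k that] assms not_less by blast
    then show "\<kappa> \<in> (\<Pi>\<^sub>E b\<in>Pbeta \<beta>. {..N})" using k by (auto simp: colorings_def PiE_def)
  qed
qed (simp add: finite_PiE)

lemma decreasing_exists:
  assumes "finite S" and total: "\<And>a b. a \<in> S \<Longrightarrow> b \<in> S \<Longrightarrow> a \<noteq> b \<Longrightarrow> lt a b \<or> lt b a"
    and irrefl: "\<And>a. \<not> lt a a" and trans: "\<And>a b c. lt a b \<Longrightarrow> lt b c \<Longrightarrow> lt a c"
  shows "\<exists>w. decreasing lt w \<and> set w = S"
  using assms(1,2)
proof (induction "card S" arbitrary: S)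
  case 0
  then show ?case by (auto simp: decreasing_def)
next
  case (Suc n)
  then have "S \<noteq> {}" by auto
  moreover have "transp_on S lt" "asymp_on S lt"
    using trans irrefl by (auto intro!: transp_onI asymp_onI)
  ultimately obtain m where m: "m \<in> S" "\<And>x. x \<in> S \<Longrightarrow> x \<noteq> m \<Longrightarrow> lt x m"
    using Finite_Set.bex_max_element[of S lt] Suc.prems by metis
  have "\<exists>w. decreasing lt w \<and> set w = S - {m}"
    using Suc m by (intro Suc.hyps(1)) auto
  then obtain w where "decreasing lt w" "set w = S - {m}" by blast
  then have "decreasing lt (m # w)" "set (m # w) = S"
    using m by (auto simp: decreasing_def)
  then show ?case by blast
qed

text \<open>Color classes are sets while chain sums run over words; existence and uniqueness of a
  decreasing arrangement identify the two.\<close>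

lemma decreasing_unique:
  assumes irrefl: "\<And>a. \<not> lt a a" and trans: "\<And>a b c. lt a b \<Longrightarrow> lt b c \<Longrightarrow> lt a c"
    and "decreasing lt v" "decreasing lt w" "set v = set w"
  shows "v = w"
  using assms(3-5)
proof (induction v arbitrary: w)
  case (Cons a v)
  then obtain b w' where w: "w = b # w'" by (cases w) auto
  have v: "\<forall>x\<in>set v. lt x a" "decreasing lt v" and w': "\<forall>x\<in>set w'. lt x b" "decreasing lt w'"
    using Cons.prems w by (auto simp: decreasing_def)
  have "a = b"
  proof (rule ccontr)
    assume "a \<noteq> b"
    then have "lt a b" "lt b a" using Cons.prems(3) v w' w by auto
    then show False using irrefl trans by blast
  qed
  moreover have "set v = set w'"
    using Cons.prems(3) v(1) w'(1) w \<open>a = b\<close> irrefl by (metis insert_ident list.simps(15))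
  ultimately show ?case using Cons.IH v w' w by blast
qed simp

lemma decreasing_distinct: "(\<And>a. \<not> lt a a) \<Longrightarrow> decreasing lt w \<Longrightarrow> distinct w"
  by (induction w) (auto simp: decreasing_def)

lemma incomp_beta_iff: "incomp_beta lt b b' \<longleftrightarrow> b \<noteq> b' \<and> sim lt (fst b) (fst b')"
  by (auto simp: incomp_beta_def lt_beta_def sim_def)

text \<open>Copies of a letter have decreasing colors, so the class of the largest color N consists of first
copies only; removing it deletes those and shifts the numbering of the remaining copies.\<close>

locale top_color =
  fixes lt :: "'a \<Rightarrow> 'a \<Rightarrow> bool" and \<beta> :: "'a multiset" and w :: "'a list"
    and \<alpha> :: "nat \<Rightarrow> nat" and N :: nat
  assumes irrefl: "\<And>a. \<not> lt a a" and trans: "\<And>a b c. lt a b \<Longrightarrow> lt b c \<Longrightarrow> lt a c"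
    and N: "N \<ge> 1" and above: "\<And>v. v > N \<Longrightarrow> \<alpha> v = 0"
    and dec: "decreasing lt w" and sub: "mset w \<subseteq># \<beta>" and len: "length w = \<alpha> N"
begin

definition "rest = \<beta> - mset w"

definition shift :: "'a \<times> nat \<Rightarrow> 'a \<times> nat" where
  "shift b = (fst b, if fst b \<in> set w then Suc (snd b) else snd b)"

definition tops :: "('a \<times> nat) set" where
  "tops = (\<lambda>a. (a, 1)) ` set w"

definition fiber :: "('a \<times> nat \<Rightarrow> nat) set" where
  "fiber = {\<kappa> \<in> colorings lt \<beta> \<alpha>. {a \<in> set_mset \<beta>. \<kappa> (a, 1) = N} = set w}"

definition lower :: "('a \<times> nat \<Rightarrow> nat) \<Rightarrow> 'a \<times> nat \<Rightarrow> nat" where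
  "lower \<kappa> = restrict (\<kappa> \<circ> shift) (Pbeta rest)"

definition raise :: "('a \<times> nat \<Rightarrow> nat) \<Rightarrow> 'a \<times> nat \<Rightarrow> nat" where
  "raise \<kappa> = restrict (\<lambda>b. if b \<in> tops then N else \<kappa> (inv_into (Pbeta rest) shift b)) (Pbeta \<beta>)"

section \<open>Bijection between colorings with a given top class and colorings of the rest\<close>

lemma fst_shift [simp]: "fst (shift b) = fst b"
  by (simp add: shift_def)

lemma shift_inj: "inj shift"
  by (auto simp: inj_def shift_def prod_eq_iff split: if_splits)

lemma distinct_w: "distinct w"
  using decreasing_distinct[OF irrefl dec] .

lemma count_rest: "count rest a = count \<beta> a - (if a \<in> set w then 1 else 0)"
  by (simp add: rest_def distinct_count_atmost_1[THEN iffD1, OF distinct_w])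

lemma w_sub: "a \<in> set w \<Longrightarrow> a \<in># \<beta>"
  using sub by (metis mset_subset_eqD set_mset_mset)

lemma mem_Pbeta: "(a, i) \<in> Pbeta \<gamma> \<longleftrightarrow> 1 \<le> i \<and> i \<le> count \<gamma> a"
  by (auto simp: Pbeta_def intro: count_inI)

lemma Pbeta_split: "Pbeta \<beta> = tops \<union> shift ` Pbeta rest"
proof (rule set_eqI)
  fix b :: "'a \<times> nat"
  obtain a i where b: "b = (a, i)" by fastforce
  show "b \<in> Pbeta \<beta> \<longleftrightarrow> b \<in> tops \<union> shift ` Pbeta rest"
  proof (cases "a \<in> set w")
    case True
    then have 1: "count \<beta> a \<ge> 1" using w_sub by (simp add: Suc_leI)
    have "b \<in> shift ` Pbeta rest \<longleftrightarrow> (\<exists>j. i = Suc j \<and> (a, j) \<in> Pbeta rest)"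
      using True unfolding b shift_def image_iff by (force split: if_splits)
    also have "\<dots> \<longleftrightarrow> 2 \<le> i \<and> i \<le> count \<beta> a"
      using True 1 by (cases i) (auto simp: mem_Pbeta count_rest)
    finally show ?thesis using True 1 by (auto simp: b tops_def mem_Pbeta)
  next
    case False
    have "b \<in> shift ` Pbeta rest \<longleftrightarrow> (a, i) \<in> Pbeta rest"
      using False unfolding b shift_def image_iff by (force split: if_splits)
    then show ?thesis using False by (auto simp: b tops_def mem_Pbeta count_rest)
  qed
qed

lemma tops_disjoint: "shift b \<notin> tops" if "b \<in> Pbeta rest" for b
  using that by (auto simp: shift_def tops_def Pbeta_def split: if_splits)

lemma shift_in: "b \<in> Pbeta rest \<Longrightarrow> shift b \<in> Pbeta \<beta>"
  by (simp add: Pbeta_split)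

lemma finite_tops: "finite tops"
  by (simp add: tops_def)

lemma card_tops: "card tops = \<alpha> N"
  using distinct_w by (simp add: tops_def card_image inj_on_def distinct_card len)

lemma card_color:
  assumes "\<And>b. b \<in> tops \<Longrightarrow> \<kappa> b = N"
  shows "card {b \<in> Pbeta \<beta>. \<kappa> b = v} =
    (if v = N then \<alpha> N else 0) + card {b \<in> Pbeta rest. lower \<kappa> b = v}"
proof -
  have "{b \<in> Pbeta \<beta>. \<kappa> b = v} = (if v = N then tops else {}) \<union> shift ` {b \<in> Pbeta rest. lower \<kappa> b = v}"
    using assms by (auto simp: Pbeta_split lower_def)
  also have "card \<dots> = (if v = N then \<alpha> N else 0) + card (shift ` {b \<in> Pbeta rest. lower \<kappa> b = v})"
    by (subst card_Un_disjoint) (auto simp: finite_tops card_tops tops_disjoint)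
  finally show ?thesis by (simp add: card_image inj_on_subset[OF shift_inj])
qed

lemma fiber_tops: "\<kappa> b = N" if "\<kappa> \<in> fiber" "b \<in> tops"
  using that by (auto simp: fiber_def tops_def)

lemma colors_le: "\<kappa> \<in> colorings lt \<beta> \<alpha> \<Longrightarrow> b \<in> Pbeta \<beta> \<Longrightarrow> \<kappa> b \<le> N"
  using colorings_supp above not_less by blast

text \<open>A first copy outside \<open>w\<close> avoids color \<open>N\<close> by the definition of
  \<open>fiber\<close>, and a later copy has a smaller color than the first copy of its letter,
  which is at most \<open>N\<close>.\<close>

lemma fiber_less: "\<kappa> (shift b) < N" if k: "\<kappa> \<in> fiber" and b: "b \<in> Pbeta rest"
proof -
  have col: "\<kappa> \<in> colorings lt \<beta> \<alpha>" using k by (simp add: fiber_def)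
  have sb: "shift b \<in> Pbeta \<beta>" using shift_in b .
  obtain a i where ai: "shift b = (a, i)" by fastforce
  have a1: "(a, 1) \<in> Pbeta \<beta>" using sb ai by (metis mem_Pbeta le_refl le_trans)
  show ?thesis
  proof (cases "i = 1")
    case True
    then have "a \<notin> set w" using tops_disjoint[OF b] ai by (auto simp: tops_def)
    moreover have "a \<in># \<beta>" using sb ai by (metis Pbeta_Sigma mem_Sigma_iff)
    ultimately have "\<kappa> (a, 1) \<noteq> N" using k by (auto simp: fiber_def)
    then show ?thesis using colors_le[OF col a1] True ai by simp
  next
    case False
    then have "1 < i" using sb ai by (auto simp: mem_Pbeta)
    then have "\<kappa> (a, i) < \<kappa> (a, 1)" using col sb ai a1 by (auto simp: colorings_def)
    then show ?thesis using colors_le[OF col a1] ai by simp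
  qed
qed

lemma incomp_shift: "incomp_beta lt (shift b) (shift b') \<longleftrightarrow> incomp_beta lt b b'"
  using shift_inj by (auto simp: incomp_beta_iff inj_eq)

lemma lower_colorings: "lower \<kappa> \<in> colorings lt rest (\<alpha>(N := 0))" if k: "\<kappa> \<in> fiber"
proof -
  have col: "\<kappa> \<in> colorings lt \<beta> \<alpha>" using k by (simp add: fiber_def)
  have 1: "lower \<kappa> \<in> extensional (Pbeta rest)" by (simp add: lower_def)
  have 2: "\<forall>b\<in>Pbeta rest. 1 \<le> lower \<kappa> b"
    using col shift_in by (simp add: lower_def colorings_def)
  have 3: "\<forall>b\<in>Pbeta rest. \<forall>b'\<in>Pbeta rest. incomp_beta lt b b' \<longrightarrow> lower \<kappa> b \<noteq> lower \<kappa> b'"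
    using col shift_in by (simp add: lower_def colorings_def incomp_shift)
  have 4: "\<forall>a i j. (a, i) \<in> Pbeta rest \<longrightarrow> (a, j) \<in> Pbeta rest \<longrightarrow> i < j \<longrightarrow> lower \<kappa> (a, i) > lower \<kappa> (a, j)"
  proof (intro allI impI)
    fix a i j assume *: "(a, i) \<in> Pbeta rest" "(a, j) \<in> Pbeta rest" "i < j"
    obtain i' j' where ij: "shift (a, i) = (a, i')" "shift (a, j) = (a, j')" "i' < j'"
      using *(3) by (auto simp: shift_def)
    then have "\<kappa> (a, i') > \<kappa> (a, j')"
      using col shift_in[OF *(1)] shift_in[OF *(2)] by (simp add: colorings_def)
    then show "lower \<kappa> (a, i) > lower \<kappa> (a, j)" using * ij by (simp add: lower_def)
  qed
  have 5: "\<forall>v. card {b \<in> Pbeta rest. lower \<kappa> b = v} = (\<alpha>(N := 0)) v"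
  proof
    fix v
    show "card {b \<in> Pbeta rest. lower \<kappa> b = v} = (\<alpha>(N := 0)) v"
    proof (cases "v = N")
      case True
      have "{b \<in> Pbeta rest. lower \<kappa> b = v} = {}"
        using fiber_less[OF k] True by (auto simp: lower_def)
      then show ?thesis using True by (simp only: card.empty) simp
    next
      case False
      have "card {b \<in> Pbeta \<beta>. \<kappa> b = v} = \<alpha> v" using col by (simp add: colorings_def)
      then show ?thesis using card_color[of \<kappa> v] fiber_tops[OF k] False by simp
    qed
  qed
  show ?thesis unfolding colorings_def using 1 2 3 4 5 by blast
qed

lemma raise_tops: "b \<in> tops \<Longrightarrow> raise \<kappa> b = N"
  by (simp add: raise_def Pbeta_split)

lemma raise_shift: "b \<in> Pbeta rest \<Longrightarrow> raise \<kappa> (shift b) = \<kappa> b"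
  using tops_disjoint shift_in by (simp add: raise_def inv_into_f_f inj_on_subset[OF shift_inj])

lemma lower_raise: "\<kappa> \<in> extensional (Pbeta rest) \<Longrightarrow> lower (raise \<kappa>) = \<kappa>"
  by (rule extensionalityI[of _ "Pbeta rest"]) (simp_all add: lower_def raise_shift)

lemma raise_lower: "raise (lower \<kappa>) = \<kappa>" if "\<kappa> \<in> fiber"
proof (rule extensionalityI[of _ "Pbeta \<beta>"])
  show "raise (lower \<kappa>) \<in> extensional (Pbeta \<beta>)" by (simp add: raise_def)
  show "\<kappa> \<in> extensional (Pbeta \<beta>)" using that by (simp add: fiber_def colorings_def)
  fix b assume "b \<in> Pbeta \<beta>"
  then show "raise (lower \<kappa>) b = \<kappa> b"
    unfolding Pbeta_split using fiber_tops[OF that, of b] by (auto simp: raise_tops raise_shift lower_def)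
qed

lemma raise_fiber: "raise \<kappa> \<in> fiber" if k: "\<kappa> \<in> colorings lt rest (\<alpha>(N := 0))"
proof -
  have ext: "\<kappa> \<in> extensional (Pbeta rest)" using k by (simp add: colorings_def)
  have less: "\<kappa> b < N" if "b \<in> Pbeta rest" for b
    using colorings_supp[OF k that] above[of "\<kappa> b"] by (cases "\<kappa> b" N rule: linorder_cases) auto
  have 1: "raise \<kappa> \<in> extensional (Pbeta \<beta>)" by (simp add: raise_def)
  have 2: "\<forall>b\<in>Pbeta \<beta>. 1 \<le> raise \<kappa> b"
    using k N unfolding Pbeta_split by (auto simp: raise_tops raise_shift colorings_def)
  \<comment> \<open>Since \<open>w\<close> is a chain, giving all of \<open>tops\<close> the color
    \<open>N\<close> is proper.\<close>
  have chain: "\<not> incomp_beta lt b b'" if t: "b \<in> tops" "b' \<in> tops" for b b'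
  proof -
    obtain x y where xy: "b = (x, 1)" "b' = (y, 1)" "x \<in> set w" "y \<in> set w"
      using t unfolding tops_def by blast
    have "lt x y \<or> lt y x" if "x \<noteq> y"
      using dec that xy(3,4) unfolding decreasing_def
      by (induction w) auto
    then show ?thesis using xy by (auto simp: incomp_beta_iff sim_def)
  qed
  have 3: "\<forall>b\<in>Pbeta \<beta>. \<forall>b'\<in>Pbeta \<beta>. incomp_beta lt b b' \<longrightarrow> raise \<kappa> b \<noteq> raise \<kappa> b'"
  proof (intro ballI impI)
    fix b b' assume *: "b \<in> Pbeta \<beta>" "b' \<in> Pbeta \<beta>" "incomp_beta lt b b'"
    consider "b \<in> tops" "b' \<in> shift ` Pbeta rest" | "b \<in> shift ` Pbeta rest" "b' \<in> tops"
      | "b \<in> shift ` Pbeta rest" "b' \<in> shift ` Pbeta rest"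
      using * chain unfolding Pbeta_split by blast
    then show "raise \<kappa> b \<noteq> raise \<kappa> b'"
    proof cases
      case 1
      then obtain c where "c \<in> Pbeta rest" "b' = shift c" by blast
      then show ?thesis using 1 less[of c] by (simp add: raise_tops raise_shift)
    next
      case 2
      then obtain c where "c \<in> Pbeta rest" "b = shift c" by blast
      then show ?thesis using 2 less[of c] by (simp add: raise_tops raise_shift)
    next
      case 3
      then show ?thesis using k *(3) by (auto simp: raise_shift incomp_shift colorings_def)
    qed
  qed
  have 4: "\<forall>a i j. (a, i) \<in> Pbeta \<beta> \<longrightarrow> (a, j) \<in> Pbeta \<beta> \<longrightarrow> i < j \<longrightarrow> raise \<kappa> (a, i) > raise \<kappa> (a, j)"
  proof (intro allI impI)
    fix a i j assume *: "(a, i) \<in> Pbeta \<beta>" "(a, j) \<in> Pbeta \<beta>" "i < j"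
    have "(a, j) \<notin> tops" using * by (auto simp: tops_def mem_Pbeta)
    then obtain b where b: "b \<in> Pbeta rest" "(a, j) = shift b"
      using * unfolding Pbeta_split by blast
    show "raise \<kappa> (a, i) > raise \<kappa> (a, j)"
    proof (cases "(a, i) \<in> tops")
      case True
      then show ?thesis using less b by (simp add: raise_tops raise_shift)
    next
      case False
      then obtain b' where b': "b' \<in> Pbeta rest" "(a, i) = shift b'"
        using * unfolding Pbeta_split by blast
      have "fst b = a" "fst b' = a" "snd b' < snd b"
        using b b' *(3) by (auto simp: shift_def split: if_splits)
      then have "\<kappa> b' > \<kappa> b"
        using k b(1) b'(1) unfolding colorings_def by (cases b; cases b') auto
      then show ?thesis using b b' by (simp add: raise_shift)
    qed
  qed
  have 5: "\<forall>v. card {b \<in> Pbeta \<beta>. raise \<kappa> b = v} = \<alpha> v"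
  proof
    fix v
    have "card {b \<in> Pbeta rest. \<kappa> b = v} = (\<alpha>(N := 0)) v" using k by (simp add: colorings_def)
    then show "card {b \<in> Pbeta \<beta>. raise \<kappa> b = v} = \<alpha> v"
      using card_color[of "raise \<kappa>" v] by (auto simp: raise_tops lower_raise[OF ext])
  qed
  have 6: "{a \<in> set_mset \<beta>. raise \<kappa> (a, 1) = N} = set w"
  proof (rule set_eqI)
    fix a
    show "a \<in> {a \<in> set_mset \<beta>. raise \<kappa> (a, 1) = N} \<longleftrightarrow> a \<in> set w"
    proof (cases "a \<in> set w")
      case True
      then show ?thesis using w_sub raise_tops[of "(a, 1)"] by (simp add: tops_def)
    next
      case False
      have "raise \<kappa> (a, 1) < N" if "a \<in># \<beta>"
      proof -
        have "(a, 1) \<in> Pbeta rest" using that False by (simp add: mem_Pbeta count_rest Suc_leI)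
        moreover have "shift (a, 1) = (a, 1)" using False by (simp add: shift_def)
        ultimately show ?thesis using raise_shift less by metis
      qed
      then show ?thesis using False by auto
    qed
  qed
  show ?thesis unfolding fiber_def colorings_def using 1 2 3 4 5 6 by blast
qed

text \<open>No color exceeds \<open>N\<close>, so pairs with second member in \<open>tops\<close>
  have weight 1. Pairs from \<open>tops\<close> to the rest always contribute, since the rest has
  smaller colors, and pairs inside the rest keep their comparison under
  \<open>lower\<close>.\<close>

lemma color_weight_fiber:
  fixes q :: "'a \<Rightarrow> 'a \<Rightarrow> 'c::comm_ring_1"
  assumes k: "\<kappa> \<in> fiber"
  shows "color_weight q \<beta> \<kappa> = (\<Prod>a\<in>#mset w. \<Prod>b\<in>#rest. q a b) * color_weight q rest (lower \<kappa>)"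
proof -
  let ?f = "\<lambda>b b'. if \<kappa> b' < \<kappa> b then q (fst b) (fst b') else 1"
  have split: "(\<Prod>b\<in>Pbeta \<beta>. g b) = (\<Prod>b\<in>tops. g b) * (\<Prod>b\<in>Pbeta rest. g (shift b))"
    for g :: "'a \<times> nat \<Rightarrow> 'c"
    unfolding Pbeta_split
    by (subst prod.union_disjoint)
       (auto simp: finite_tops tops_disjoint prod.reindex inj_on_subset[OF shift_inj])
  have tt: "(\<Prod>b'\<in>tops. ?f b b') = 1" if "b \<in> Pbeta \<beta>" for b
  proof (rule prod.neutral, rule ballI)
    fix b' assume "b' \<in> tops"
    then have "\<kappa> b' = N" using fiber_tops[OF k] by blast
    moreover have "\<kappa> b \<le> N" using colors_le that k unfolding fiber_def by blast
    ultimately show "?f b b' = 1" by simp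
  qed
  have "color_weight q \<beta> \<kappa> = (\<Prod>b\<in>Pbeta \<beta>. \<Prod>b'\<in>Pbeta rest. ?f b (shift b'))"
    unfolding color_weight_def by (rule prod.cong[OF refl]) (simp add: split tt)
  also have "\<dots> = (\<Prod>b\<in>tops. \<Prod>b'\<in>Pbeta rest. ?f b (shift b')) *
      (\<Prod>b\<in>Pbeta rest. \<Prod>b'\<in>Pbeta rest. ?f (shift b) (shift b'))"
    by (rule split)
  also have "(\<Prod>b\<in>tops. \<Prod>b'\<in>Pbeta rest. ?f b (shift b')) = (\<Prod>b\<in>tops. \<Prod>b'\<in>Pbeta rest. q (fst b) (fst b'))"
    using fiber_tops[OF k] fiber_less[OF k] by (intro prod.cong refl) simp
  also have "\<dots> = (\<Prod>a\<in>set w. \<Prod>b\<in>#rest. q a b)"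
    unfolding prod_Pbeta by (simp add: tops_def prod.reindex inj_on_def)
  also have "\<dots> = (\<Prod>a\<in>#mset w. \<Prod>b\<in>#rest. q a b)"
    using distinct_w by (simp add: prod_unfold_prod_mset mset_set_set)
  also have "(\<Prod>b\<in>Pbeta rest. \<Prod>b'\<in>Pbeta rest. ?f (shift b) (shift b')) = color_weight q rest (lower \<kappa>)"
    unfolding color_weight_def by (intro prod.cong refl) (simp add: lower_def)
  finally show ?thesis .
qed

lemma sum_fiber:
  fixes q :: "'a \<Rightarrow> 'a \<Rightarrow> 'c::comm_ring_1"
  shows "(\<Sum>\<kappa>\<in>fiber. color_weight q \<beta> \<kappa>) =
    (\<Prod>a\<in>#mset w. \<Prod>b\<in>#\<beta> - mset w. q a b) * X_weighted q lt (\<beta> - mset w) (\<alpha>(N := 0))"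
proof -
  have "lower (raise \<kappa>) = \<kappa>" if "\<kappa> \<in> colorings lt rest (\<alpha>(N := 0))" for \<kappa>
    by (rule lower_raise) (use that in \<open>simp add: colorings_def\<close>)
  then have "(\<Sum>\<kappa>\<in>fiber. color_weight q \<beta> \<kappa>) = (\<Sum>\<kappa>\<in>colorings lt rest (\<alpha>(N := 0)).
      (\<Prod>a\<in>#mset w. \<Prod>b\<in>#rest. q a b) * color_weight q rest \<kappa>)"
    by (intro sum.reindex_bij_witness[of _ raise lower])
       (simp_all add: raise_lower raise_fiber lower_colorings color_weight_fiber)
  then show ?thesis by (simp add: X_weighted_def sum_distrib_left rest_def)
qed

end

text \<open>Colorings are grouped by the decreasing word \<open>g \<kappa>\<close> that lists the
  class of color \<open>N\<close>; the class is a chain because incomparable elements have different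
  colors. It may be empty.\<close>

lemma X_weighted_top_color:
  fixes q :: "'a \<Rightarrow> 'a \<Rightarrow> 'c::comm_ring_1"
  assumes irrefl: "\<And>a. \<not> lt a a" and trans: "\<And>a b c. lt a b \<Longrightarrow> lt b c \<Longrightarrow> lt a c"
    and N: "N \<ge> 1" "\<And>v. v > N \<Longrightarrow> \<alpha> v = 0" and A: "finite A" "set_mset \<beta> \<subseteq> A"
  shows "X_weighted q lt \<beta> \<alpha> =
    (\<Sum>w\<in>{w. set w \<subseteq> A \<and> length w = \<alpha> N \<and> decreasing lt w \<and> mset w \<subseteq># \<beta>}.
      (\<Prod>a\<in>#mset w. \<Prod>b\<in>#\<beta> - mset w. q a b) * X_weighted q lt (\<beta> - mset w) (\<alpha>(N := 0)))"
proof -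
  let ?W = "{w. set w \<subseteq> A \<and> length w = \<alpha> N \<and> decreasing lt w \<and> mset w \<subseteq># \<beta>}"
  define S where "S \<kappa> = {a \<in> set_mset \<beta>. \<kappa> (a, 1) = N}" for \<kappa> :: "'a \<times> nat \<Rightarrow> nat"
  define g where "g \<kappa> = (SOME w. decreasing lt w \<and> set w = S \<kappa>)" for \<kappa>
  have g: "decreasing lt (g \<kappa>) \<and> set (g \<kappa>) = S \<kappa>" if k: "\<kappa> \<in> colorings lt \<beta> \<alpha>" for \<kappa>
  proof -
    have "lt a b \<or> lt b a" if "a \<in> S \<kappa>" "b \<in> S \<kappa>" "a \<noteq> b" for a b
    proof -
      have "(a, 1) \<in> Pbeta \<beta>" "(b, 1) \<in> Pbeta \<beta>" "\<kappa> (a, 1) = \<kappa> (b, 1)"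
        using that by (auto simp: S_def Pbeta_def Suc_leI)
      then have "\<not> incomp_beta lt (a, 1) (b, 1)" using k unfolding colorings_def by blast
      then show ?thesis using that by (auto simp: incomp_beta_iff sim_def)
    qed
    then have "\<exists>w. decreasing lt w \<and> set w = S \<kappa>"
      using decreasing_exists[of "S \<kappa>" lt] irrefl trans by (auto simp: S_def)
    then show ?thesis unfolding g_def by (rule someI_ex)
  qed
  have gW: "g \<kappa> \<in> ?W" if k: "\<kappa> \<in> colorings lt \<beta> \<alpha>" for \<kappa>
  proof -
    have dist: "distinct (g \<kappa>)" using decreasing_distinct[of lt] irrefl g[OF k] by blast
    have "{b \<in> Pbeta \<beta>. \<kappa> b = N} = (\<lambda>a. (a, 1)) ` S \<kappa>"
    proof (rule set_eqI, rule iffI)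
      fix b assume b: "b \<in> {b \<in> Pbeta \<beta>. \<kappa> b = N}"
      obtain a i where ai: "b = (a, i)" by fastforce
      have a1: "(a, 1) \<in> Pbeta \<beta>" using b ai by (auto simp: Pbeta_def)
      \<comment> \<open>A later copy of color \<open>N\<close> would force the first copy above
        \<open>N\<close>, where the exponents vanish.\<close>
      have "i = 1"
      proof (rule ccontr)
        assume "i \<noteq> 1"
        then have "1 < i" using b ai by (auto simp: Pbeta_def)
        then have "\<kappa> (a, i) < \<kappa> (a, 1)" using k b ai a1 by (auto simp: colorings_def)
        then have "\<kappa> (a, 1) > N" using b ai by simp
        then show False using colorings_supp[OF k a1] N(2)[of "\<kappa> (a, 1)"] by simp
      qed
      then have "b = (a, 1)" "a \<in> S \<kappa>" using b ai by (simp_all add: S_def Pbeta_def)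
      then show "b \<in> (\<lambda>a. (a, 1)) ` S \<kappa>" by (rule image_eqI)
    next
      fix b :: "'a \<times> nat" assume "b \<in> (\<lambda>a. (a, 1)) ` S \<kappa>"
      then obtain a where "b = (a, 1)" "a \<in> S \<kappa>" by blast
      then show "b \<in> {b \<in> Pbeta \<beta>. \<kappa> b = N}" by (simp add: S_def Pbeta_def Suc_leI)
    qed
    moreover have "card {b \<in> Pbeta \<beta>. \<kappa> b = N} = \<alpha> N" using k by (simp add: colorings_def)
    ultimately have "card (S \<kappa>) = \<alpha> N" by (simp add: card_image inj_on_def)
    then have len: "length (g \<kappa>) = \<alpha> N" using distinct_card[OF dist] g[OF k] by simp
    have "mset (g \<kappa>) \<subseteq># \<beta>"
    proof (rule mset_subset_eqI)
      fix a
      show "count (mset (g \<kappa>)) a \<le> count \<beta> a"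
        using dist g[OF k] by (cases "a \<in> set (g \<kappa>)")
          (auto simp: distinct_count_atmost_1 S_def Suc_leI count_eq_zero_iff)
    qed
    then show ?thesis using g[OF k] len A by (auto simp: S_def)
  qed
  have finW: "finite ?W" using finite_words[OF A(1), of "\<alpha> N"] by simp
  have "X_weighted q lt \<beta> \<alpha> =
      (\<Sum>w\<in>?W. \<Sum>\<kappa>\<in>{\<kappa> \<in> colorings lt \<beta> \<alpha>. g \<kappa> = w}. color_weight q \<beta> \<kappa>)"
    unfolding X_weighted_def
    by (rule sum.group[symmetric, OF finite_colorings[of N] finW]) (use N gW in auto)
  also have "\<dots> = (\<Sum>w\<in>?W. (\<Prod>a\<in>#mset w. \<Prod>b\<in>#\<beta> - mset w. q a b) *
      X_weighted q lt (\<beta> - mset w) (\<alpha>(N := 0)))"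
  proof (rule sum.cong[OF refl])
    fix w assume w: "w \<in> ?W"
    interpret top_color lt \<beta> w \<alpha> N
      using w N irrefl trans by unfold_locales auto
    have "g \<kappa> = w \<longleftrightarrow> S \<kappa> = set w" if "\<kappa> \<in> colorings lt \<beta> \<alpha>" for \<kappa>
      using g[OF that] decreasing_unique[of lt "g \<kappa>" w] irrefl trans w by blast
    then have "{\<kappa> \<in> colorings lt \<beta> \<alpha>. g \<kappa> = w} = fiber"
      unfolding fiber_def S_def by blast
    then show "(\<Sum>\<kappa>\<in>{\<kappa> \<in> colorings lt \<beta> \<alpha>. g \<kappa> = w}. color_weight q \<beta> \<kappa>) =
        (\<Prod>a\<in>#mset w. \<Prod>b\<in>#\<beta> - mset w. q a b) * X_weighted q lt (\<beta> - mset w) (\<alpha>(N := 0))"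
      using sum_fiber by simp
  qed
  finally show ?thesis .
qed

text \<open>The list is reversed because the largest color is removed first and therefore gives the
  leftmost factor.\<close>

lemma X_weighted_exps:
  fixes q :: "'a \<Rightarrow> 'a \<Rightarrow> 'c::comm_ring_1"
  assumes irrefl: "\<And>a. \<not> lt a a" and trans: "\<And>a b c. lt a b \<Longrightarrow> lt b c \<Longrightarrow> lt a c"
    and comparable: "\<And>a b. lt a b \<Longrightarrow> q b a = 1" and A: "finite A" "set_mset \<beta> \<subseteq> A"
  shows "X_weighted q lt \<beta> (exps a) =
    app (prod_list (map (word_sum (letter_op q) (decreasing lt) A) (rev a))) vacuum \<beta>"
  using A(2)
proof (induction a arbitrary: \<beta> rule: rev_induct)
  case Nil
  have exps: "exps [] = (\<lambda>_. 0)" by (auto simp: exps_def)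
  \<comment> \<open>With no color available only the empty multiset can be colored, and
    extensionality leaves one function.\<close>
  have "colorings lt \<beta> (exps []) = (if \<beta> = {#} then {\<lambda>_. undefined} else {})"
  proof (cases "\<beta> = {#}")
    case True
    then show ?thesis by (auto simp: colorings_def Pbeta_def exps)
  next
    case False
    then obtain a where "a \<in># \<beta>" by blast
    then have "(a, 1) \<in> Pbeta \<beta>" by (simp add: Pbeta_def Suc_leI)
    then have "\<kappa> \<notin> colorings lt \<beta> (exps [])" for \<kappa>
      using colorings_supp[of \<kappa> lt \<beta> "exps []" "(a, 1)"] by (auto simp: exps)
    then show ?thesis using False by auto
  qed
  then show ?case by (auto simp: X_weighted_def vacuum_def color_weight_def Pbeta_def)
next
  case (snoc x a)
  let ?N = "Suc (length a)"
  have upd: "(exps (a @ [x]))(?N := 0) = exps a"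
  proof
    fix v
    consider "v = 0" | "1 \<le> v" "v \<le> length a" | "v = ?N" | "v > ?N" by linarith
    then show "((exps (a @ [x]))(?N := 0)) v = exps a v"
      by cases (auto simp: exps_def nth_append)
  qed
  have x: "exps (a @ [x]) ?N = x" by (simp add: exps_def nth_append)
  have "X_weighted q lt \<beta> (exps (a @ [x])) =
    (\<Sum>w\<in>{w. set w \<subseteq> A \<and> length w = x \<and> decreasing lt w \<and> mset w \<subseteq># \<beta>}.
      (\<Prod>a\<in>#mset w. \<Prod>b\<in>#\<beta> - mset w. q a b) * X_weighted q lt (\<beta> - mset w) (exps a))"
    using X_weighted_top_color[of lt ?N "exps (a @ [x])" A \<beta> q, OF irrefl trans] A(1) snoc.prems
    unfolding upd x by (simp add: exps_def)
  also have "\<dots> = (\<Sum>w\<in>{w. set w \<subseteq> A \<and> length w = x \<and> decreasing lt w \<and> mset w \<subseteq># \<beta>}.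
      (\<Prod>a\<in>#mset w. \<Prod>b\<in>#\<beta> - mset w. q a b) *
      app (prod_list (map (word_sum (letter_op q) (decreasing lt) A) (rev a))) vacuum (\<beta> - mset w))"
    using snoc.prems by (intro sum.cong refl, subst snoc.IH) (auto dest: in_diffD)
  also have "\<dots> = app (prod_list (map (word_sum (letter_op q) (decreasing lt) A) (rev (a @ [x])))) vacuum \<beta>"
    using app_chain_sum_mult[OF A(1), of lt q] comparable by simp
  finally show ?case .
qed

lemma X_weighted_eq_0:
  assumes "\<nexists>a. \<alpha> = exps a"
  shows "X_weighted q lt \<beta> \<alpha> = 0"
proof -
  have "\<kappa> \<notin> colorings lt \<beta> \<alpha>" for \<kappa>
  proof
    assume k: "\<kappa> \<in> colorings lt \<beta> \<alpha>"
    have card: "card {b \<in> Pbeta \<beta>. \<kappa> b = v} = \<alpha> v" for v using k by (simp add: colorings_def)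
    have "{v. \<alpha> v \<noteq> 0} \<subseteq> \<kappa> ` Pbeta \<beta>"
      using card by (smt (verit) Collect_empty_eq card.empty image_eqI mem_Collect_eq subsetI)
    then have "finite {v. \<alpha> v \<noteq> 0}" using finite_subset finite_imageI[OF finite_Pbeta] by metis
    moreover have "\<alpha> 0 = 0"
    proof (rule ccontr)
      assume "\<alpha> 0 \<noteq> 0"
      then have "{b \<in> Pbeta \<beta>. \<kappa> b = 0} \<noteq> {}" using card[of 0] by (metis card.empty)
      then show False using k unfolding colorings_def by fastforce
    qed
    ultimately show False using exps_exists assms by blast
  qed
  then have "colorings lt \<beta> \<alpha> = {}" by blast
  then show ?thesis by (simp add: X_weighted_def)
qed

section \<open>The involution on coefficient functions\<close>

definition sub_lists :: "(nat \<Rightarrow> bool) \<Rightarrow> nat \<Rightarrow> nat list \<Rightarrow> nat list set" where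
  "sub_lists p k a = {b. list_all2 (\<lambda>x y. x \<le> y \<and> p x) b a \<and> sum_list b = k}"

text \<open>On coefficient functions this is multiplication by the complete homogeneous series of
  degree \<open>k\<close> when \<open>p\<close> is always true, and by the elementary one when
  \<open>p\<close> bounds entries by 1.\<close>

definition sub_sum :: "(nat \<Rightarrow> bool) \<Rightarrow> nat \<Rightarrow> (nat list \<Rightarrow> 'c::comm_ring_1) \<Rightarrow> nat list \<Rightarrow> 'c" where
  "sub_sum p k g a = (\<Sum>b\<in>sub_lists p k a. g (map2 (-) a b))"

lemma sub_lists_Nil: "sub_lists p k [] = (if k = 0 then {[]} else {})"
  by (auto simp: sub_lists_def)

lemma sub_lists_Cons: "sub_lists p k (n # a) =
    (\<lambda>(i, b). i # b) ` (SIGMA i:{i. i \<le> n \<and> i \<le> k \<and> p i}. sub_lists p (k - i) a)"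
  by (auto simp: sub_lists_def list_all2_Cons2 image_iff)

lemma finite_sub_lists [simp]: "finite (sub_lists p k a)"
  by (induction a arbitrary: k) (auto simp: sub_lists_Nil sub_lists_Cons)

lemma sub_sum_Nil [simp]: "sub_sum p k g [] = (if k = 0 then g [] else 0)"
  by (simp add: sub_sum_def sub_lists_Nil)

lemma sub_sum_Cons: "sub_sum p k g (n # a) =
    (\<Sum>i\<in>{i. i \<le> n \<and> i \<le> k \<and> p i}. sub_sum p (k - i) (\<lambda>b. g ((n - i) # b)) a)"
proof -
  have "sub_sum p k g (n # a) = (\<Sum>(i, b)\<in>(SIGMA i:{i. i \<le> n \<and> i \<le> k \<and> p i}. sub_lists p (k - i) a).
      g ((n - i) # map2 (-) a b))"
    unfolding sub_sum_def sub_lists_Cons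
    by (subst sum.reindex) (auto simp: inj_on_def intro!: sum.cong)
  then show ?thesis by (simp add: sum.Sigma[symmetric] sub_sum_def)
qed

lemma sub_sum_linear:
  "sub_sum p k (\<lambda>b. \<Sum>j\<in>J. c j * f j b) a = (\<Sum>j\<in>J. c j * sub_sum p k (f j) a)"
  unfolding sub_sum_def by (subst sum.swap) (simp add: sum_distrib_left)

abbreviation "h_sub \<equiv> sub_sum (\<lambda>_. True)"
abbreviation "e_sub \<equiv> sub_sum (\<lambda>x. x \<le> Suc 0)"

lemma sub_sum_Cons_0: "p 0 \<Longrightarrow> sub_sum p k g (0 # a) = sub_sum p k (\<lambda>b. g (0 # b)) a"
proof -
  assume "p 0"
  then have "{i. i \<le> 0 \<and> i \<le> k \<and> p i} = {0}" by auto
  then show ?thesis unfolding sub_sum_Cons by simp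
qed

lemma sub_sum_0: "p 0 \<Longrightarrow> sub_sum p 0 g = g"
proof
  fix a
  assume "p 0"
  then show "sub_sum p 0 g a = g a"
  proof (induction a arbitrary: g)
    case (Cons n a)
    have "{i. i \<le> n \<and> i \<le> 0 \<and> p i} = {0}" using Cons.prems by auto
    then show ?case unfolding sub_sum_Cons by (simp add: Cons)
  qed simp
qed

text \<open>Either nothing is taken from the leading entry or one unit is. After that unit the
  complete series may take more, so the whole list \<open>n # a\<close> stays available; in the
  elementary recursion below the leading entry is closed. The involution exchanges exactly these two
  behaviours.\<close>

lemma h_sub_Suc: "h_sub (Suc k) g (Suc n # a) = h_sub (Suc k) (\<lambda>b. g (Suc n # b)) a + h_sub k g (n # a)"
proof -
  have "{i. i \<le> Suc n \<and> i \<le> Suc k \<and> True} = insert 0 (Suc ` {i. i \<le> n \<and> i \<le> k \<and> True})"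
    using nat.exhaust_sel by (auto simp: image_iff) (metis Suc_le_mono)
  then show ?thesis unfolding sub_sum_Cons by (simp add: sum.reindex)
qed

lemma e_sub_Suc: "e_sub (Suc k) g (Suc n # a) =
    e_sub (Suc k) (\<lambda>b. g (Suc n # b)) a + e_sub k (\<lambda>b. g (n # b)) a"
proof -
  have "{i. i \<le> Suc n \<and> i \<le> Suc k \<and> i \<le> Suc 0} = {0, 1}" by auto
  then show ?thesis unfolding sub_sum_Cons by simp
qed

text \<open>This is quasisymmetry in terms of exponent lists. The involution discards zero entries,
  so the identities below need it of the argument.\<close>

definition ignores_zeros :: "(nat list \<Rightarrow> 'c) \<Rightarrow> bool" where
  "ignores_zeros g \<longleftrightarrow> (\<forall>u v. g (u @ 0 # v) = g (u @ v))"

lemma ignores_zeros_0: "ignores_zeros g \<Longrightarrow> g (0 # b) = g b"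
  unfolding ignores_zeros_def by (metis append_Nil)

lemma ignores_zeros_Cons: "ignores_zeros g \<Longrightarrow> ignores_zeros (\<lambda>b. g (n # b))"
  unfolding ignores_zeros_def by (metis append_Cons)

lemma ignores_zeros_sub_sum: "p 0 \<Longrightarrow> ignores_zeros g \<Longrightarrow> ignores_zeros (sub_sum p k g)"
proof -
  have "sub_sum p k g (u @ 0 # v) = sub_sum p k g (u @ v)" if "p 0" "ignores_zeros g" for u v
    using that
  proof (induction u arbitrary: k g)
    case Nil
    then show ?case by (simp add: sub_sum_Cons_0 ignores_zeros_0)
  next
    case (Cons n u)
    then show ?case by (simp add: sub_sum_Cons ignores_zeros_Cons)
  qed
  then show "p 0 \<Longrightarrow> ignores_zeros g \<Longrightarrow> ignores_zeros (sub_sum p k g)"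
    by (simp add: ignores_zeros_def)
qed

text \<open>The involution on coefficient functions of quasisymmetric series: a block n of the exponent
list is replaced by the signed sum over all compositions of n, so that it carries products of
elementary functions to products of complete homogeneous ones and conversely.\<close>

function list_omega :: "(nat list \<Rightarrow> 'c::comm_ring_1) \<Rightarrow> nat list \<Rightarrow> 'c" where
  "list_omega g [] = g []"
| "list_omega g (0 # a) = list_omega g a"
| "list_omega g (Suc n # a) = (\<Sum>k\<le>n. (-1) ^ k * list_omega (\<lambda>b. g (Suc k # b)) ((n - k) # a))"
  by pat_completeness auto
termination by (relation "measure (\<lambda>(g, a). sum_list a + length a)") auto

lemma list_omega_linear:
  "list_omega (\<lambda>b. \<Sum>j\<in>J. c j * f j b) a = (\<Sum>j\<in>J. c j * list_omega (f j) a)"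
proof (induction "sum_list a + length a" arbitrary: a f rule: less_induct)
  case less
  show ?case
  proof (cases a)
    case (Cons n a')
    show ?thesis
    proof (cases n)
      case 0
      then show ?thesis using less Cons by simp
    next
      case (Suc m)
      have "list_omega (\<lambda>b. \<Sum>j\<in>J. c j * f j b) a =
          (\<Sum>k\<le>m. \<Sum>j\<in>J. (-1) ^ k * (c j * list_omega (\<lambda>b. f j (Suc k # b)) ((m - k) # a')))"
        unfolding Cons Suc list_omega.simps sum_distrib_left[symmetric]
        by (intro sum.cong refl arg_cong[where f = "(*) _"] less) (simp add: Cons Suc)
      also have "\<dots> = (\<Sum>j\<in>J. c j * list_omega (f j) a)"
        unfolding Cons Suc list_omega.simps
        by (subst sum.swap) (simp add: sum_distrib_left algebra_simps)
      finally show ?thesis .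
    qed
  qed simp
qed

lemma list_omega_add: "list_omega (\<lambda>b. f b + g b) a = list_omega f a + list_omega g a"
  using list_omega_linear[of "\<lambda>_. 1" "\<lambda>i. if i then f else g" UNIV a]
  by (simp add: UNIV_bool add.commute)

text \<open>For positive \<open>n\<close> the term \<open>k = 0\<close> is the left side of the
  recursion, its leading zero being dropped, and the remaining terms are the right side with
  opposite sign.\<close>

lemma list_omega_relation:
  assumes "ignores_zeros g"
  shows "(\<Sum>k\<le>n. (-1) ^ k * list_omega (\<lambda>b. g (k # b)) ((n - k) # a)) = (if n = 0 then list_omega g a else 0)"
proof (cases n)
  case 0
  then show ?thesis using assms by (simp add: ignores_zeros_0)
next
  case (Suc m)
  have "(\<Sum>k\<le>n. (-1) ^ k * list_omega (\<lambda>b. g (k # b)) ((n - k) # a)) =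
      list_omega g (Suc m # a) - list_omega g (Suc m # a)"
    unfolding Suc sum.atMost_Suc_shift using assms by (simp add: ignores_zeros_0 sum_negf)
  then show ?thesis by (simp add: Suc)
qed

text \<open>The leading entry is opened by \<open>h_sub_Suc\<close> on one side and by
  \<open>e_sub_Suc\<close> on the other. With its linear companion and the mirror statement below,
  this makes \<open>list_omega\<close> exchange the two kinds of multiplication.\<close>

lemma list_omega_h_sub:
  fixes g :: "nat list \<Rightarrow> 'c::comm_ring_1"
  assumes "ignores_zeros g"
  shows "list_omega (h_sub k g) a = e_sub k (list_omega g) a"
  using assms
proof (induction "sum_list a + length a" arbitrary: a g k rule: less_induct)
  case less
  show ?case
  proof (cases k)
    case 0
    then show ?thesis by (simp add: sub_sum_0)
  next
    case (Suc k')
    show ?thesis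
    proof (cases a)
      case Nil
      then show ?thesis by (simp add: Suc)
    next
      case (Cons m a')
      have IH: "list_omega (h_sub k g) b = e_sub k (list_omega g) b"
        if "ignores_zeros g" "sum_list b + length b < sum_list a + length a"
        for k b and g :: "nat list \<Rightarrow> 'c"
        using less.hyps that by blast
      show ?thesis
      proof (cases m)
        case 0
        then show ?thesis using IH[OF less.prems, of a'] Cons by (simp add: sub_sum_Cons_0)
      next
        case m: (Suc n)
        let ?G = "\<lambda>j. list_omega (\<lambda>b. g (Suc j # b))"
        have "list_omega (h_sub k g) a =
            (\<Sum>j\<le>n. (-1) ^ j * list_omega (h_sub k (\<lambda>b. g (Suc j # b))) ((n - j) # a')) +
            (\<Sum>j\<le>n. (-1) ^ j * list_omega (\<lambda>b. h_sub k' g (j # b)) ((n - j) # a'))"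
          by (simp add: Cons m Suc h_sub_Suc list_omega_add sum.distrib distrib_left)
        \<comment> \<open>This sum collapses unless \<open>n = 0\<close>; the surviving term
          supplies what the sum over \<open>j < n\<close> below, empty in that case, would be
          missing.\<close>
        also have "(\<Sum>j\<le>n. (-1) ^ j * list_omega (\<lambda>b. h_sub k' g (j # b)) ((n - j) # a')) =
            (if n = 0 then e_sub k' (list_omega g) a' else 0)"
          using list_omega_relation[OF ignores_zeros_sub_sum[OF TrueI less.prems]] IH[OF less.prems, of a' k'] Cons
          by simp
        also have "(\<Sum>j\<le>n. (-1) ^ j * list_omega (h_sub k (\<lambda>b. g (Suc j # b))) ((n - j) # a')) =
            (\<Sum>j\<le>n. (-1) ^ j * e_sub k (?G j) ((n - j) # a'))"
          by (intro sum.cong refl arg_cong[where f = "(*) _"] IH ignores_zeros_Cons less.prems)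
             (simp add: Cons m)
        also have "\<dots> = (\<Sum>j\<le>n. (-1) ^ j * e_sub k (\<lambda>b. ?G j ((n - j) # b)) a' +
            (if j < n then (-1) ^ j * e_sub k' (\<lambda>b. ?G j ((n - Suc j) # b)) a' else 0))"
        proof (rule sum.cong[OF refl])
          fix j assume "j \<in> {..n}"
          then consider "j = n" | "j < n" by force
          then show "(-1) ^ j * e_sub k (?G j) ((n - j) # a') =
            (-1) ^ j * e_sub k (\<lambda>b. ?G j ((n - j) # b)) a' +
            (if j < n then (-1) ^ j * e_sub k' (\<lambda>b. ?G j ((n - Suc j) # b)) a' else 0)"
          proof cases
            case 1
            then show ?thesis by (simp add: sub_sum_Cons_0)
          next
            case 2
            then have nj: "n - j = Suc (n - Suc j)" by simp
            show ?thesis using 2 unfolding nj Suc e_sub_Suc by (simp add: distrib_left)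
          qed
        qed
        also have "\<dots> = (\<Sum>j\<le>n. (-1) ^ j * e_sub k (\<lambda>b. ?G j ((n - j) # b)) a') +
            (\<Sum>j<n. (-1) ^ j * e_sub k' (\<lambda>b. ?G j ((n - Suc j) # b)) a')"
          unfolding sum.distrib
          by (intro arg_cong2[where f = "(+)"] refl sum.mono_neutral_cong_right) auto
        also have "(\<Sum>j\<le>n. (-1) ^ j * e_sub k (\<lambda>b. ?G j ((n - j) # b)) a') =
            e_sub k (\<lambda>b. list_omega g (Suc n # b)) a'"
          by (simp add: sub_sum_linear)
        also have "(\<Sum>j<n. (-1) ^ j * e_sub k' (\<lambda>b. ?G j ((n - Suc j) # b)) a') =
            (if n = 0 then 0 else e_sub k' (\<lambda>b. list_omega g (n # b)) a')"
          by (cases n) (simp_all add: sub_sum_linear lessThan_Suc_atMost)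
        finally show ?thesis
          unfolding Cons m Suc e_sub_Suc by simp
      qed
    qed
  qed
qed

text \<open>Here the second sum does not collapse. Apart from its term \<open>j = 0\<close> it
  cancels against the extra terms that \<open>h_sub_Suc\<close> produces in the first sum.\<close>

lemma list_omega_e_sub:
  fixes g :: "nat list \<Rightarrow> 'c::comm_ring_1"
  assumes "ignores_zeros g"
  shows "list_omega (e_sub k g) a = h_sub k (list_omega g) a"
  using assms
proof (induction "sum_list a + length a" arbitrary: a g k rule: less_induct)
  case less
  show ?case
  proof (cases k)
    case 0
    then show ?thesis by (simp add: sub_sum_0)
  next
    case (Suc k')
    show ?thesis
    proof (cases a)
      case Nil
      then show ?thesis by (simp add: Suc)
    next
      case (Cons m a')
      have IH: "list_omega (e_sub k g) b = h_sub k (list_omega g) b"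
        if "ignores_zeros g" "sum_list b + length b < sum_list a + length a"
        for k b and g :: "nat list \<Rightarrow> 'c"
        using less.hyps that by blast
      show ?thesis
      proof (cases m)
        case 0
        then show ?thesis using IH[OF less.prems, of a'] Cons by (simp add: sub_sum_Cons_0)
      next
        case m: (Suc n)
        let ?G = "\<lambda>j. list_omega (\<lambda>b. g (Suc j # b))"
        have "list_omega (e_sub k g) a =
            (\<Sum>j\<le>n. (-1) ^ j * list_omega (e_sub k (\<lambda>b. g (Suc j # b))) ((n - j) # a')) +
            (\<Sum>j\<le>n. (-1) ^ j * list_omega (e_sub k' (\<lambda>b. g (j # b))) ((n - j) # a'))"
          by (simp add: Cons m Suc e_sub_Suc list_omega_add sum.distrib distrib_left)
        also have "(\<Sum>j\<le>n. (-1) ^ j * list_omega (e_sub k' (\<lambda>b. g (j # b))) ((n - j) # a')) =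
            (\<Sum>j\<le>n. (-1) ^ j * h_sub k' (list_omega (\<lambda>b. g (j # b))) ((n - j) # a'))"
          by (intro sum.cong refl arg_cong[where f = "(*) _"] IH ignores_zeros_Cons less.prems)
             (simp add: Cons m)
        also have "\<dots> = h_sub k' (list_omega g) (n # a') -
            (\<Sum>j<n. (-1) ^ j * h_sub k' (?G j) ((n - Suc j) # a'))"
        proof (cases n)
          case 0
          then show ?thesis using less.prems by (simp add: ignores_zeros_0)
        next
          case (Suc n')
          show ?thesis unfolding Suc sum.atMost_Suc_shift lessThan_Suc_atMost
            using less.prems by (simp add: ignores_zeros_0 sum_negf)
        qed
        also have "(\<Sum>j\<le>n. (-1) ^ j * list_omega (e_sub k (\<lambda>b. g (Suc j # b))) ((n - j) # a')) =
            (\<Sum>j\<le>n. (-1) ^ j * h_sub k (?G j) ((n - j) # a'))"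
          by (intro sum.cong refl arg_cong[where f = "(*) _"] IH ignores_zeros_Cons less.prems)
             (simp add: Cons m)
        also have "\<dots> = (\<Sum>j\<le>n. (-1) ^ j * h_sub k (\<lambda>b. ?G j ((n - j) # b)) a' +
            (if j < n then (-1) ^ j * h_sub k' (?G j) ((n - Suc j) # a') else 0))"
        proof (rule sum.cong[OF refl])
          fix j assume "j \<in> {..n}"
          then consider "j = n" | "j < n" by force
          then show "(-1) ^ j * h_sub k (?G j) ((n - j) # a') =
            (-1) ^ j * h_sub k (\<lambda>b. ?G j ((n - j) # b)) a' +
            (if j < n then (-1) ^ j * h_sub k' (?G j) ((n - Suc j) # a') else 0)"
          proof cases
            case 1
            then show ?thesis by (simp add: sub_sum_Cons_0)
          next
            case 2
            then have nj: "n - j = Suc (n - Suc j)" by simp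
            show ?thesis using 2 unfolding nj Suc h_sub_Suc by (simp add: distrib_left)
          qed
        qed
        also have "\<dots> = (\<Sum>j\<le>n. (-1) ^ j * h_sub k (\<lambda>b. ?G j ((n - j) # b)) a') +
            (\<Sum>j<n. (-1) ^ j * h_sub k' (?G j) ((n - Suc j) # a'))"
          unfolding sum.distrib
          by (intro arg_cong2[where f = "(+)"] refl sum.mono_neutral_cong_right) auto
        also have "(\<Sum>j\<le>n. (-1) ^ j * h_sub k (\<lambda>b. ?G j ((n - j) # b)) a') =
            h_sub k (\<lambda>b. list_omega g (Suc n # b)) a'"
          by (simp add: sub_sum_linear)
        finally show ?thesis
          unfolding Cons m Suc h_sub_Suc by simp
      qed
    qed
  qed
qed

section \<open>Products of elementary and complete homogeneous series\<close>

lemma sum_list_exps: "(\<Sum>v\<in>{v. exps b v \<noteq> 0}. exps b v) = sum_list b"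
proof -
  have "sum_list b = (\<Sum>i<length b. b ! i)"
    by (simp add: sum_list_sum_nth atLeast0LessThan)
  also have "\<dots> = (\<Sum>i<length b. exps b (Suc i))"
    by (rule sum.cong) (auto simp: exps_def)
  also have "\<dots> = (\<Sum>v\<in>Suc ` {..<length b}. exps b v)"
    by (simp add: sum.reindex)
  also have "\<dots> = (\<Sum>v\<in>{v. exps b v \<noteq> 0}. exps b v)"
  proof (rule sum.mono_neutral_right)
    show "{v. exps b v \<noteq> 0} \<subseteq> Suc ` {..<length b}"
    proof
      fix v assume "v \<in> {v. exps b v \<noteq> 0}"
      then show "v \<in> Suc ` {..<length b}" by (cases v) (auto simp: exps_def split: if_splits)
    qed
  qed auto
  finally show ?thesis by simp
qed

lemma is_monomial_deg_exps: "is_monomial_deg k (exps b) \<longleftrightarrow> sum_list b = k"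
  using finite_exps[of b] sum_list_exps[of b] by (simp add: is_monomial_deg_def)

lemma exps_inj: "length a = length b \<Longrightarrow> exps a = exps b \<Longrightarrow> a = b"
proof (rule nth_equalityI)
  fix i assume "length a = length b" "exps a = exps b" "i < length a"
  moreover from this have "exps a (Suc i) = exps b (Suc i)" by simp
  ultimately show "a ! i = b ! i" unfolding exps_def by simp
qed

lemma exps_diff: "length b = length a \<Longrightarrow> (\<lambda>v. exps a v - exps b v) = exps (map2 (-) a b)"
  by (rule ext) (auto simp: exps_def)

lemma exps_append_zeros: "exps (a @ replicate m 0) = exps a"
  by (rule ext) (auto simp: exps_def nth_append)

lemma le_exps: "{\<gamma>. \<forall>v. \<gamma> v \<le> exps a v} = exps ` {b. list_all2 (\<le>) b a}"
proof (rule set_eqI, rule iffI)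
  fix \<gamma> assume "\<gamma> \<in> {\<gamma>. \<forall>v. \<gamma> v \<le> exps a v}"
  then have le: "\<gamma> v \<le> exps a v" for v by simp
  define b where "b = map (\<lambda>i. \<gamma> (Suc i)) [0..<length a]"
  have "list_all2 (\<le>) b a"
    unfolding b_def list_all2_conv_all_nth
  proof (intro conjI allI impI)
    fix i assume "i < length (map (\<lambda>i. \<gamma> (Suc i)) [0..<length a])"
    then show "map (\<lambda>i. \<gamma> (Suc i)) [0..<length a] ! i \<le> a ! i"
      using le[of "Suc i"] by (simp add: exps_def)
  qed simp
  moreover have "\<gamma> v = exps b v" for v
    using le[of v] by (cases v) (auto simp: b_def exps_def split: if_splits)
  ultimately show "\<gamma> \<in> exps ` {b. list_all2 (\<le>) b a}" by blast
next
  fix \<gamma> assume "\<gamma> \<in> exps ` {b. list_all2 (\<le>) b a}"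
  then show "\<gamma> \<in> {\<gamma>. \<forall>v. \<gamma> v \<le> exps a v}"
    by (auto simp: exps_def list_all2_conv_all_nth)
qed

lemma finite_list_all2_le: "finite {b :: nat list. list_all2 (\<le>) b a}"
proof (rule finite_subset)
  show "{b. list_all2 (\<le>) b a} \<subseteq> {b. set b \<subseteq> {..sum_list a} \<and> length b = length a}"
  proof
    fix b assume "b \<in> {b. list_all2 (\<le>) b a}"
    then have b: "length b = length a" "\<And>i. i < length a \<Longrightarrow> b ! i \<le> a ! i"
      by (auto simp: list_all2_conv_all_nth)
    have "b ! i \<le> sum_list a" if "i < length a" for i
      using b(2)[OF that] member_le_sum_list[OF nth_mem[OF that]] by simp
    then show "b \<in> {b. set b \<subseteq> {..sum_list a} \<and> length b = length a}"
      using b(1) by (auto simp: in_set_conv_nth)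
  qed
qed (rule finite_lists_length_eq, simp)

lemma all_exps_iff:
  assumes "p 0"
  shows "(\<forall>v. p (exps b v)) \<longleftrightarrow> (\<forall>x\<in>set b. p x)"
proof
  assume *: "\<forall>v. p (exps b v)"
  show "\<forall>x\<in>set b. p x"
  proof
    fix x assume "x \<in> set b"
    then obtain i where "i < length b" "x = b ! i" by (auto simp: in_set_conv_nth)
    then show "p x" using *[rule_format, of "Suc i"] by (simp add: exps_def)
  qed
next
  assume *: "\<forall>x\<in>set b. p x"
  show "\<forall>v. p (exps b v)"
  proof
    fix v
    show "p (exps b v)"
    proof (cases "1 \<le> v \<and> v \<le> length b")
      case True
      then have "b ! (v - 1) \<in> set b" by (intro nth_mem) linarith
      then show ?thesis using * True by (simp add: exps_def)
    next
      case False
      then have "exps b v = 0" by (simp only: exps_def if_False)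
      then show ?thesis using assms by simp
    qed
  qed
qed

text \<open>The predicate \<open>p\<close> allows one argument for \<open>h_sym\<close> and
  \<open>e_sym\<close>: trivially true for the former, a bound by 1 for the latter.\<close>

lemma series_mult_exps:
  assumes "p 0"
  shows "series_mult (\<lambda>\<alpha>. if is_monomial_deg k \<alpha> \<and> (\<forall>v. p (\<alpha> v)) then 1 else 0) f (exps a) =
    sub_sum p k (\<lambda>b. f (exps b)) a"
proof -
  let ?B = "{b. list_all2 (\<le>) b a}"
  note p = all_exps_iff[of p, OF assms]
  have inj: "inj_on exps ?B"
    by (rule inj_onI) (auto intro!: exps_inj dest!: list_all2_lengthD)
  have "series_mult (\<lambda>\<alpha>. if is_monomial_deg k \<alpha> \<and> (\<forall>v. p (\<alpha> v)) then 1 else 0) f (exps a) =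
      (\<Sum>b\<in>?B. (if sum_list b = k \<and> (\<forall>x\<in>set b. p x) then 1 else 0) * f (\<lambda>v. exps a v - exps b v))"
    unfolding series_mult_def le_exps sum.reindex[OF inj] comp_def is_monomial_deg_exps p ..
  also have "\<dots> = (\<Sum>b\<in>?B. if sum_list b = k \<and> (\<forall>x\<in>set b. p x) then f (exps (map2 (-) a b)) else 0)"
    by (rule sum.cong) (auto simp: exps_diff dest: list_all2_lengthD)
  also have "\<dots> = (\<Sum>b\<in>{b \<in> ?B. sum_list b = k \<and> (\<forall>x\<in>set b. p x)}. f (exps (map2 (-) a b)))"
    by (rule sum.inter_filter[symmetric]) (rule finite_list_all2_le)
  also have "{b \<in> ?B. sum_list b = k \<and> (\<forall>x\<in>set b. p x)} = sub_lists p k a"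
    by (auto simp: sub_lists_def list_all2_conv_all_nth all_set_conv_all_nth)
  finally show ?thesis by (simp add: sub_sum_def)
qed

lemma h_part_Cons_exps: "h_part (k # lam) (exps a) = h_sub k (\<lambda>b. h_part lam (exps b)) a"
  using series_mult_exps[of "\<lambda>_. True" k "h_part lam" a] by (simp add: h_part_def h_sym_def[abs_def])

lemma e_part_Cons_exps: "e_part (k # lam) (exps a) = e_sub k (\<lambda>b. e_part lam (exps b)) a"
  using series_mult_exps[of "\<lambda>x. x \<le> Suc 0" k "e_part lam" a] by (simp add: e_part_def e_sym_def[abs_def])

lemma series_mult_eq_0:
  assumes f: "\<And>\<alpha>. \<nexists>a. \<alpha> = exps a \<Longrightarrow> f \<alpha> = 0" and g: "\<And>\<alpha>. \<nexists>a. \<alpha> = exps a \<Longrightarrow> g \<alpha> = 0"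
    and \<alpha>: "\<nexists>a. \<alpha> = exps a"
  shows "series_mult f g \<alpha> = 0"
  unfolding series_mult_def
proof (rule sum.neutral, rule ballI)
  fix \<gamma> assume \<gamma>: "\<gamma> \<in> {\<gamma>. \<forall>v. \<gamma> v \<le> \<alpha> v}"
  show "f \<gamma> * g (\<lambda>v. \<alpha> v - \<gamma> v) = 0"
  proof (rule ccontr)
    assume "\<not> ?thesis"
    then have "f \<gamma> \<noteq> 0" "g (\<lambda>v. \<alpha> v - \<gamma> v) \<noteq> 0" by auto
    then obtain b c where bc: "\<gamma> = exps b" "(\<lambda>v. \<alpha> v - \<gamma> v) = exps c" using f g by blast
    have \<alpha>_eq: "\<alpha> v = exps b v + exps c v" for v
      using \<gamma> fun_cong[OF bc(2), of v] bc(1) by (auto simp: le_add_diff_inverse dest!: spec[of _ v])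
    have "finite {v. \<alpha> v \<noteq> 0}"
      by (rule finite_subset[OF _ finite_UnI[OF finite_exps[of b] finite_exps[of c]]]) (auto simp: \<alpha>_eq)
    moreover have "\<alpha> 0 = 0" by (simp add: \<alpha>_eq)
    ultimately show False using \<alpha> exps_exists by blast
  qed
qed

lemma is_monomial_deg_imp_exps: "is_monomial_deg k \<alpha> \<Longrightarrow> \<exists>a. \<alpha> = exps a"
  by (rule exps_exists) (auto simp: is_monomial_deg_def)

lemma series_one_exps: "series_one (exps a) = (if \<forall>x\<in>set a. x = 0 then 1 else 0)"
  using all_exps_iff[of "\<lambda>x. x = 0" a] by (simp add: series_one_def fun_eq_iff)

lemma series_one_eq_0:
  assumes "\<nexists>a. \<alpha> = exps a"
  shows "series_one \<alpha> = 0"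
proof -
  have nil: "(\<lambda>_. 0) = exps []" by (auto simp: exps_def)
  have "\<alpha> \<noteq> (\<lambda>_. 0)"
  proof
    assume "\<alpha> = (\<lambda>_. 0)"
    then have "\<alpha> = exps []" unfolding nil .
    then show False using assms by blast
  qed
  then show ?thesis by (simp only: series_one_def if_False)
qed

lemma h_part_eq_0: "\<nexists>a. \<alpha> = exps a \<Longrightarrow> h_part lam \<alpha> = (0 :: 'c::comm_ring_1)"
proof (induction lam arbitrary: \<alpha>)
  case Nil
  from series_one_eq_0[OF Nil.prems, where 'a = 'c] show ?case by (simp add: h_part_def)
next
  case (Cons k lam)
  have "series_mult (h_sym k) (h_part lam) \<alpha> = (0 :: 'c)"
  proof (rule series_mult_eq_0)
    show "h_sym k \<alpha> = (0 :: 'c)" if "\<nexists>a. \<alpha> = exps a" for \<alpha>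
      using that is_monomial_deg_imp_exps[of k \<alpha>] unfolding h_sym_def by auto
    show "h_part lam \<alpha> = (0 :: 'c)" if "\<nexists>a. \<alpha> = exps a" for \<alpha>
      using that by (rule Cons.IH)
  qed (rule Cons.prems)
  then show ?case by (simp add: h_part_def)
qed

lemma e_part_eq_0: "\<nexists>a. \<alpha> = exps a \<Longrightarrow> e_part lam \<alpha> = (0 :: 'c::comm_ring_1)"
proof (induction lam arbitrary: \<alpha>)
  case Nil
  from series_one_eq_0[OF Nil.prems, where 'a = 'c] show ?case by (simp add: e_part_def)
next
  case (Cons k lam)
  have "series_mult (e_sym k) (e_part lam) \<alpha> = (0 :: 'c)"
  proof (rule series_mult_eq_0)
    show "e_sym k \<alpha> = (0 :: 'c)" if "\<nexists>a. \<alpha> = exps a" for \<alpha>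
      using that is_monomial_deg_imp_exps[of k \<alpha>] unfolding e_sym_def by auto
    show "e_part lam \<alpha> = (0 :: 'c)" if "\<nexists>a. \<alpha> = exps a" for \<alpha>
      using that by (rule Cons.IH)
  qed (rule Cons.prems)
  then show ?case by (simp add: e_part_def)
qed

section \<open>The involution exchanges elementary and complete products\<close>

lemma ignores_zeros_one: "ignores_zeros (\<lambda>b. series_one (exps b))"
  by (simp add: ignores_zeros_def series_one_exps)

lemma list_omega_zero: "list_omega (\<lambda>b. 0) a = 0"
  using list_omega_linear[of "\<lambda>_. 0" "\<lambda>_ _. 0" "{}" a] by simp

lemma list_omega_one: "list_omega (\<lambda>b. series_one (exps b)) a = series_one (exps a)"
proof (induction a)
  case Nil
  show ?case by (simp only: list_omega.simps)
next
  case (Cons n a)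
  show ?case
  proof (cases n)
    case 0
    then show ?thesis using Cons by (simp add: series_one_exps)
  next
    case (Suc m)
    then show ?thesis by (simp add: series_one_exps list_omega_zero)
  qed
qed

lemma ignores_zeros_h_part: "ignores_zeros (\<lambda>b. h_part lam (exps b) :: 'c::comm_ring_1)"
proof (induction lam)
  case Nil
  then show ?case using ignores_zeros_one by (simp add: h_part_def)
next
  case (Cons k lam)
  have "ignores_zeros (h_sub k (\<lambda>b. h_part lam (exps b) :: 'c))"
    by (rule ignores_zeros_sub_sum) (simp, rule Cons.IH)
  then show ?case by (simp only: h_part_Cons_exps)
qed

lemma ignores_zeros_e_part: "ignores_zeros (\<lambda>b. e_part lam (exps b) :: 'c::comm_ring_1)"
proof (induction lam)
  case Nil
  then show ?case using ignores_zeros_one by (simp add: e_part_def)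
next
  case (Cons k lam)
  have "ignores_zeros (e_sub k (\<lambda>b. e_part lam (exps b) :: 'c))"
    by (rule ignores_zeros_sub_sum) (simp, rule Cons.IH)
  then show ?case by (simp only: e_part_Cons_exps)
qed

lemma list_omega_h_part:
  "list_omega (\<lambda>b. h_part lam (exps b) :: 'c::comm_ring_1) a = e_part lam (exps a)"
proof (induction lam arbitrary: a)
  case Nil
  then show ?case using list_omega_one by (simp add: h_part_def e_part_def)
next
  case (Cons k lam)
  have "list_omega (\<lambda>b. h_part lam (exps b) :: 'c) = (\<lambda>a. e_part lam (exps a))"
    by (rule ext) (rule Cons.IH)
  then show ?case
    by (simp add: h_part_Cons_exps e_part_Cons_exps list_omega_h_sub[OF ignores_zeros_h_part])
qed

lemma list_omega_e_part:
  "list_omega (\<lambda>b. e_part lam (exps b) :: 'c::comm_ring_1) a = h_part lam (exps a)"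
proof (induction lam arbitrary: a)
  case Nil
  then show ?case using list_omega_one by (simp add: h_part_def e_part_def)
next
  case (Cons k lam)
  have "list_omega (\<lambda>b. e_part lam (exps b) :: 'c) = (\<lambda>a. h_part lam (exps a))"
    by (rule ext) (rule Cons.IH)
  then show ?case
    by (simp add: h_part_Cons_exps e_part_Cons_exps list_omega_e_sub[OF ignores_zeros_e_part])
qed

text \<open>Any two expansions in the h basis have the same image, because that image is computed by
list_omega from the series alone; linear independence of the h basis is not required.\<close>

lemma omega_eqI:
  fixes c :: "nat list \<Rightarrow> 'c::comm_ring_1"
  assumes S: "finite S" "\<And>lam. lam \<in> S \<Longrightarrow> is_partition lam"
    and f: "\<And>\<alpha>. f \<alpha> = (\<Sum>lam\<in>S. c lam * h_part lam \<alpha>)"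
    and g: "\<And>\<alpha>. g \<alpha> = (\<Sum>lam\<in>S. c lam * e_part lam \<alpha>)"
  shows "omega f = g"
proof -
  define c' where "c' lam = (if lam \<in> S then c lam else 0)" for lam
  have c'S: "{lam. c' lam \<noteq> 0} \<subseteq> S" by (auto simp: c'_def)
  have c': "(\<Sum>lam\<in>S. c lam * t lam) = (\<Sum>lam\<in>{lam. c' lam \<noteq> 0}. c' lam * t lam)" for t
    by (rule sum.mono_neutral_cong_right[OF S(1) c'S]) (auto simp: c'_def)
  show ?thesis
    unfolding omega_def
  proof (rule the_equality)
    show "\<exists>c. finite {lam. c lam \<noteq> 0} \<and> (\<forall>lam. c lam \<noteq> 0 \<longrightarrow> is_partition lam) \<and>
      f = (\<lambda>\<alpha>. \<Sum>lam\<in>{lam. c lam \<noteq> 0}. c lam * h_part lam \<alpha>) \<and>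
      g = (\<lambda>\<alpha>. \<Sum>lam\<in>{lam. c lam \<noteq> 0}. c lam * e_part lam \<alpha>)"
    proof (intro exI[of _ c'] conjI)
      show "finite {lam. c' lam \<noteq> 0}" using finite_subset[OF c'S S(1)] .
      show "\<forall>lam. c' lam \<noteq> 0 \<longrightarrow> is_partition lam" using S(2) c'S by blast
      show "f = (\<lambda>\<alpha>. \<Sum>lam\<in>{lam. c' lam \<noteq> 0}. c' lam * h_part lam \<alpha>)"
        by (rule ext) (rule trans[OF f c'])
      show "g = (\<lambda>\<alpha>. \<Sum>lam\<in>{lam. c' lam \<noteq> 0}. c' lam * e_part lam \<alpha>)"
        by (rule ext) (rule trans[OF g c'])
    qed
  next
    fix g' assume "\<exists>c. finite {lam. c lam \<noteq> 0} \<and> (\<forall>lam. c lam \<noteq> 0 \<longrightarrow> is_partition lam) \<and>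
      f = (\<lambda>\<alpha>. \<Sum>lam\<in>{lam. c lam \<noteq> 0}. c lam * h_part lam \<alpha>) \<and>
      g' = (\<lambda>\<alpha>. \<Sum>lam\<in>{lam. c lam \<noteq> 0}. c lam * e_part lam \<alpha>)"
    then obtain d where d: "f = (\<lambda>\<alpha>. \<Sum>lam\<in>{lam. d lam \<noteq> 0}. d lam * h_part lam \<alpha>)"
      "g' = (\<lambda>\<alpha>. \<Sum>lam\<in>{lam. d lam \<noteq> 0}. d lam * e_part lam \<alpha>)" by blast
    show "g' = g"
    proof
      fix \<alpha>
      show "g' \<alpha> = g \<alpha>"
      proof (cases "\<exists>a. \<alpha> = exps a")
        case True
        then obtain a where a: "\<alpha> = exps a" by blast
        have "g' \<alpha> = list_omega (\<lambda>b. f (exps b)) a"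
          by (simp add: d a list_omega_linear list_omega_h_part)
        also have "\<dots> = g \<alpha>" by (simp add: f g a list_omega_linear list_omega_h_part)
        finally show ?thesis .
      next
        case False
        then have "e_part lam \<alpha> = (0 :: 'c)" for lam by (rule e_part_eq_0)
        then show ?thesis by (simp add: d(2) g)
      qed
    qed
  qed
qed

section \<open>Symmetric series are spanned by elementary products\<close>

text \<open>This is the sum of all prefix sums: an entry counts once for each prefix containing
  it.\<close>

fun prefix_weight :: "nat list \<Rightarrow> nat" where
  "prefix_weight [] = 0"
| "prefix_weight (x # a) = x * Suc (length a) + prefix_weight a"

lemma prefix_weight_add:
  "length a = length b \<Longrightarrow> prefix_weight (map2 (+) a b) = prefix_weight a + prefix_weight b"
  by (induction a b rule: list_induct2) (simp_all add: algebra_simps)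

text \<open>The list \<open>b0\<close> has its ones in front, the heaviest position, and each of the
  \<open>d\<close> additional ones of \<open>b\<close> weighs at most the length. The slack
  \<open>d\<close> lets the induction pass a place where the two lists differ.\<close>

lemma prefix_weight_01_le:
  assumes "length b = length b0" "set b \<subseteq> {0, 1}" "set b0 \<subseteq> {0, 1}" "sorted (rev b0)"
    "sum_list b = sum_list b0 + d"
  shows "prefix_weight b \<le> prefix_weight b0 + d * length b0"
  using assms
proof (induction b b0 arbitrary: d rule: list_induct2)
  case (Cons y b x b0)
  have IH: "prefix_weight b \<le> prefix_weight b0 + d' * length b0" if "sum_list b = sum_list b0 + d'" for d'
    using Cons.IH[of d'] Cons.prems that by (simp add: sorted_append)
  consider "x = y" | "x = 0" "y = 1" | "x = 1" "y = 0" using Cons.prems by auto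
  then show ?case
  proof cases
    case 1
    then show ?thesis using IH[of d] Cons.prems Cons.hyps by simp
  next
    case 2
    then have "\<forall>z\<in>set b0. z = 0" using Cons.prems by (auto simp: sorted_append)
    then have zero: "sum_list b0 = 0" by (simp only: sum_list_eq_0_iff)
    then obtain d' where "d = Suc d'" "sum_list b = sum_list b0 + d'"
      using Cons.prems(4) 2 unfolding zero by (cases d) (auto simp: zero)
    then show ?thesis using IH[of d'] 2 Cons.hyps by simp
  next
    case 3
    then show ?thesis using IH[of "Suc d"] Cons.prems Cons.hyps by simp
  qed
qed simp

text \<open>At the first difference \<open>b\<close> has 0 where \<open>b0\<close> has 1. This loses
  one more than the length of the tail, while the one extra unit in the tail regains at most that
  length.\<close>

lemma prefix_weight_01_less:
  assumes "length b = length b0" "set b \<subseteq> {0, 1}" "set b0 \<subseteq> {0, 1}" "sorted (rev b0)"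
    "sum_list b = sum_list b0"
  shows "prefix_weight b < prefix_weight b0 \<or> b = b0"
  using assms
proof (induction b b0 rule: list_induct2)
  case (Cons y b x b0)
  consider "x = y" | "x = 0" "y = 1" | "x = 1" "y = 0" using Cons.prems by auto
  then show ?case
  proof cases
    case 1
    then show ?thesis using Cons by (auto simp: sorted_append)
  next
    case 2
    then have "\<forall>z\<in>set b0. z = 0" using Cons.prems by (auto simp: sorted_append)
    then have zero: "sum_list b0 = 0" by (simp only: sum_list_eq_0_iff)
    then show ?thesis using Cons.prems(4) 2 by (simp add: zero)
  next
    case 3
    then have "prefix_weight b \<le> prefix_weight b0 + 1 * length b0"
      using Cons.prems Cons.hyps by (intro prefix_weight_01_le) (auto simp: sorted_append)
    then show ?thesis using 3 Cons.hyps by simp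
  qed
qed simp

lemma sub_lists_01D:
  assumes "b \<in> sub_lists (\<lambda>x. x \<le> Suc 0) k a"
  shows "length b = length a" "set b \<subseteq> {0, 1}" "sum_list b = k" "map2 (+) (map2 (-) a b) b = a"
    "sum_list (map2 (-) a b) + k = sum_list a"
proof -
  have *: "list_all2 (\<lambda>x y. x \<le> y \<and> x \<le> Suc 0) b a" "sum_list b = k"
    using assms by (auto simp: sub_lists_def)
  show "length b = length a" "sum_list b = k" using * list_all2_lengthD by auto
  have "length b = length a" using * list_all2_lengthD by auto
  then have "set b \<subseteq> {0, 1} \<and> map2 (+) (map2 (-) a b) b = a \<and> sum_list (map2 (-) a b) + sum_list b = sum_list a"
    using *(1) by (induction b a rule: list_induct2) auto
  then show "set b \<subseteq> {0, 1}" "map2 (+) (map2 (-) a b) b = a" "sum_list (map2 (-) a b) + k = sum_list a"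
    using *(2) by auto
qed

lemma e_part_degree: "e_part lam (exps a) \<noteq> (0 :: 'c::comm_ring_1) \<Longrightarrow> sum_list a = sum_list lam"
proof (induction lam arbitrary: a)
  case Nil
  then show ?case by (auto simp: e_part_def series_one_exps split: if_splits)
next
  case (Cons k lam)
  from Cons.prems have "(\<Sum>b\<in>sub_lists (\<lambda>x. x \<le> Suc 0) k a. e_part lam (exps (map2 (-) a b))) \<noteq> (0 :: 'c)"
    unfolding e_part_Cons_exps sub_sum_def .
  then obtain b where b: "b \<in> sub_lists (\<lambda>x. x \<le> Suc 0) k a" "e_part lam (exps (map2 (-) a b)) \<noteq> (0 :: 'c)"
    by (rule sum.not_neutral_contains_not_neutral)
  then show ?case using Cons.IH[OF b(2)] sub_lists_01D(5)[OF b(1)] by simp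
qed

text \<open>The partition is the conjugate of the exponent list, and prefix_weight, a strictly
decreasing linear functional, stands in for the dominance order.\<close>

lemma e_part_leading:
  assumes "sorted (rev \<mu>)"
  shows "\<exists>lam. is_partition lam \<and> (\<forall>k\<in>set lam. k \<le> length (filter (\<lambda>x. x \<noteq> 0) \<mu>)) \<and>
    sum_list lam = sum_list \<mu> \<and> e_part lam (exps \<mu>) = (1 :: 'c::comm_ring_1) \<and>
    (\<forall>\<nu>. length \<nu> = length \<mu> \<longrightarrow> e_part lam (exps \<nu>) \<noteq> (0 :: 'c) \<longrightarrow>
      prefix_weight \<nu> < prefix_weight \<mu> \<or> \<nu> = \<mu>)"
  using assms
proof (induction "sum_list \<mu>" arbitrary: \<mu> rule: less_induct)
  case less
  show ?case
  proof (cases "\<forall>x\<in>set \<mu>. x = 0")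
    case True
    have "\<nu> = \<mu>" if "length \<nu> = length \<mu>" "e_part [] (exps \<nu>) \<noteq> (0 :: 'c)" for \<nu>
    proof -
      have "\<forall>x\<in>set \<nu>. x = 0"
        using that(2) by (auto simp: e_part_def series_one_exps split: if_splits)
      then show ?thesis using True that(1) by (metis replicate_eqI)
    qed
    then show ?thesis using True
      by (intro exI[of _ "[]"]) (auto simp: is_partition_def e_part_def series_one_exps)
  next
    case False
    \<comment> \<open>In diagram terms, \<open>b0\<close> is the first column of
      \<open>\<mu>\<close>, \<open>k\<close> is its height, hence the first part of the conjugate,
      and \<open>\<mu>'\<close> is the diagram without it.\<close>
    define \<mu>' where "\<mu>' = map (\<lambda>x. x - 1) \<mu>"
    define b0 where "b0 = map (\<lambda>x. if x = 0 then 0 else 1 :: nat) \<mu>"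
    define k where "k = sum_list b0"
    have k: "k = length (filter (\<lambda>x. x \<noteq> 0) \<mu>)"
      unfolding k_def b0_def by (induction \<mu>) auto
    have b0: "length b0 = length \<mu>" "set b0 \<subseteq> {0, 1}" by (auto simp: b0_def)
    have sorted_b0: "sorted (rev b0)"
      using less.prems unfolding b0_def rev_map sorted_map
      by (rule sorted_wrt_mono_rel[rotated]) auto
    have sorted_\<mu>': "sorted (rev \<mu>')"
      using less.prems unfolding \<mu>'_def rev_map sorted_map
      by (rule sorted_wrt_mono_rel[rotated]) auto
    have add: "map2 (+) \<mu>' b0 = \<mu>" unfolding \<mu>'_def b0_def by (induction \<mu>) auto
    have diff: "map2 (-) \<mu> b0 = \<mu>'" unfolding \<mu>'_def b0_def by (induction \<mu>) auto
    have b0_sub: "b0 \<in> sub_lists (\<lambda>x. x \<le> Suc 0) k \<mu>"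
      by (auto simp: sub_lists_def k_def b0_def list_all2_conv_all_nth)
    have sum: "sum_list \<mu>' + k = sum_list \<mu>" using sub_lists_01D(5)[OF b0_sub] diff by simp
    have "k > 0" using False by (auto simp: k filter_empty_conv)
    then obtain lam where lam: "is_partition lam" "\<forall>j\<in>set lam. j \<le> length (filter (\<lambda>x. x \<noteq> 0) \<mu>')"
      "sum_list lam = sum_list \<mu>'" "e_part lam (exps \<mu>') = (1 :: 'c)"
      and lead: "\<And>\<nu>. length \<nu> = length \<mu>' \<Longrightarrow> e_part lam (exps \<nu>) \<noteq> (0 :: 'c) \<Longrightarrow>
        prefix_weight \<nu> < prefix_weight \<mu>' \<or> \<nu> = \<mu>'"
      using less.hyps[OF _ sorted_\<mu>'] sum by auto
    have len: "length \<mu>' = length \<mu>" by (simp add: \<mu>'_def)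
    have w\<mu>: "prefix_weight \<mu> = prefix_weight \<mu>' + prefix_weight b0"
      using prefix_weight_add[of \<mu>' b0] add len b0 by simp
    \<comment> \<open>The bound on the parts carried in the induction statement keeps
      \<open>k # lam\<close> weakly decreasing.\<close>
    have le_k: "\<forall>j\<in>set lam. j \<le> k"
    proof -
      have "length (filter (\<lambda>x. x \<noteq> 0) \<mu>') \<le> k" unfolding k \<mu>'_def by (induction \<mu>) auto
      then show ?thesis using lam(2) by force
    qed
    have part: "is_partition (k # lam)"
      using lam(1) le_k \<open>k > 0\<close> by (auto simp: is_partition_def sorted_append)
    have b_le: "prefix_weight b < prefix_weight b0 \<or> b = b0"
      if "b \<in> sub_lists (\<lambda>x. x \<le> Suc 0) k \<nu>" "length \<nu> = length \<mu>" for b \<nu>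
      using sub_lists_01D[OF that(1)] that(2) b0 sorted_b0
      by (intro prefix_weight_01_less) (auto simp: k_def)
    have w: "prefix_weight \<nu> = prefix_weight (map2 (-) \<nu> b) + prefix_weight b"
      if "b \<in> sub_lists (\<lambda>x. x \<le> Suc 0) k \<nu>" for b \<nu>
      using prefix_weight_add[of "map2 (-) \<nu> b" b] sub_lists_01D[OF that] by simp
    have "e_part (k # lam) (exps \<mu>) =
        (\<Sum>b\<in>sub_lists (\<lambda>x. x \<le> Suc 0) k \<mu>. if b = b0 then 1 else 0 :: 'c)"
      unfolding e_part_Cons_exps sub_sum_def
    proof (rule sum.cong[OF refl])
      fix b assume b: "b \<in> sub_lists (\<lambda>x. x \<le> Suc 0) k \<mu>"
      show "e_part lam (exps (map2 (-) \<mu> b)) = (if b = b0 then 1 else 0 :: 'c)"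
      proof (cases "b = b0")
        case True
        then show ?thesis using diff lam by simp
      next
        case False
        \<comment> \<open>Removing a lighter list than \<open>b0\<close> leaves a remainder heavier
          than \<open>\<mu>'\<close>, where \<open>e_part lam\<close> vanishes by induction.\<close>
        then have "prefix_weight b < prefix_weight b0" using b_le[OF b] by simp
        then have "prefix_weight (map2 (-) \<mu> b) > prefix_weight \<mu>'" using w[OF b] w\<mu> by simp
        then show ?thesis
          using lead[of "map2 (-) \<mu> b"] sub_lists_01D(1)[OF b] len False by fastforce
      qed
    qed
    then have one: "e_part (k # lam) (exps \<mu>) = (1 :: 'c)" using b0_sub by simp
    have "prefix_weight \<nu> < prefix_weight \<mu> \<or> \<nu> = \<mu>"
      if \<nu>: "length \<nu> = length \<mu>" "e_part (k # lam) (exps \<nu>) \<noteq> (0 :: 'c)" for \<nu>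
    proof -
      obtain b where b: "b \<in> sub_lists (\<lambda>x. x \<le> Suc 0) k \<nu>" "e_part lam (exps (map2 (-) \<nu> b)) \<noteq> (0 :: 'c)"
        using \<nu>(2) unfolding e_part_Cons_exps sub_sum_def by (rule sum.not_neutral_contains_not_neutral)
      have "prefix_weight (map2 (-) \<nu> b) < prefix_weight \<mu>' \<or> map2 (-) \<nu> b = \<mu>'"
        using lead[OF _ b(2)] sub_lists_01D(1)[OF b(1)] \<nu>(1) len by simp
      then show ?thesis
        using b_le[OF b(1) \<nu>(1)] w[OF b(1)] w\<mu> sub_lists_01D(4)[OF b(1)] add by auto
    qed
    then show ?thesis
      using part one le_k sum lam(3) k by (intro exI[of _ "k # lam"]) auto
  qed
qed

section \<open>Elementary products are symmetric\<close>

lemma sub_lists_permute: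
  assumes \<pi>: "\<pi> permutes {..<length a}"
  shows "sub_lists p k (permute_list \<pi> a) = permute_list \<pi> ` sub_lists p k a"
proof (rule set_eqI, rule iffI)
  fix b assume "b \<in> permute_list \<pi> ` sub_lists p k a"
  then obtain b' where b': "b = permute_list \<pi> b'" "list_all2 (\<lambda>x y. x \<le> y \<and> p x) b' a" "sum_list b' = k"
    by (auto simp: sub_lists_def)
  have "length b' = length a" using b'(2) list_all2_lengthD by blast
  then have \<pi>': "\<pi> permutes {..<length b'}" using \<pi> by simp
  have "sum_list b = k" using b' mset_permute_list[OF \<pi>'] by (metis sum_mset_sum_list)
  then show "b \<in> sub_lists p k (permute_list \<pi> a)"
    using b' list_all2_permute_list_iff[OF \<pi>', of _ a] by (simp add: sub_lists_def)
next
  fix b assume "b \<in> sub_lists p k (permute_list \<pi> a)"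
  then have b: "list_all2 (\<lambda>x y. x \<le> y \<and> p x) b (permute_list \<pi> a)" "sum_list b = k"
    by (auto simp: sub_lists_def)
  have len: "length b = length a" using list_all2_lengthD[OF b(1)] by simp
  define b' where "b' = permute_list (inv \<pi>) b"
  have \<pi>': "\<pi> permutes {..<length b}" using \<pi> len by simp
  have inv: "inv \<pi> permutes {..<length b}" using permutes_inv[OF \<pi>'] .
  have bb': "permute_list \<pi> b' = b"
    unfolding b'_def using permute_list_compose[OF \<pi>', of "inv \<pi>"] permutes_inv_o(2)[OF \<pi>'] by simp
  have "sum_list b' = k" using b mset_permute_list[OF inv] unfolding b'_def by (metis sum_mset_sum_list)
  moreover have "list_all2 (\<lambda>x y. x \<le> y \<and> p x) b' a"
    using b(1) list_all2_permute_list_iff[of \<pi> b' _ a] bb' \<pi>' by (simp add: b'_def)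
  ultimately show "b \<in> permute_list \<pi> ` sub_lists p k a"
    using bb' by (auto simp: sub_lists_def image_iff)
qed

text \<open>A permutation of the exponent list permutes the subtracted lists along with it, so
  corresponding differences are rearrangements of each other.\<close>

lemma sub_sum_mset_cong:
  assumes sym: "\<And>a b. mset a = mset b \<Longrightarrow> g a = g b" and "mset a = mset b"
  shows "sub_sum p k g a = sub_sum p k g b"
proof -
  obtain \<pi> where \<pi>: "\<pi> permutes {..<length b}" "permute_list \<pi> b = a"
    using mset_eq_permutation[OF assms(2)] by blast
  have len: "length c = length b" if "c \<in> sub_lists p k b" for c
    using that list_all2_lengthD by (auto simp: sub_lists_def)
  have "inj_on (permute_list \<pi>) (sub_lists p k b)"
  proof (rule inj_onI)
    fix c d assume cd: "c \<in> sub_lists p k b" "d \<in> sub_lists p k b" "permute_list \<pi> c = permute_list \<pi> d"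
    have \<pi>c: "inv \<pi> permutes {..<length c}" "inv \<pi> permutes {..<length d}"
      using permutes_inv[OF \<pi>(1)] len cd by simp_all
    have "permute_list (inv \<pi>) (permute_list \<pi> c) = permute_list (inv \<pi>) (permute_list \<pi> d)"
      using cd(3) by simp
    then show "c = d"
      using permute_list_compose[OF \<pi>c(1), of \<pi>] permute_list_compose[OF \<pi>c(2), of \<pi>]
        permutes_inv_o(1)[OF \<pi>(1)] by simp
  qed
  then have "sub_sum p k g a = (\<Sum>c\<in>sub_lists p k b. g (map2 (-) (permute_list \<pi> b) (permute_list \<pi> c)))"
    unfolding sub_sum_def \<pi>(2)[symmetric] sub_lists_permute[OF \<pi>(1)] by (simp add: sum.reindex)
  also have "\<dots> = sub_sum p k g b"
    unfolding sub_sum_def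
  proof (rule sum.cong[OF refl])
    fix c assume c: "c \<in> sub_lists p k b"
    have "permute_list \<pi> (map2 (-) b c) = map (\<lambda>(x, y). x - y) (permute_list \<pi> (zip b c))"
      by (rule permute_list_map) (use \<pi>(1) len[OF c] in simp)
    also have "permute_list \<pi> (zip b c) = zip (permute_list \<pi> b) (permute_list \<pi> c)"
      by (rule permute_list_zip[OF \<pi>(1) refl]) (use len[OF c] in simp)
    finally have "map2 (-) (permute_list \<pi> b) (permute_list \<pi> c) = permute_list \<pi> (map2 (-) b c)" by simp
    also have "mset \<dots> = mset (map2 (-) b c)"
      by (rule mset_permute_list) (use \<pi>(1) len[OF c] in simp)
    finally show "g (map2 (-) (permute_list \<pi> b) (permute_list \<pi> c)) = g (map2 (-) b c)" by (rule sym)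
  qed
  finally show ?thesis .
qed

lemma e_part_mset_cong: "mset a = mset b \<Longrightarrow> e_part lam (exps a) = e_part lam (exps b)"
proof (induction lam arbitrary: a b)
  case Nil
  then have "set a = set b" by (metis set_mset_mset)
  then show ?case by (simp add: e_part_def series_one_exps)
next
  case (Cons k lam)
  show ?case unfolding e_part_Cons_exps by (rule sub_sum_mset_cong) (use Cons in blast)+
qed

definition symmetric_of_degree :: "nat \<Rightarrow> (nat list \<Rightarrow> 'c::zero) \<Rightarrow> bool" where
  "symmetric_of_degree n f \<longleftrightarrow> (\<forall>a b. mset a = mset b \<longrightarrow> f a = f b) \<and>
    (\<forall>a m. f (a @ replicate m 0) = f a) \<and> (\<forall>a. f a \<noteq> 0 \<longrightarrow> sum_list a = n)"

lemma symmetric_of_degree_e_part: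
  "symmetric_of_degree (sum_list lam) (\<lambda>a. e_part lam (exps a) :: 'c::comm_ring_1)"
  unfolding symmetric_of_degree_def
proof (intro conjI allI impI)
  fix a b :: "nat list" and m :: nat
  show "mset a = mset b \<Longrightarrow> e_part lam (exps a) = (e_part lam (exps b) :: 'c)"
    by (rule e_part_mset_cong)
  show "e_part lam (exps (a @ replicate m 0)) = (e_part lam (exps a) :: 'c)"
    by (simp only: exps_append_zeros)
  show "e_part lam (exps a) \<noteq> (0 :: 'c) \<Longrightarrow> sum_list a = sum_list lam"
    by (rule e_part_degree)
qed

text \<open>Partitions of \<open>n\<close>, padded with zeros to the common length \<open>n\<close>,
  so that their prefix weights are comparable.\<close>

definition sorted_exps :: "nat \<Rightarrow> nat list set" where
  "sorted_exps n = {\<nu>. length \<nu> = n \<and> sorted (rev \<nu>) \<and> sum_list \<nu> = n}"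

lemma finite_sorted_exps: "finite (sorted_exps n)"
proof (rule finite_subset)
  show "sorted_exps n \<subseteq> {\<nu>. set \<nu> \<subseteq> {..n} \<and> length \<nu> = n}"
  proof
    fix \<nu> assume \<nu>: "\<nu> \<in> sorted_exps n"
    have "x \<le> sum_list \<nu>" if "x \<in> set \<nu>" for x by (rule member_le_sum_list) (use that in auto)
    then show "\<nu> \<in> {\<nu>. set \<nu> \<subseteq> {..n} \<and> length \<nu> = n}" using \<nu> by (auto simp: sorted_exps_def)
  qed
qed (rule finite_lists_length_eq, simp)

text \<open>A list of sum \<open>n\<close> has at most \<open>n\<close> nonzero entries, so up to
  order and zeros it is one of the padded partitions.\<close>

lemma symmetric_eq_0:
  assumes f: "symmetric_of_degree n f" and zero: "\<And>\<nu>. \<nu> \<in> sorted_exps n \<Longrightarrow> f \<nu> = 0"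
  shows "f a = 0"
proof (rule ccontr)
  assume "f a \<noteq> 0"
  then have n: "sum_list a = n" using f unfolding symmetric_of_degree_def by blast
  define c where "c = filter (\<lambda>x. x \<noteq> 0) a"
  define z where "z = length (filter (\<lambda>x. x = 0) a)"
  have ac: "mset a = mset c + replicate_mset z 0"
    unfolding c_def z_def by (induction a) auto
  have "length c \<le> sum_list c" unfolding c_def by (induction a) auto
  moreover have sc: "sum_list c = n" unfolding n[symmetric] c_def by (induction a) auto
  ultimately have len: "length c \<le> n" by simp
  define \<nu> where "\<nu> = rev (sort (c @ replicate (n - length c) 0))"
  have "sum_list \<nu> = n" unfolding \<nu>_def sum_mset_sum_list[symmetric] using sc by (simp add: sum_mset_sum_list)
  then have "\<nu> \<in> sorted_exps n" using len by (simp add: sorted_exps_def \<nu>_def)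
  then have "f \<nu> = 0" by (rule zero)
  moreover have "mset (a @ replicate (n - length c) 0) = mset (\<nu> @ replicate z 0)"
    by (simp add: \<nu>_def ac)
  ultimately have "f a = 0" using f unfolding symmetric_of_degree_def by metis
  then show False using \<open>f a \<noteq> 0\<close> by contradiction
qed

definition e_spanned :: "(nat list \<Rightarrow> 'c::comm_ring_1) \<Rightarrow> bool" where
  "e_spanned f \<longleftrightarrow> (\<exists>S c. finite S \<and> (\<forall>lam\<in>S. is_partition lam) \<and>
    (\<forall>a. f a = (\<Sum>lam\<in>S. c lam * e_part lam (exps a))))"

lemma e_spanned_add:
  assumes "e_spanned f" "e_spanned g"
  shows "e_spanned (\<lambda>a. f a + g a)"
proof -
  obtain S c where S: "finite S" "\<forall>lam\<in>S. is_partition lam"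
    and f: "\<And>a. f a = (\<Sum>lam\<in>S. c lam * e_part lam (exps a))"
    using assms(1) unfolding e_spanned_def by blast
  obtain R d where R: "finite R" "\<forall>lam\<in>R. is_partition lam"
    and g: "\<And>a. g a = (\<Sum>lam\<in>R. d lam * e_part lam (exps a))"
    using assms(2) unfolding e_spanned_def by blast
  define b where "b lam = (if lam \<in> S then c lam else 0) + (if lam \<in> R then d lam else 0)" for lam
  have "f a = (\<Sum>lam\<in>S \<union> R. (if lam \<in> S then c lam else 0) * e_part lam (exps a))" for a
    unfolding f using S R by (intro sum.mono_neutral_cong_left) auto
  moreover have "g a = (\<Sum>lam\<in>S \<union> R. (if lam \<in> R then d lam else 0) * e_part lam (exps a))" for a
    unfolding g using S R by (intro sum.mono_neutral_cong_left) auto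
  ultimately have "\<forall>a. f a + g a = (\<Sum>lam\<in>S \<union> R. b lam * e_part lam (exps a))"
    by (simp add: b_def distrib_right sum.distrib)
  then show ?thesis unfolding e_spanned_def using S R by (intro exI[of _ "S \<union> R"] exI[of _ b]) auto
qed

lemma e_spanned_monomial: "is_partition lam \<Longrightarrow> e_spanned (\<lambda>a. c * e_part lam (exps a))"
  unfolding e_spanned_def by (intro exI[of _ "{lam}"] exI[of _ "\<lambda>_. c"]) simp

lemma e_spanned_sum:
  assumes "finite I" "\<And>i. i \<in> I \<Longrightarrow> e_spanned (f i)"
  shows "e_spanned (\<lambda>a. \<Sum>i\<in>I. f i a)"
  using assms
proof (induction I)
  case empty
  show ?case unfolding e_spanned_def by (intro exI[of _ "{}"]) simp
next
  case (insert i I)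
  have "e_spanned (\<lambda>a. f i a + (\<Sum>i\<in>I. f i a))"
    by (rule e_spanned_add) (use insert in auto)
  then show ?case using insert.hyps by simp
qed

text \<open>Elimination from the heaviest partitions downwards, where \<open>m\<close> bounds the
  weights still present. Partitions of equal weight are cleared together: each chosen product has
  coefficient 1 at its own partition and 0 at the others of that weight or more, so subtraction
  alone suffices over any commutative ring.\<close>

lemma symmetric_e_spanned:
  fixes f :: "nat list \<Rightarrow> 'c::comm_ring_1"
  assumes "symmetric_of_degree n f"
  shows "e_spanned f"
proof -
  have step: "e_spanned f" if "symmetric_of_degree n f"
    "\<And>\<nu>. \<nu> \<in> sorted_exps n \<Longrightarrow> m \<le> prefix_weight \<nu> \<Longrightarrow> f \<nu> = 0" for m and f :: "nat list \<Rightarrow> 'c"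
    using that
  proof (induction m arbitrary: f)
    case 0
    have "f a = 0" for a by (rule symmetric_eq_0[OF "0.prems"(1)]) (use "0.prems"(2) in simp)
    then show ?case unfolding e_spanned_def by (intro exI[of _ "{}"]) simp
  next
    case (Suc m)
    let ?D = "{\<mu> \<in> sorted_exps n. prefix_weight \<mu> = m}"
    have "\<forall>\<mu>\<in>sorted_exps n. \<exists>lam. is_partition lam \<and> sum_list lam = n \<and> e_part lam (exps \<mu>) = (1 :: 'c) \<and>
      (\<forall>\<nu>. length \<nu> = n \<longrightarrow> e_part lam (exps \<nu>) \<noteq> (0 :: 'c) \<longrightarrow>
        prefix_weight \<nu> < prefix_weight \<mu> \<or> \<nu> = \<mu>)"
      using e_part_leading[where 'c = 'c] by (fastforce simp: sorted_exps_def)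
    then obtain L where L: "\<And>\<mu>. \<mu> \<in> sorted_exps n \<Longrightarrow> is_partition (L \<mu>)"
      "\<And>\<mu>. \<mu> \<in> sorted_exps n \<Longrightarrow> sum_list (L \<mu>) = n"
      "\<And>\<mu>. \<mu> \<in> sorted_exps n \<Longrightarrow> e_part (L \<mu>) (exps \<mu>) = (1 :: 'c)"
      "\<And>\<mu> \<nu>. \<mu> \<in> sorted_exps n \<Longrightarrow> length \<nu> = n \<Longrightarrow> e_part (L \<mu>) (exps \<nu>) \<noteq> (0 :: 'c) \<Longrightarrow>
        prefix_weight \<nu> < prefix_weight \<mu> \<or> \<nu> = \<mu>"
      by metis
    define g where "g a = (\<Sum>\<mu>\<in>?D. f \<mu> * e_part (L \<mu>) (exps a))" for a
    have finD: "finite ?D" using finite_sorted_exps by simp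
    have g: "e_spanned g"
      unfolding g_def[abs_def] by (rule e_spanned_sum[OF finD], rule e_spanned_monomial) (use L in auto)
    have sym: "symmetric_of_degree n (\<lambda>a. f a - g a)"
    proof -
      have e: "symmetric_of_degree n (\<lambda>a. e_part (L \<mu>) (exps a) :: 'c)" if "\<mu> \<in> ?D" for \<mu>
        using symmetric_of_degree_e_part[of "L \<mu>"] L(2) that by auto
      have "g a = g b" if "mset a = mset b" for a b
        unfolding g_def by (simp add: e_part_mset_cong[OF that])
      moreover have "g (a @ replicate j 0) = g a" for a j
        unfolding g_def by (simp add: exps_append_zeros)
      moreover have "g a = 0" if "sum_list a \<noteq> n" for a
        unfolding g_def
      proof (rule sum.neutral, rule ballI)
        fix \<mu> assume "\<mu> \<in> ?D"
        then have "e_part (L \<mu>) (exps a) = (0 :: 'c)"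
          using e[of \<mu>] that unfolding symmetric_of_degree_def by blast
        then show "f \<mu> * e_part (L \<mu>) (exps a) = 0" by simp
      qed
      ultimately show ?thesis using Suc.prems(1) unfolding symmetric_of_degree_def by (metis diff_zero)
    qed
    have "f \<nu> - g \<nu> = 0" if \<nu>: "\<nu> \<in> sorted_exps n" "m \<le> prefix_weight \<nu>" for \<nu>
    proof -
      have "g \<nu> = (\<Sum>\<mu>\<in>?D. if \<mu> = \<nu> then f \<nu> else 0)"
        unfolding g_def
      proof (rule sum.cong[OF refl])
        fix \<mu> assume \<mu>: "\<mu> \<in> ?D"
        show "f \<mu> * e_part (L \<mu>) (exps \<nu>) = (if \<mu> = \<nu> then f \<nu> else 0)"
        proof (cases "\<mu> = \<nu>")
          case True
          then show ?thesis using L(3) \<nu> by simp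
        next
          case False
          then have "e_part (L \<mu>) (exps \<nu>) = (0 :: 'c)"
            using L(4)[of \<mu> \<nu>] \<mu> \<nu> by (auto simp: sorted_exps_def)
          then show ?thesis using False by simp
        qed
      qed
      also have "\<dots> = f \<nu>"
      proof (cases "prefix_weight \<nu> = m")
        case False
        then have "f \<nu> = 0" using Suc.prems(2)[OF \<nu>(1)] \<nu>(2) by simp
        then show ?thesis by (simp only: if_cancel sum.neutral_const)
      qed (use finD \<nu> in simp)
      finally show ?thesis by simp
    qed
    then have "e_spanned (\<lambda>a. f a - g a)" by (rule Suc.IH[OF sym])
    from e_spanned_add[OF this g] show ?case by simp
  qed
  obtain m where m: "\<And>\<nu>. \<nu> \<in> sorted_exps n \<Longrightarrow> prefix_weight \<nu> < m"
    using finite_imageI[OF finite_sorted_exps, of prefix_weight] unfolding finite_nat_set_iff_bounded by blast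
  show ?thesis
  proof (rule step[OF assms, of m])
    fix \<nu> assume "\<nu> \<in> sorted_exps n" "m \<le> prefix_weight \<nu>"
    then show "f \<nu> = 0" using m[of \<nu>] by simp
  qed
qed

section \<open>The theorem\<close>

lemma prod_list_mset_cong:
  fixes f :: "'b \<Rightarrow> 'r::monoid_mult"
  assumes comm: "\<And>x y. f x * f y = f y * f x" and "mset a = mset b"
  shows "prod_list (map f a) = prod_list (map f b)"
  using assms(2)
proof (induction a arbitrary: b)
  case (Cons x a)
  then have "x \<in> set b" by (metis list.set_intros(1) set_mset_mset)
  then obtain u v where b: "b = u @ x # v" by (meson split_list)
  then have "mset a = mset (u @ v)" using Cons.prems by simp
  then have "prod_list (map f (x # a)) = f x * prod_list (map f u) * prod_list (map f v)"
    using Cons.IH[of "u @ v"] by (simp add: mult.assoc)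
  also have "f x * prod_list (map f u) = prod_list (map f u) * f x"
    by (rule prod_list_commute) (auto simp: comm)
  finally show ?case by (simp add: b mult.assoc)
qed simp

lemma app_sign: "app ((-1) ^ k * f) \<phi> \<beta> = (-1) ^ k * app f \<phi> \<beta>" for f :: "('m \<Rightarrow> 'c::comm_ring_1) endo"
proof (cases "even k")
  case False
  have "app (- f) \<phi> = - app f \<phi>" by transfer simp
  then show ?thesis using False by simp
qed simp

text \<open>The hypothesis \<open>hS\<close>, inserted at the leading factor of a product, is the
  recursion of \<open>list_omega\<close>; \<open>r\<close> collects the factors already
  passed.\<close>

lemma list_omega_prod:
  fixes e h :: "nat \<Rightarrow> ('m \<Rightarrow> 'c::comm_ring_1) endo"
  assumes h0: "h 0 = 1" and hS: "\<And>n. h (Suc n) = (\<Sum>k\<le>n. (-1) ^ k * (e (Suc k) * h (n - k)))"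
  shows "list_omega (\<lambda>b. app (r * prod_list (map e b)) \<phi> \<beta>) a = app (r * prod_list (map h a)) \<phi> \<beta>"
proof (induction "sum_list a + length a" arbitrary: a r rule: less_induct)
  case less
  show ?case
  proof (cases a)
    case (Cons m a')
    show ?thesis
    proof (cases m)
      case 0
      then show ?thesis using less[of a' r] Cons h0 by simp
    next
      case (Suc n)
      have step: "list_omega (\<lambda>b. app (r * prod_list (map e (Suc k # b))) \<phi> \<beta>) ((n - k) # a') =
          app (r * e (Suc k) * prod_list (map h ((n - k) # a'))) \<phi> \<beta>" for k
        using less[of "(n - k) # a'" "r * e (Suc k)"] Cons Suc by (simp add: mult.assoc)
      have sign: "r * ((-1) ^ k * x) = (-1) ^ k * (r * x)" for k and x :: "('m \<Rightarrow> 'c) endo"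
        by (cases "even k") simp_all
      have "r * prod_list (map h a) =
          (\<Sum>k\<le>n. (-1) ^ k * (r * e (Suc k) * prod_list (map h ((n - k) # a'))))"
        by (simp add: Cons Suc hS sum_distrib_left sum_distrib_right mult.assoc sign)
      then have "app (r * prod_list (map h a)) \<phi> \<beta> =
          (\<Sum>k\<le>n. (-1) ^ k * app (r * e (Suc k) * prod_list (map h ((n - k) # a'))) \<phi> \<beta>)"
        by (simp only: app_sum sum_fun_apply app_sign)
      then show ?thesis unfolding Cons Suc list_omega.simps step by simp
    qed
  qed simp
qed

lemma convolution_solve:
  fixes x y :: "nat \<Rightarrow> 'r::ring_1"
  assumes "(\<Sum>k\<le>Suc n. (-1) ^ k * (x k * y (Suc n - k))) = 0" "x 0 = 1"
  shows "y (Suc n) = (\<Sum>k\<le>n. (-1) ^ k * (x (Suc k) * y (n - k)))"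
  using assms unfolding sum.atMost_Suc_shift by (simp add: sum_negf)

lemma convolution_flip:
  fixes x y :: "nat \<Rightarrow> 'r::ring_1"
  assumes "(\<Sum>k\<le>n. (-1) ^ k * (x k * y (n - k))) = 0" and comm: "\<And>i j. x i * y j = y j * x i"
  shows "(\<Sum>k\<le>n. (-1) ^ k * (y k * x (n - k))) = 0"
proof -
  have sign: "(-1) ^ k = (-1) ^ n * ((-1) ^ (n - k) :: 'r)" if "k \<le> n" for k
    using that by (cases "even n"; cases "even k") simp_all
  have "(\<Sum>k\<le>n. (-1) ^ k * (y k * x (n - k))) =
      (\<Sum>k\<le>n. (-1) ^ n * ((-1) ^ (n - k) * (x (n - k) * y k)))"
  proof (rule sum.cong[OF refl])
    fix k assume "k \<in> {..n}"
    then have k: "k \<le> n" by simp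
    show "(-1) ^ k * (y k * x (n - k)) = (-1) ^ n * ((-1) ^ (n - k) * (x (n - k) * y k))"
      by (subst sign[OF k]) (simp only: comm mult.assoc)
  qed
  also have "\<dots> = (-1) ^ n * (\<Sum>k\<le>n. (-1) ^ k * (x k * y (n - k)))"
    unfolding sum_distrib_left
    by (rule sum.reindex_bij_witness[of _ "\<lambda>k. n - k" "\<lambda>k. n - k"]) auto
  finally show ?thesis using assms(1) by simp
qed

theorem F_words_eq_omega_X:
  fixes q :: "'a \<Rightarrow> 'a \<Rightarrow> 'c::comm_ring_1"
  assumes irrefl: "\<And>a. \<not> lt a a" and trans: "\<And>a b c. lt a b \<Longrightarrow> lt b c \<Longrightarrow> lt a c"
    and comparable: "\<And>a b. lt a b \<Longrightarrow> q b a = 1" and A: "finite A" "set_mset \<beta> \<subseteq> A"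
    and comm: "\<And>i j. chain_sum (letter_op q) lt A i * chain_sum (letter_op q) lt A j =
      chain_sum (letter_op q) lt A j * chain_sum (letter_op q) lt A i"
  shows "F_of lt (words \<beta>) (pair_weight q) = omega (X_weighted q lt \<beta>)"
proof -
  let ?E = "chain_sum (letter_op q) lt A" and ?H = "word_sum (letter_op q) (descent_free lt) A"
  let ?F = "F_of lt (words \<beta>) (pair_weight q)" and ?X = "X_weighted q lt \<beta>"
  have E0: "?E 0 = 1" by (simp add: word_sum_0 decreasing_def)
  have H0: "?H 0 = 1" by (simp add: word_sum_0 descent_free_def)
  have conv: "(\<Sum>k\<le>n. (-1) ^ k * (?E k * ?H (n - k))) = 0" if "n > 0" for n
    by (rule decreasing_descent_free_convolution[OF A(1) trans that])
  have HS: "?H (Suc n) = (\<Sum>k\<le>n. (-1) ^ k * (?E (Suc k) * ?H (n - k)))" for n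
    by (rule convolution_solve[OF conv E0]) simp
  \<comment> \<open>By \<open>HS\<close> each \<open>?H n\<close> is a polynomial in the chain sums,
    so it commutes with whatever they commute with.\<close>
  have comm_H: "x * ?H n = ?H n * x" if x: "\<And>k. x * ?E k = ?E k * x" for x n
  proof (induction n rule: less_induct)
    case (less n)
    show ?case
    proof (cases n)
      case (Suc m)
      have "x * ((-1) ^ k * (?E (Suc k) * ?H (m - k))) = (-1) ^ k * (?E (Suc k) * ?H (m - k)) * x" for k
      proof -
        have "x * (?E (Suc k) * ?H (m - k)) = ?E (Suc k) * (x * ?H (m - k))"
          by (simp only: mult.assoc[symmetric] x)
        also have "x * ?H (m - k) = ?H (m - k) * x" by (rule less) (simp add: Suc)
        finally have "x * (?E (Suc k) * ?H (m - k)) = ?E (Suc k) * ?H (m - k) * x"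
          by (simp only: mult.assoc)
        then show ?thesis by (cases "even k") simp_all
      qed
      then show ?thesis unfolding Suc HS sum_distrib_left sum_distrib_right by simp
    qed (simp add: H0)
  qed
  have EH: "?E i * ?H j = ?H j * ?E i" for i j by (rule comm_H) (rule comm)
  have HH: "?H i * ?H j = ?H j * ?H i" for i j by (rule comm_H) (rule EH[symmetric])
  \<comment> \<open>The relation is read in the opposite direction, because the involution will be
    applied to F to obtain X.\<close>
  have ES: "?E (Suc n) = (\<Sum>k\<le>n. (-1) ^ k * (?H (Suc k) * ?E (n - k)))" for n
    by (rule convolution_solve[OF convolution_flip[OF conv EH] H0]) simp
  have F: "?F (exps a) = app (1 * prod_list (map ?H a)) vacuum \<beta>" for a
    by (simp add: F_of_words_exps[OF A])
  \<comment> \<open>Commuting chain sums allow the reversed exponent list to be turned back.\<close>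
  have X: "?X (exps a) = app (1 * prod_list (map ?E a)) vacuum \<beta>" for a
    using X_weighted_exps[of lt q A \<beta> a, OF irrefl trans comparable A]
      prod_list_mset_cong[of ?E "rev a" a, OF comm] by simp
  have XF: "?X (exps a) = list_omega (\<lambda>b. ?F (exps b)) a" for a
    unfolding X F by (rule list_omega_prod[symmetric]) (rule E0, rule ES)
  have "symmetric_of_degree (size \<beta>) (\<lambda>a. ?F (exps a))"
    unfolding symmetric_of_degree_def
  proof (intro conjI allI impI)
    fix a b :: "nat list" and m :: nat
    show "?F (exps a) = ?F (exps b)" if "mset a = mset b"
      unfolding F using prod_list_mset_cong[of ?H, OF HH that] by simp
    show "?F (exps (a @ replicate m 0)) = ?F (exps a)" by (simp only: exps_append_zeros)
    show "sum_list a = size \<beta>" if nz: "?F (exps a) \<noteq> 0"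
    proof (rule ccontr)
      assume "sum_list a \<noteq> size \<beta>"
      then have "length w \<noteq> sum_list a" if "w \<in> words \<beta>" for w
        using that by (auto simp: words_def)
      then have "?F (exps a) = 0"
        unfolding F_of_words_exps[OF A] app_word_sums_vacuum[OF A] by (intro sum.neutral) auto
      then show False using nz by contradiction
    qed
  qed
  then have "e_spanned (\<lambda>a. ?F (exps a))" by (rule symmetric_e_spanned)
  then obtain S c where S: "finite S" "\<forall>lam\<in>S. is_partition lam"
    and c: "\<And>a. ?F (exps a) = (\<Sum>lam\<in>S. c lam * e_part lam (exps a))"
    unfolding e_spanned_def by blast
  have "omega ?X = ?F"
  proof (rule omega_eqI[of S _ c])
    show "finite S" by (rule S)
    show "is_partition lam" if "lam \<in> S" for lam using S that by blast
    fix \<alpha>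
    show "?X \<alpha> = (\<Sum>lam\<in>S. c lam * h_part lam \<alpha>)"
    proof (cases "\<exists>a. \<alpha> = exps a")
      case True
      then obtain a where a: "\<alpha> = exps a" by blast
      \<comment> \<open>Applied termwise to the elementary expansion of F, the involution yields an
        expansion of X in complete products with the same coefficients.\<close>
      show ?thesis unfolding a XF c list_omega_linear list_omega_e_part ..
    next
      case False
      then have "h_part lam \<alpha> = (0 :: 'c)" for lam by (rule h_part_eq_0)
      moreover have "?X \<alpha> = 0" using False by (rule X_weighted_eq_0)
      ultimately show ?thesis by simp
    qed
    show "?F \<alpha> = (\<Sum>lam\<in>S. c lam * e_part lam \<alpha>)"
    proof (cases "\<exists>a. \<alpha> = exps a")
      case True
      then show ?thesis using c by blast
    next
      case False
      then have "e_part lam \<alpha> = (0 :: 'c)" for lam by (rule e_part_eq_0)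
      moreover have "?F \<alpha> = 0" using False by (rule F_of_eq_0)
      ultimately show ?thesis by simp
    qed
  qed
  then show ?thesis by simp
qed

section \<open>Inversions and ascents as pair weights\<close>

definition inversion_factor :: "('a \<Rightarrow> 'a \<Rightarrow> bool) \<Rightarrow> ('a \<Rightarrow> 'a \<Rightarrow> bool) \<Rightarrow> 'a \<Rightarrow> 'a \<Rightarrow> int poly" where
  "inversion_factor lt tot a b = (if tot b a \<and> sim lt a b then monom 1 1 else 1)"

lemma pair_weight_inversion_factor:
  "pair_weight (inversion_factor lt tot) w = monom 1 (inv_P lt tot w)"
proof (induction w)
  case Nil
  then show ?case by (simp add: inv_P_def)
next
  case (Cons a w)
  let ?p = "\<lambda>b. tot b a \<and> sim lt a b"
  let ?I = "{(i, j). i < j \<and> j < length w \<and> tot (w ! j) (w ! i) \<and> sim lt (w ! i) (w ! j)}"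
  have "{(i, j). i < j \<and> j < length (a # w) \<and> tot ((a # w) ! j) ((a # w) ! i) \<and>
      sim lt ((a # w) ! i) ((a # w) ! j)} =
    (\<lambda>j. (0, Suc j)) ` {j. j < length w \<and> ?p (w ! j)} \<union> (\<lambda>(i, j). (Suc i, Suc j)) ` ?I"
    (is "?L = ?R")
  proof (rule set_eqI)
    fix x :: "nat \<times> nat"
    obtain i j where x: "x = (i, j)" by fastforce
    show "x \<in> ?L \<longleftrightarrow> x \<in> ?R"
      unfolding x by (cases i; cases j) (auto simp: image_iff)
  qed
  moreover have "finite ?I"
    by (rule finite_subset[of _ "{..<length w} \<times> {..<length w}"]) auto
  ultimately have "inv_P lt tot (a # w) = card {j. j < length w \<and> ?p (w ! j)} + inv_P lt tot w"
    unfolding inv_P_def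
    by (simp only:) (subst card_Un_disjoint; auto simp: card_image inj_on_def split: prod.splits)
  moreover have "(\<Prod>b\<leftarrow>w. inversion_factor lt tot a b) = monom 1 (length (filter ?p w))"
    by (induction w) (auto simp: inversion_factor_def mult_monom)
  ultimately show ?case using Cons by (simp add: length_filter_conv_card mult_monom)
qed

text \<open>\<open>color_weight\<close> lists the larger color first and \<open>asc\<close> the
  smaller, so pairs correspond by swapping. Copies of one letter are incomparable and ordered by
  number, but their colors decrease, so none is an ascent and comparing letters by
  \<open>tot\<close> is enough.\<close>

lemma color_weight_inversion_factor:
  assumes "\<kappa> \<in> colorings lt \<beta> \<alpha>"
  shows "color_weight (inversion_factor lt tot) \<beta> \<kappa> = monom 1 (asc lt tot \<beta> \<kappa>)"
proof -
  let ?R = "\<lambda>p. \<kappa> (snd p) < \<kappa> (fst p) \<and> tot (fst (snd p)) (fst (fst p)) \<and> sim lt (fst (fst p)) (fst (snd p))"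
  let ?I = "{p \<in> Pbeta \<beta> \<times> Pbeta \<beta>. ?R p}"
  have "color_weight (inversion_factor lt tot) \<beta> \<kappa> =
      (\<Prod>p\<in>Pbeta \<beta> \<times> Pbeta \<beta>. if ?R p then monom 1 1 else 1)"
    unfolding color_weight_def prod.cartesian_product
    by (rule prod.cong) (auto simp: inversion_factor_def)
  also have "\<dots> = (\<Prod>p\<in>?I. monom 1 1)" by (rule prod.inter_filter[symmetric]) simp
  also have "\<dots> = monom 1 (card ?I)" by (simp add: monom_power)
  also have "card ?I = asc lt tot \<beta> \<kappa>"
    unfolding asc_def
  proof (rule bij_betw_same_card[of prod.swap], rule bij_betwI[of _ _ _ prod.swap])
    show "prod.swap \<in> ?I \<rightarrow> {(b, b'). b \<in> Pbeta \<beta> \<and> b' \<in> Pbeta \<beta> \<and> tot_beta tot b b' \<and>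
        incomp_beta lt b b' \<and> \<kappa> b < \<kappa> b'}"
      by (auto simp: tot_beta_def incomp_beta_iff sim_def)
    have "\<kappa> b' < \<kappa> b" if "b \<in> Pbeta \<beta>" "b' \<in> Pbeta \<beta>" "fst b = fst b'" "snd b < snd b'" for b b'
      using assms that unfolding colorings_def by (cases b; cases b') auto
    then show "prod.swap \<in> {(b, b'). b \<in> Pbeta \<beta> \<and> b' \<in> Pbeta \<beta> \<and> tot_beta tot b b' \<and>
        incomp_beta lt b b' \<and> \<kappa> b < \<kappa> b'} \<rightarrow> ?I"
      unfolding tot_beta_def incomp_beta_iff sim_def by fastforce
  qed auto
  finally show ?thesis .
qed

lemma pair_weight_one: "pair_weight (\<lambda>_ _. 1) w = (1 :: 'c::comm_ring_1)"
proof (induction w)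
  case (Cons a w)
  have "(\<Prod>b\<leftarrow>w. 1) = (1 :: 'c)" by (induction w) simp_all
  then show ?case using Cons by simp
qed simp

theorem mainTheorem7:
  fixes P :: "'a set" and lt tot :: "'a \<Rightarrow> 'a \<Rightarrow> bool" and \<beta> :: "'a multiset"
  assumes "finite P" and "strict_poset P lt" and "set_mset \<beta> \<subseteq> P"
  shows "F_W lt \<beta> = omega (X_inc lt \<beta>) \<and>
         (nuio P lt tot \<longrightarrow> F_Wt lt tot \<beta> = omega (X_inc_t lt tot \<beta>))"
proof -
  have irrefl: "\<not> lt a a" for a using assms(2) unfolding strict_poset_def by blast
  have trans: "lt a c" if "lt a b" "lt b c" for a b c
    using assms(2) that unfolding strict_poset_def by blast
  show ?thesis
  proof (intro conjI impI)
    let ?q = "\<lambda>(_ :: 'a) (_ :: 'a). (1 :: int)"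
    let ?E = "chain_sum (letter_op ?q) lt P"
    \<comment> \<open>At t = 1 all factors are 1, so the operators themselves commute for every
      poset.\<close>
    have "letter_op ?q a * letter_op ?q b = letter_op ?q b * letter_op ?q a" for a b :: 'a
      using letter_op_exchange[where q = ?q and a = b and b = a and c = 1] by (simp add: scalar_1)
    then have "?E i * ?E j = ?E j * ?E i" for i j
      by (intro word_sum_commute word_sum_commute[symmetric])
    then have "F_of lt (words \<beta>) (pair_weight ?q) = omega (X_weighted ?q lt \<beta>)"
      by (intro F_words_eq_omega_X[OF irrefl trans _ assms(1,3)]) auto
    moreover have "X_weighted ?q lt \<beta> = X_inc lt \<beta>"
      by (rule ext) (simp add: X_weighted_def X_inc_def color_weight_def)
    moreover have "pair_weight ?q = (\<lambda>_ :: 'a list. 1)" by (rule ext) (rule pair_weight_one)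
    ultimately show "F_W lt \<beta> = omega (X_inc lt \<beta>)" by (simp add: F_W_def)
  next
    assume nuio: "nuio P lt tot"
    let ?q = "inversion_factor lt tot"
    have asym: "\<not> tot b a" if "tot a b" for a b
      using nuio that unfolding nuio_def by blast
    have comparable: "?q a b = 1" "?q b a = 1" if "lt a b" for a b
      using that by (simp_all add: inversion_factor_def sim_def)
    \<comment> \<open>The indeterminate t is \<open>monom 1 1\<close>: an incomparable pair yields
      it only when the larger letter is removed first.\<close>
    interpret unit_interval_relations P lt tot "letter_op ?q" "scalar (monom 1 1)"
    proof
      show "letter_op ?q b * letter_op ?q a = letter_op ?q a * letter_op ?q b" if "lt a b" for a b
        using letter_op_exchange[where q = ?q and a = a and b = b and c = 1] comparable[OF that] by (simp add: scalar_1)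
      show "letter_op ?q b * letter_op ?q a = scalar (monom 1 1) * letter_op ?q a * letter_op ?q b"
        if "tot a b" "sim lt a b" for a b
      proof (rule letter_op_exchange)
        show "?q b a = monom 1 1 * ?q a b"
          using that asym[OF that(1)] by (auto simp: inversion_factor_def sim_def)
      qed
    qed (use assms nuio scalar_letter_op in auto)
    have "F_of lt (words \<beta>) (pair_weight ?q) = omega (X_weighted ?q lt \<beta>)"
      using comparable by (intro F_words_eq_omega_X[OF irrefl trans _ assms(1,3)] chain_sums_commute) auto
    moreover have "X_weighted ?q lt \<beta> = X_inc_t lt tot \<beta>"
      by (rule ext) (simp add: X_weighted_def X_inc_t_def color_weight_inversion_factor)
    moreover have "pair_weight ?q = (\<lambda>w. monom 1 (inv_P lt tot w))"
      by (rule ext) (rule pair_weight_inversion_factor)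
    ultimately show "F_Wt lt tot \<beta> = omega (X_inc_t lt tot \<beta>)" by (simp add: F_Wt_def)
  qed
qed

end
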